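(* Let $H$ be a cocommutative weak Hopf algebra in $\mathcal{C}$, $(A,\varphi_A)$ a weak left $H$-module algebra and $\alpha,\beta\in Reg^{+}_{\varphi_A}(H^2,A)$ both satisfying the twisted condition and the 2-cocycle condition. The weak crossed products $A\otimes_\alpha H$ and $A\otimes_\beta H$ are equivalent if and only if there exists $f\in Reg^{+}_{\varphi_A}(H,A)$ such that $$\mu_A\circ(A\otimes f)\circ\psi_H^A=\mu_A\circ(f\otimes\varphi_A)\circ(\delta_H\otimes A)$$ and $$\alpha\wedge\partial_{1,1}(f)=\partial_{1,0}(f)\wedge\partial_{1,2}(f)\wedge\beta .$$
   Context: Throughout, $\mathcal{C}$ is a strict symmetric monoidal category with tensor product $\otimes$, unit object $K$, symmetry $c$, and equalizers (hence every idempotent $q:Y\to Y$ splits: $q=i\circ p$ with $p\circ i=id$). For an object $P$ and a morphism $f$, $P\otimes f$ means $id_P\otimes f$ (likewise $f\otimes P$). Algebras $(A,\eta_A,\mu_A)$ are unital associative, coalgebras $(D,\varepsilon_D,\delta_D)$ counital coassociative, all in $\mathcal{C}$; $D$ is cocommutative if $c_{D,D}\circ\delta_D=\delta_D$. For coalgebras $D,E$: $\varepsilon_{D\otimes E}=\varepsilon_D\otimes\varepsilon_E$, $\delta_{D\otimes E}=(D\otimes c_{D,E}\otimes E)\circ(\delta_D\otimes\delta_E)$; $H^n$ is the $n$-fold tensor power with the resulting coalgebra structure. For morphisms $f,g:B\to A$ from a coalgebra to an algebra, $f\wedge g=\mu_A\circ(f\otimes g)\circ\delta_B$. A weak Hopf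 algebra $H$ is an algebra and coalgebra in $\mathcal{C}$ with: (a1) $\delta_H\circ\mu_H=(\mu_H\otimes\mu_H)\circ\delta_{H\otimes H}$; (a2) $\varepsilon_H\circ\mu_H\circ(\mu_H\otimes H)=(\varepsilon_H\otimes\varepsilon_H)\circ(\mu_H\otimes\mu_H)\circ(H\otimes\delta_H\otimes H)=(\varepsilon_H\otimes\varepsilon_H)\circ(\mu_H\otimes\mu_H)\circ(H\otimes(c_{H,H}\circ\delta_H)\otimes H)$; (a3) $(\delta_H\otimes H)\circ\delta_H\circ\eta_H=(H\otimes\mu_H\otimes H)\circ(\delta_H\otimes\delta_H)\circ(\eta_H\otimes\eta_H)=(H\otimes(\mu_H\circ c_{H,H})\otimes H)\circ(\delta_H\otimes\delta_H)\circ(\eta_H\otimes\eta_H)$; (a4) there is an antipode $\lambda_H:H\to H$ with $id_H\wedge\lambda_H=\Pi_H^L$, $\lambda_H\wedge id_H=\Pi_H^R$, $\lambda_H\wedge id_H\wedge\lambda_H=\lambda_H$, where $\Pi_H^L=((\varepsilon_H\circ\mu_H)\otimes H)\circ(H\otimes c_{H,H})\circ((\delta_H\circ\eta_H)\otimes H)$ and $\Pi_H^R=(H\otimes(\varepsilon_H\circ\mu_H))\circ(c_{H,H}\otimes H)\circ(H\otimes(\delta_H\circ\eta_H))$. Write $\Pi_H^L=i_L\circ p_L$ for a splitting through an object $H_L$ ($p_L\circ i_L=id_{H_L}$). A weak left $H$-module algebra is an algebra $A$ with $\varphi_A:H\otimes A\to A$ such that (b1) $\varphi_A\circ(\eta_H\otimes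 A)=id_A$; (b2) $\varphi_A\circ(H\otimes\mu_A)=\mu_A\circ(\varphi_A\otimes\varphi_A)\circ(H\otimes c_{H,A}\otimes A)\circ(\delta_H\otimes A\otimes A)$; (b3) $\varphi_A\circ(\mu_H\otimes\eta_A)=\varphi_A\circ(H\otimes(\varphi_A\circ(H\otimes\eta_A)))$; (b6) $\varphi_A\circ(\Pi_H^L\otimes\eta_A)=\varphi_A\circ(H\otimes\eta_A)$ (equivalently (b4) $\varphi_A\circ(\Pi_H^L\otimes A)=\mu_A\circ((\varphi_A\circ(H\otimes\eta_A))\otimes A)$). $u_1=\varphi_A\circ(H\otimes\eta_A)$, $u_2=\varphi_A\circ(\mu_H\otimes\eta_A)$. For $n=1,2$, $Reg_{\varphi_A}(H^n,A)$ is the set of $\sigma:H^n\to A$ for which there is $\sigma^{-1}:H^n\to A$ with $\sigma\wedge\sigma^{-1}=\sigma^{-1}\wedge\sigma=u_n$, $\sigma\wedge\sigma^{-1}\wedge\sigma=\sigma$, $\sigma^{-1}\wedge\sigma\wedge\sigma^{-1}=\sigma^{-1}$. $Reg^+_{\varphi_A}(H,A)=\{h\in Reg_{\varphi_A}(H,A): h\circ i_L=u_1\circ i_L\}$ and $Reg^+_{\varphi_A}(H^2,A)=\{\sigma\in Reg_{\varphi_A}(H^2,A):\sigma\circ(\eta_H\otimes H)=\sigma\circ(H\otimes\eta_H)=u_1\}$. For $h:H\to A$: $\partial_{1,0}(h)=\varphi_A\circ(H\otimes h)$, $\partial_{1,1}(h)=h\circ\mu_H$, $\partial_{1,2}(h)=h\circ\mu_H\circ(H\otimes\Pi_H^L)$.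 For $\sigma:H^2\to A$: $\partial_{2,0}(\sigma)=\varphi_A\circ(H\otimes\sigma)$, $\partial_{2,1}(\sigma)=\sigma\circ(\mu_H\otimes H)$, $\partial_{2,2}(\sigma)=\sigma\circ(H\otimes\mu_H)$, $\partial_{2,3}(\sigma)=\sigma\circ(H\otimes(\mu_H\circ(H\otimes\Pi_H^L)))$. $\psi_H^A=(\varphi_A\otimes H)\circ(H\otimes c_{H,A})\circ(\delta_H\otimes A)$, $\sigma^A_{H,\alpha}=(\alpha\otimes\mu_H)\circ\delta_{H^2}$. Twisted condition for $\alpha$: $\mu_A\circ((\varphi_A\circ(H\otimes\varphi_A))\otimes A)\circ(H\otimes H\otimes c_{A,A})\circ(((H\otimes H\otimes\alpha)\circ\delta_{H^2})\otimes A)=\mu_A\circ(A\otimes\varphi_A)\circ(\sigma^A_{H,\alpha}\otimes A)$. 2-cocycle condition for $\alpha$: $\partial_{2,3}(\alpha)\wedge\partial_{2,1}(\alpha)=\partial_{2,0}(\alpha)\wedge\partial_{2,2}(\alpha)$. $\nabla_{A\otimes H}=(\mu_A\otimes H)\circ(A\otimes\psi_H^A)\circ(A\otimes H\otimes\eta_A)$ is an idempotent, split as $i_{A\otimes H}\circ p_{A\otimes H}$ through $A\times H$. The weak crossed product $A\otimes_\alpha H$ is $A\otimes H$ with the (associative) product $\mu_{A\otimes_\alpha H}=(\mu_A\otimes H)\circ(\mu_A\otimes\sigma^A_{H,\alpha})\circ(A\otimes\psi_H^A\otimes H)$ and preunit $\nu=\nabla_{A\otimes H}\circ(\eta_A\otimes\eta_H)$.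 Its associated algebra $A\times_\alpha H$ is $A\times H$ with unit $p_{A\otimes H}\circ\nu$ and product $p_{A\otimes H}\circ\mu_{A\otimes_\alpha H}\circ(i_{A\otimes H}\otimes i_{A\otimes H})$; it carries the left $A$-action $p_{A\otimes H}\circ(\mu_A\otimes H)\circ(A\otimes i_{A\otimes H})$ and the right $H$-coaction $(p_{A\otimes H}\otimes H)\circ(A\otimes\delta_H)\circ i_{A\otimes H}$. $A\otimes_\alpha H$ and $A\otimes_\beta H$ are equivalent if there is an isomorphism $A\times_\alpha H\to A\times_\beta H$ which is a morphism of algebras, of left $A$-modules and of right $H$-comodules. *)

theory Defs
  imports Main
begin

section \<open>Strict symmetric monoidal categories\<close>

text \<open>
  Composition is a total function on arrows which is only meaningful for composable arrows,
  and \<open>g \<cdot> f\<close> means ``first f, then g''. The tensor product is written \<open>\<odot>\<close> on objects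
  and \<open>\<otimes>\<close> on arrows. ``Strict'' refers to the monoidal structure: associativity and
  unit constraints are identities, the symmetry is arbitrary.
\<close>

record ('o, 'm) category_data =
  Ob :: "'o set"
  Arr :: "'m set"
  Dom :: "'m \<Rightarrow> 'o"
  Cod :: "'m \<Rightarrow> 'o"
  ident :: "'o \<Rightarrow> 'm"
  comp :: "'m \<Rightarrow> 'm \<Rightarrow> 'm"  (infixl "\<cdot>\<index>" 65)
  tensor_ob :: "'o \<Rightarrow> 'o \<Rightarrow> 'o"  (infixl "\<odot>\<index>" 70)
  tensor :: "'m \<Rightarrow> 'm \<Rightarrow> 'm"  (infixl "\<otimes>\<index>" 70)
  unit_ob :: 'o  ("\<K>\<index>")
  braid :: "'o \<Rightarrow> 'o \<Rightarrow> 'm"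

definition hom :: "('o, 'm, 'z) category_data_scheme \<Rightarrow> 'o \<Rightarrow> 'o \<Rightarrow> 'm set" where
  "hom C X Y = {f \<in> Arr C. Dom C f = X \<and> Cod C f = Y}"

locale strict_symmetric_monoidal_category =
  fixes C :: "('o, 'm, 'z) category_data_scheme" (structure)
  assumes dom_closed: "f \<in> Arr C \<Longrightarrow> Dom C f \<in> Ob C"
    and cod_closed: "f \<in> Arr C \<Longrightarrow> Cod C f \<in> Ob C"
    and ident_hom: "X \<in> Ob C \<Longrightarrow> ident C X \<in> hom C X X"
    and comp_hom: "f \<in> hom C X Y \<Longrightarrow> g \<in> hom C Y Z \<Longrightarrow> g \<cdot> f \<in> hom C X Z"
    and comp_assoc:
      "f \<in> hom C W X \<Longrightarrow> g \<in> hom C X Y \<Longrightarrow> h \<in> hom C Y Z \<Longrightarrow> h \<cdot> (g \<cdot> f) = (h \<cdot> g) \<cdot> f"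
    and comp_ident_left: "f \<in> hom C X Y \<Longrightarrow> ident C Y \<cdot> f = f"
    and comp_ident_right: "f \<in> hom C X Y \<Longrightarrow> f \<cdot> ident C X = f"
    and unit_ob_closed: "\<K> \<in> Ob C"
    and tensor_ob_closed: "X \<in> Ob C \<Longrightarrow> Y \<in> Ob C \<Longrightarrow> X \<odot> Y \<in> Ob C"
    and tensor_ob_assoc:
      "X \<in> Ob C \<Longrightarrow> Y \<in> Ob C \<Longrightarrow> Z \<in> Ob C \<Longrightarrow> (X \<odot> Y) \<odot> Z = X \<odot> (Y \<odot> Z)"
    and tensor_ob_unit_left: "X \<in> Ob C \<Longrightarrow> \<K> \<odot> X = X"
    and tensor_ob_unit_right: "X \<in> Ob C \<Longrightarrow> X \<odot> \<K> = X"
    and tensor_hom: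
      "f \<in> hom C X Y \<Longrightarrow> g \<in> hom C Z W \<Longrightarrow> f \<otimes> g \<in> hom C (X \<odot> Z) (Y \<odot> W)"
    and tensor_ident:
      "X \<in> Ob C \<Longrightarrow> Y \<in> Ob C \<Longrightarrow> ident C X \<otimes> ident C Y = ident C (X \<odot> Y)"
    and tensor_comp:
      "f \<in> hom C X Y \<Longrightarrow> f' \<in> hom C Y Z \<Longrightarrow> g \<in> hom C U V \<Longrightarrow> g' \<in> hom C V W \<Longrightarrow>
        (f' \<cdot> f) \<otimes> (g' \<cdot> g) = (f' \<otimes> g') \<cdot> (f \<otimes> g)"
    and tensor_assoc:
      "f \<in> Arr C \<Longrightarrow> g \<in> Arr C \<Longrightarrow> h \<in> Arr C \<Longrightarrow> (f \<otimes> g) \<otimes> h = f \<otimes> (g \<otimes> h)"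
    and tensor_unit_left: "f \<in> Arr C \<Longrightarrow> ident C \<K> \<otimes> f = f"
    and tensor_unit_right: "f \<in> Arr C \<Longrightarrow> f \<otimes> ident C \<K> = f"
    and braid_hom: "X \<in> Ob C \<Longrightarrow> Y \<in> Ob C \<Longrightarrow> braid C X Y \<in> hom C (X \<odot> Y) (Y \<odot> X)"
    and braid_natural:
      "f \<in> hom C X Y \<Longrightarrow> g \<in> hom C Z W \<Longrightarrow>
        braid C Y W \<cdot> (f \<otimes> g) = (g \<otimes> f) \<cdot> braid C X Z"
    and braid_symmetric:
      "X \<in> Ob C \<Longrightarrow> Y \<in> Ob C \<Longrightarrow> braid C Y X \<cdot> braid C X Y = ident C (X \<odot> Y)"
    and braid_hexagon:
      "X \<in> Ob C \<Longrightarrow> Y \<in> Ob C \<Longrightarrow> Z \<in> Ob C \<Longrightarrow>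
        braid C X (Y \<odot> Z) = (ident C Y \<otimes> braid C X Z) \<cdot> (braid C X Y \<otimes> ident C Z)"

section \<open>Algebras, weak Hopf algebras and weak module algebras\<close>

record ('o, 'm) algebra_data =
  obj :: 'o
  unt :: 'm  ("\<eta>\<index>")
  mul :: 'm  ("\<mu>\<index>")

record ('o, 'm) weak_hopf_data = "('o, 'm) algebra_data" +
  counit :: 'm  ("\<epsilon>\<index>")
  comul :: 'm  ("\<delta>\<index>")

record ('o, 'm) module_algebra_data = "('o, 'm) algebra_data" +
  act :: 'm  ("\<phi>\<index>")

context
  fixes C :: "('o, 'm, 'z) category_data_scheme" (structure)
begin

definition has_equalizers :: bool where
  "has_equalizers \<longleftrightarrow>
    (\<forall>X Y. \<forall>f \<in> hom C X Y. \<forall>g \<in> hom C X Y.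
      \<exists>E. \<exists>e \<in> hom C E X. f \<cdot> e = g \<cdot> e \<and>
        (\<forall>W. \<forall>h \<in> hom C W X. f \<cdot> h = g \<cdot> h \<longrightarrow> (\<exists>!k. k \<in> hom C W E \<and> e \<cdot> k = h)))"

definition splits_through :: "'m \<Rightarrow> 'o \<Rightarrow> 'o \<Rightarrow> 'm \<Rightarrow> 'm \<Rightarrow> bool" where
  "splits_through q Y Z i p \<longleftrightarrow>
    i \<in> hom C Z Y \<and> p \<in> hom C Y Z \<and> i \<cdot> p = q \<and> p \<cdot> i = ident C Z"

definition isomorphism :: "'o \<Rightarrow> 'o \<Rightarrow> 'm \<Rightarrow> bool" where
  "isomorphism X Y T \<longleftrightarrow> T \<in> hom C X Y \<and>
    (\<exists>S \<in> hom C Y X. S \<cdot> T = ident C X \<and> T \<cdot> S = ident C Y)"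

abbreviation idn :: "('o, 'm, 'y) algebra_data_scheme \<Rightarrow> 'm"  ("\<I>") where
  "\<I> X \<equiv> ident C (obj X)"

abbreviation sym ::
  "('o, 'm, 'y) algebra_data_scheme \<Rightarrow> ('o, 'm, 'x) algebra_data_scheme \<Rightarrow> 'm"  ("\<c>") where
  "\<c> X Y \<equiv> braid C (obj X) (obj Y)"

definition algebra :: "('o, 'm, 'y) algebra_data_scheme \<Rightarrow> bool" where
  "algebra A \<longleftrightarrow>
    obj A \<in> Ob C \<and>
    \<eta>\<^bsub>A\<^esub> \<in> hom C \<K> (obj A) \<and>
    \<mu>\<^bsub>A\<^esub> \<in> hom C (obj A \<odot> obj A) (obj A) \<and>
    \<mu>\<^bsub>A\<^esub> \<cdot> (\<eta>\<^bsub>A\<^esub> \<otimes> \<I> A) = \<I> A \<and>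
    \<mu>\<^bsub>A\<^esub> \<cdot> (\<I> A \<otimes> \<eta>\<^bsub>A\<^esub>) = \<I> A \<and>
    \<mu>\<^bsub>A\<^esub> \<cdot> (\<mu>\<^bsub>A\<^esub> \<otimes> \<I> A) = \<mu>\<^bsub>A\<^esub> \<cdot> (\<I> A \<otimes> \<mu>\<^bsub>A\<^esub>)"

definition coalgebra :: "('o, 'm, 'y) weak_hopf_data_scheme \<Rightarrow> bool" where
  "coalgebra H \<longleftrightarrow>
    obj H \<in> Ob C \<and>
    \<epsilon>\<^bsub>H\<^esub> \<in> hom C (obj H) \<K> \<and>
    \<delta>\<^bsub>H\<^esub> \<in> hom C (obj H) (obj H \<odot> obj H) \<and>
    (\<epsilon>\<^bsub>H\<^esub> \<otimes> \<I> H) \<cdot> \<delta>\<^bsub>H\<^esub> = \<I> H \<and>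
    (\<I> H \<otimes> \<epsilon>\<^bsub>H\<^esub>) \<cdot> \<delta>\<^bsub>H\<^esub> = \<I> H \<and>
    (\<delta>\<^bsub>H\<^esub> \<otimes> \<I> H) \<cdot> \<delta>\<^bsub>H\<^esub> = (\<I> H \<otimes> \<delta>\<^bsub>H\<^esub>) \<cdot> \<delta>\<^bsub>H\<^esub>"

definition cocommutative :: "('o, 'm, 'y) weak_hopf_data_scheme \<Rightarrow> bool" where
  "cocommutative H \<longleftrightarrow> \<c> H H \<cdot> \<delta>\<^bsub>H\<^esub> = \<delta>\<^bsub>H\<^esub>"

text \<open>Coproduct of the tensor product of coalgebras with objects X, Y and coproducts d, e.\<close>

definition tensor_comul :: "'o \<Rightarrow> 'm \<Rightarrow> 'o \<Rightarrow> 'm \<Rightarrow> 'm" where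
  "tensor_comul X d Y e = (ident C X \<otimes> braid C X Y \<otimes> ident C Y) \<cdot> (d \<otimes> e)"

definition comul2 :: "('o, 'm, 'y) weak_hopf_data_scheme \<Rightarrow> 'm" where
  "comul2 H = tensor_comul (obj H) \<delta>\<^bsub>H\<^esub> (obj H) \<delta>\<^bsub>H\<^esub>"

definition comul3 :: "('o, 'm, 'y) weak_hopf_data_scheme \<Rightarrow> 'm" where
  "comul3 H = tensor_comul (obj H \<odot> obj H) (comul2 H) (obj H) \<delta>\<^bsub>H\<^esub>"

text \<open>Convolution \<open>f \<and> g\<close> of arrows from a coalgebra with coproduct d to the algebra A.\<close>

definition conv :: "'m \<Rightarrow> ('o, 'm, 'y) algebra_data_scheme \<Rightarrow> 'm \<Rightarrow> 'm \<Rightarrow> 'm" where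
  "conv d A f g = \<mu>\<^bsub>A\<^esub> \<cdot> (f \<otimes> g) \<cdot> d"

definition Pi_L :: "('o, 'm, 'y) weak_hopf_data_scheme \<Rightarrow> 'm" where
  "Pi_L H = ((\<epsilon>\<^bsub>H\<^esub> \<cdot> \<mu>\<^bsub>H\<^esub>) \<otimes> \<I> H) \<cdot> (\<I> H \<otimes> \<c> H H) \<cdot> ((\<delta>\<^bsub>H\<^esub> \<cdot> \<eta>\<^bsub>H\<^esub>) \<otimes> \<I> H)"

definition Pi_R :: "('o, 'm, 'y) weak_hopf_data_scheme \<Rightarrow> 'm" where
  "Pi_R H = (\<I> H \<otimes> (\<epsilon>\<^bsub>H\<^esub> \<cdot> \<mu>\<^bsub>H\<^esub>)) \<cdot> (\<c> H H \<otimes> \<I> H) \<cdot> (\<I> H \<otimes> (\<delta>\<^bsub>H\<^esub> \<cdot> \<eta>\<^bsub>H\<^esub>))"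

definition antipode :: "('o, 'm, 'y) weak_hopf_data_scheme \<Rightarrow> 'm \<Rightarrow> bool" where
  "antipode H s \<longleftrightarrow>
    s \<in> hom C (obj H) (obj H) \<and>
    conv \<delta>\<^bsub>H\<^esub> H (\<I> H) s = Pi_L H \<and>
    conv \<delta>\<^bsub>H\<^esub> H s (\<I> H) = Pi_R H \<and>
    conv \<delta>\<^bsub>H\<^esub> H (conv \<delta>\<^bsub>H\<^esub> H s (\<I> H)) s = s"

definition weak_hopf_algebra :: "('o, 'm, 'y) weak_hopf_data_scheme \<Rightarrow> bool" where
  "weak_hopf_algebra H \<longleftrightarrow>
    algebra H \<and> coalgebra H \<and>
    \<delta>\<^bsub>H\<^esub> \<cdot> \<mu>\<^bsub>H\<^esub> = (\<mu>\<^bsub>H\<^esub> \<otimes> \<mu>\<^bsub>H\<^esub>) \<cdot> comul2 H \<and>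
    \<epsilon>\<^bsub>H\<^esub> \<cdot> \<mu>\<^bsub>H\<^esub> \<cdot> (\<mu>\<^bsub>H\<^esub> \<otimes> \<I> H) =
      (\<epsilon>\<^bsub>H\<^esub> \<otimes> \<epsilon>\<^bsub>H\<^esub>) \<cdot> (\<mu>\<^bsub>H\<^esub> \<otimes> \<mu>\<^bsub>H\<^esub>) \<cdot> (\<I> H \<otimes> \<delta>\<^bsub>H\<^esub> \<otimes> \<I> H) \<and>
    \<epsilon>\<^bsub>H\<^esub> \<cdot> \<mu>\<^bsub>H\<^esub> \<cdot> (\<mu>\<^bsub>H\<^esub> \<otimes> \<I> H) =
      (\<epsilon>\<^bsub>H\<^esub> \<otimes> \<epsilon>\<^bsub>H\<^esub>) \<cdot> (\<mu>\<^bsub>H\<^esub> \<otimes> \<mu>\<^bsub>H\<^esub>) \<cdot> (\<I> H \<otimes> (\<c> H H \<cdot> \<delta>\<^bsub>H\<^esub>) \<otimes> \<I> H) \<and>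
    (\<delta>\<^bsub>H\<^esub> \<otimes> \<I> H) \<cdot> \<delta>\<^bsub>H\<^esub> \<cdot> \<eta>\<^bsub>H\<^esub> =
      (\<I> H \<otimes> \<mu>\<^bsub>H\<^esub> \<otimes> \<I> H) \<cdot> (\<delta>\<^bsub>H\<^esub> \<otimes> \<delta>\<^bsub>H\<^esub>) \<cdot> (\<eta>\<^bsub>H\<^esub> \<otimes> \<eta>\<^bsub>H\<^esub>) \<and>
    (\<delta>\<^bsub>H\<^esub> \<otimes> \<I> H) \<cdot> \<delta>\<^bsub>H\<^esub> \<cdot> \<eta>\<^bsub>H\<^esub> =
      (\<I> H \<otimes> (\<mu>\<^bsub>H\<^esub> \<cdot> \<c> H H) \<otimes> \<I> H) \<cdot> (\<delta>\<^bsub>H\<^esub> \<otimes> \<delta>\<^bsub>H\<^esub>) \<cdot> (\<eta>\<^bsub>H\<^esub> \<otimes> \<eta>\<^bsub>H\<^esub>) \<and>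
    (\<exists>s. antipode H s)"

definition weak_module_algebra ::
  "('o, 'm, 'y) weak_hopf_data_scheme \<Rightarrow> ('o, 'm, 'x) module_algebra_data_scheme \<Rightarrow> bool" where
  "weak_module_algebra H A \<longleftrightarrow>
    algebra A \<and>
    \<phi>\<^bsub>A\<^esub> \<in> hom C (obj H \<odot> obj A) (obj A) \<and>
    \<phi>\<^bsub>A\<^esub> \<cdot> (\<eta>\<^bsub>H\<^esub> \<otimes> \<I> A) = \<I> A \<and>
    \<phi>\<^bsub>A\<^esub> \<cdot> (\<I> H \<otimes> \<mu>\<^bsub>A\<^esub>) =
      \<mu>\<^bsub>A\<^esub> \<cdot> (\<phi>\<^bsub>A\<^esub> \<otimes> \<phi>\<^bsub>A\<^esub>) \<cdot> (\<I> H \<otimes> \<c> H A \<otimes> \<I> A) \<cdot> (\<delta>\<^bsub>H\<^esub> \<otimes> \<I> A \<otimes> \<I> A) \<and>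
    \<phi>\<^bsub>A\<^esub> \<cdot> (\<mu>\<^bsub>H\<^esub> \<otimes> \<eta>\<^bsub>A\<^esub>) = \<phi>\<^bsub>A\<^esub> \<cdot> (\<I> H \<otimes> (\<phi>\<^bsub>A\<^esub> \<cdot> (\<I> H \<otimes> \<eta>\<^bsub>A\<^esub>))) \<and>
    \<phi>\<^bsub>A\<^esub> \<cdot> (Pi_L H \<otimes> \<eta>\<^bsub>A\<^esub>) = \<phi>\<^bsub>A\<^esub> \<cdot> (\<I> H \<otimes> \<eta>\<^bsub>A\<^esub>)"

section \<open>Regular morphisms and cosimplicial operators\<close>

definition u1 ::
  "('o, 'm, 'y) weak_hopf_data_scheme \<Rightarrow> ('o, 'm, 'x) module_algebra_data_scheme \<Rightarrow> 'm" where
  "u1 H A = \<phi>\<^bsub>A\<^esub> \<cdot> (\<I> H \<otimes> \<eta>\<^bsub>A\<^esub>)"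

definition u2 ::
  "('o, 'm, 'y) weak_hopf_data_scheme \<Rightarrow> ('o, 'm, 'x) module_algebra_data_scheme \<Rightarrow> 'm" where
  "u2 H A = \<phi>\<^bsub>A\<^esub> \<cdot> (\<mu>\<^bsub>H\<^esub> \<otimes> \<eta>\<^bsub>A\<^esub>)"

text \<open>Arrows from the coalgebra (D, d) to A that are regular relative to the arrow u.\<close>

definition regular :: "'o \<Rightarrow> 'm \<Rightarrow> ('o, 'm, 'x) algebra_data_scheme \<Rightarrow> 'm \<Rightarrow> 'm set" where
  "regular D d A u = {s \<in> hom C D (obj A). \<exists>t \<in> hom C D (obj A).
    conv d A s t = u \<and> conv d A t s = u \<and>
    conv d A (conv d A s t) s = s \<and> conv d A (conv d A t s) t = t}"

definition Reg1 ::
  "('o, 'm, 'y) weak_hopf_data_scheme \<Rightarrow> ('o, 'm, 'x) module_algebra_data_scheme \<Rightarrow> 'm set" where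
  "Reg1 H A = regular (obj H) \<delta>\<^bsub>H\<^esub> A (u1 H A)"

definition Reg2 ::
  "('o, 'm, 'y) weak_hopf_data_scheme \<Rightarrow> ('o, 'm, 'x) module_algebra_data_scheme \<Rightarrow> 'm set" where
  "Reg2 H A = regular (obj H \<odot> obj H) (comul2 H) A (u2 H A)"

definition Reg1_plus ::
  "('o, 'm, 'y) weak_hopf_data_scheme \<Rightarrow> ('o, 'm, 'x) module_algebra_data_scheme \<Rightarrow>
    'm \<Rightarrow> 'm set" where
  "Reg1_plus H A i_L = {h \<in> Reg1 H A. h \<cdot> i_L = u1 H A \<cdot> i_L}"

definition Reg2_plus ::
  "('o, 'm, 'y) weak_hopf_data_scheme \<Rightarrow> ('o, 'm, 'x) module_algebra_data_scheme \<Rightarrow> 'm set" where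
  "Reg2_plus H A =
    {s \<in> Reg2 H A. s \<cdot> (\<eta>\<^bsub>H\<^esub> \<otimes> \<I> H) = u1 H A \<and> s \<cdot> (\<I> H \<otimes> \<eta>\<^bsub>H\<^esub>) = u1 H A}"

definition d10 ::
  "('o, 'm, 'y) weak_hopf_data_scheme \<Rightarrow> ('o, 'm, 'x) module_algebra_data_scheme \<Rightarrow>
    'm \<Rightarrow> 'm" where
  "d10 H A h = \<phi>\<^bsub>A\<^esub> \<cdot> (\<I> H \<otimes> h)"

definition d11 :: "('o, 'm, 'y) weak_hopf_data_scheme \<Rightarrow> 'm \<Rightarrow> 'm" where
  "d11 H h = h \<cdot> \<mu>\<^bsub>H\<^esub>"

definition d12 :: "('o, 'm, 'y) weak_hopf_data_scheme \<Rightarrow> 'm \<Rightarrow> 'm" where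
  "d12 H h = h \<cdot> \<mu>\<^bsub>H\<^esub> \<cdot> (\<I> H \<otimes> Pi_L H)"

definition d20 ::
  "('o, 'm, 'y) weak_hopf_data_scheme \<Rightarrow> ('o, 'm, 'x) module_algebra_data_scheme \<Rightarrow>
    'm \<Rightarrow> 'm" where
  "d20 H A s = \<phi>\<^bsub>A\<^esub> \<cdot> (\<I> H \<otimes> s)"

definition d21 :: "('o, 'm, 'y) weak_hopf_data_scheme \<Rightarrow> 'm \<Rightarrow> 'm" where
  "d21 H s = s \<cdot> (\<mu>\<^bsub>H\<^esub> \<otimes> \<I> H)"

definition d22 :: "('o, 'm, 'y) weak_hopf_data_scheme \<Rightarrow> 'm \<Rightarrow> 'm" where
  "d22 H s = s \<cdot> (\<I> H \<otimes> \<mu>\<^bsub>H\<^esub>)"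

definition d23 :: "('o, 'm, 'y) weak_hopf_data_scheme \<Rightarrow> 'm \<Rightarrow> 'm" where
  "d23 H s = s \<cdot> (\<I> H \<otimes> (\<mu>\<^bsub>H\<^esub> \<cdot> (\<I> H \<otimes> Pi_L H)))"

section \<open>Weak crossed products and their equivalence\<close>

definition psi ::
  "('o, 'm, 'y) weak_hopf_data_scheme \<Rightarrow> ('o, 'm, 'x) module_algebra_data_scheme \<Rightarrow> 'm" where
  "psi H A = (\<phi>\<^bsub>A\<^esub> \<otimes> \<I> H) \<cdot> (\<I> H \<otimes> \<c> H A) \<cdot> (\<delta>\<^bsub>H\<^esub> \<otimes> \<I> A)"

definition sigma :: "('o, 'm, 'y) weak_hopf_data_scheme \<Rightarrow> 'm \<Rightarrow> 'm" where
  "sigma H \<alpha> = (\<alpha> \<otimes> \<mu>\<^bsub>H\<^esub>) \<cdot> comul2 H"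

definition twisted_condition ::
  "('o, 'm, 'y) weak_hopf_data_scheme \<Rightarrow> ('o, 'm, 'x) module_algebra_data_scheme \<Rightarrow>
    'm \<Rightarrow> bool" where
  "twisted_condition H A \<alpha> \<longleftrightarrow>
    \<mu>\<^bsub>A\<^esub> \<cdot> ((\<phi>\<^bsub>A\<^esub> \<cdot> (\<I> H \<otimes> \<phi>\<^bsub>A\<^esub>)) \<otimes> \<I> A) \<cdot> (\<I> H \<otimes> \<I> H \<otimes> \<c> A A)
      \<cdot> (((\<I> H \<otimes> \<I> H \<otimes> \<alpha>) \<cdot> comul2 H) \<otimes> \<I> A)
    = \<mu>\<^bsub>A\<^esub> \<cdot> (\<I> A \<otimes> \<phi>\<^bsub>A\<^esub>) \<cdot> (sigma H \<alpha> \<otimes> \<I> A)"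

definition cocycle_condition ::
  "('o, 'm, 'y) weak_hopf_data_scheme \<Rightarrow> ('o, 'm, 'x) module_algebra_data_scheme \<Rightarrow>
    'm \<Rightarrow> bool" where
  "cocycle_condition H A \<alpha> \<longleftrightarrow>
    conv (comul3 H) A (d23 H \<alpha>) (d21 H \<alpha>) = conv (comul3 H) A (d20 H A \<alpha>) (d22 H \<alpha>)"

definition nabla ::
  "('o, 'm, 'y) weak_hopf_data_scheme \<Rightarrow> ('o, 'm, 'x) module_algebra_data_scheme \<Rightarrow> 'm" where
  "nabla H A = (\<mu>\<^bsub>A\<^esub> \<otimes> \<I> H) \<cdot> (\<I> A \<otimes> psi H A) \<cdot> (\<I> A \<otimes> \<I> H \<otimes> \<eta>\<^bsub>A\<^esub>)"

definition wcp_mul ::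
  "('o, 'm, 'y) weak_hopf_data_scheme \<Rightarrow> ('o, 'm, 'x) module_algebra_data_scheme \<Rightarrow>
    'm \<Rightarrow> 'm" where
  "wcp_mul H A \<alpha> = (\<mu>\<^bsub>A\<^esub> \<otimes> \<I> H) \<cdot> (\<mu>\<^bsub>A\<^esub> \<otimes> sigma H \<alpha>) \<cdot> (\<I> A \<otimes> psi H A \<otimes> \<I> H)"

definition wcp_preunit ::
  "('o, 'm, 'y) weak_hopf_data_scheme \<Rightarrow> ('o, 'm, 'x) module_algebra_data_scheme \<Rightarrow> 'm" where
  "wcp_preunit H A = nabla H A \<cdot> (\<eta>\<^bsub>A\<^esub> \<otimes> \<eta>\<^bsub>H\<^esub>)"

text \<open>
  In the following, \<open>i \<cdot> p\<close> is a splitting of \<open>nabla H A\<close> through the object Z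
  (the object \<open>A \<times> H\<close>).
\<close>

definition wcp_algebra ::
  "('o, 'm, 'y) weak_hopf_data_scheme \<Rightarrow> ('o, 'm, 'x) module_algebra_data_scheme \<Rightarrow>
    'o \<Rightarrow> 'm \<Rightarrow> 'm \<Rightarrow> 'm \<Rightarrow> ('o, 'm) algebra_data" where
  "wcp_algebra H A Z i p \<alpha> =
    \<lparr>obj = Z, unt = p \<cdot> wcp_preunit H A, mul = p \<cdot> wcp_mul H A \<alpha> \<cdot> (i \<otimes> i)\<rparr>"

definition wcp_act ::
  "('o, 'm, 'y) weak_hopf_data_scheme \<Rightarrow> ('o, 'm, 'x) module_algebra_data_scheme \<Rightarrow>
    'm \<Rightarrow> 'm \<Rightarrow> 'm" where
  "wcp_act H A i p = p \<cdot> (\<mu>\<^bsub>A\<^esub> \<otimes> \<I> H) \<cdot> (\<I> A \<otimes> i)"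

definition wcp_coact ::
  "('o, 'm, 'y) weak_hopf_data_scheme \<Rightarrow> ('o, 'm, 'x) module_algebra_data_scheme \<Rightarrow>
    'm \<Rightarrow> 'm \<Rightarrow> 'm" where
  "wcp_coact H A i p = (p \<otimes> \<I> H) \<cdot> (\<I> A \<otimes> \<delta>\<^bsub>H\<^esub>) \<cdot> i"

definition algebra_morphism ::
  "('o, 'm, 'y) algebra_data_scheme \<Rightarrow> ('o, 'm, 'x) algebra_data_scheme \<Rightarrow> 'm \<Rightarrow> bool" where
  "algebra_morphism B B' T \<longleftrightarrow>
    T \<in> hom C (obj B) (obj B') \<and> T \<cdot> \<eta>\<^bsub>B\<^esub> = \<eta>\<^bsub>B'\<^esub> \<and> T \<cdot> \<mu>\<^bsub>B\<^esub> = \<mu>\<^bsub>B'\<^esub> \<cdot> (T \<otimes> T)"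

definition left_module_morphism ::
  "('o, 'm, 'y) algebra_data_scheme \<Rightarrow> 'o \<Rightarrow> 'm \<Rightarrow> 'o \<Rightarrow> 'm \<Rightarrow> 'm \<Rightarrow> bool" where
  "left_module_morphism A M a N b T \<longleftrightarrow> T \<in> hom C M N \<and> T \<cdot> a = b \<cdot> (\<I> A \<otimes> T)"

definition right_comodule_morphism ::
  "('o, 'm, 'y) weak_hopf_data_scheme \<Rightarrow> 'o \<Rightarrow> 'm \<Rightarrow> 'o \<Rightarrow> 'm \<Rightarrow> 'm \<Rightarrow> bool" where
  "right_comodule_morphism H M r N s T \<longleftrightarrow> T \<in> hom C M N \<and> s \<cdot> T = (T \<otimes> \<I> H) \<cdot> r"

definition equivalent_wcp ::
  "('o, 'm, 'y) weak_hopf_data_scheme \<Rightarrow> ('o, 'm, 'x) module_algebra_data_scheme \<Rightarrow>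
    'o \<Rightarrow> 'm \<Rightarrow> 'm \<Rightarrow> 'm \<Rightarrow> 'm \<Rightarrow> bool" where
  "equivalent_wcp H A Z i p \<alpha> \<beta> \<longleftrightarrow>
    (\<exists>T. isomorphism Z Z T \<and>
      algebra_morphism (wcp_algebra H A Z i p \<alpha>) (wcp_algebra H A Z i p \<beta>) T \<and>
      left_module_morphism A Z (wcp_act H A i p) Z (wcp_act H A i p) T \<and>
      right_comodule_morphism H Z (wcp_coact H A i p) Z (wcp_coact H A i p) T)"

end

end

theory Submission
  imports Defs
begin

text \<open>
  In Sweedler notation, put \<open>u x = x \<cdot> 1\<close>. An endomorphism of \<open>A \<otimes> H\<close> that is left \<open>A\<close>-linear and
  right \<open>H\<close>-colinear has the form \<open>T\<^sub>f (a \<otimes> x) = a f(x\<^sub>1) \<otimes> x\<^sub>2\<close>; composition of such maps is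
  convolution of the \<open>f\<close>, and the idempotent \<open>nabla\<close> is \<open>T\<^sub>u\<close>. Hence isomorphisms of \<open>A \<times> H\<close> of this
  kind correspond to regular \<open>f\<close>. Preservation of the unit means \<open>f(1\<^sub>1) \<otimes> 1\<^sub>2 = u(1\<^sub>1) \<otimes> 1\<^sub>2\<close>, that is,
  \<open>f \<circ> Pi_L = u\<close>, and multiplicativity is the single identity
  \<open>(x\<^sub>1 \<cdot> b) \<alpha>(x\<^sub>2, y\<^sub>1) f(x\<^sub>3 y\<^sub>2) = f(x\<^sub>1) (x\<^sub>2 \<cdot> (b f(y\<^sub>1))) \<beta>(x\<^sub>3, y\<^sub>2)\<close>.
  Putting \<open>y = 1\<close> gives the commutation condition on \<open>f\<close>; putting \<open>b = 1\<close> and commuting \<open>f\<close> past the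
  action gives the coboundary condition, because \<open>x Pi_L(y) = \<epsilon>(x\<^sub>1 y) x\<^sub>2\<close> and \<open>\<beta>\<close> absorbs \<open>\<epsilon>(x y)\<close>.
  Conversely the two conditions together give the identity.
\<close>

section \<open>Strict symmetric monoidal categories and comodules\<close>

context strict_symmetric_monoidal_category
begin

text \<open>An abstract \<open>C\<close> has no elements, so a Sweedler variable becomes an arrow
  into \<open>H\<close> from an auxiliary coalgebra \<open>D\<close>; duplicating it is legitimate
  when the arrow is comultiplicative. Cocommutativity makes the order of the copies irrelevant and
  keeps products of such arrows comultiplicative. The argument in \<open>A\<close> occurs once in
  each formula, so it needs only a comodule over \<open>D\<close>. The obstacle is the unit: in a
  weak Hopf algebra \<open>\<eta>\<close> is not comultiplicative, so \<open>y = 1\<close> cannot be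
  substituted inside the calculus. It is substituted into finished identities, and the leftover
  \<open>1_1 \<otimes> 1_2\<close> is controlled by
  \<open>1_1 \<otimes> Pi_L(1_2) = 1_1 \<otimes> 1_2\<close> and the formula for
  \<open>x Pi_L(y)\<close>. Preservation of the unit is what makes \<open>y = 1\<close> fruitful:
  there the inner factor \<open>f(y_1)\<close> can be traded for \<open>u(y_1)\<close>, which
  \<open>\<beta>\<close> absorbs, and \<open>\<alpha>(x, 1) = \<beta>(x, 1) = u(x)\<close> removes
  the cocycles. Comments write \<open>x.b\<close> for the action of \<open>x\<close> on
  \<open>b\<close>.\<close>

lemma in_hom: "f \<in> hom C X Y \<longleftrightarrow> f \<in> Arr C \<and> Dom C f = X \<and> Cod C f = Y"
  by (auto simp: hom_def)

lemma arr_hom: "f \<in> Arr C \<Longrightarrow> f \<in> hom C (Dom C f) (Cod C f)"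
  by (simp add: in_hom)

declare dom_closed [simp] cod_closed [simp] unit_ob_closed [simp] tensor_ob_closed [simp]
  tensor_ob_assoc [simp] tensor_ob_unit_left [simp] tensor_ob_unit_right [simp]
  tensor_ident [simp] tensor_unit_left [simp] tensor_unit_right [simp]

lemma ident_arr [simp]:
  assumes "X \<in> Ob C"
  shows "ident C X \<in> Arr C" "Dom C (ident C X) = X" "Cod C (ident C X) = X"
  using ident_hom[OF assms] by (auto simp: in_hom)

lemma comp_arr [simp]:
  assumes "f \<in> Arr C" "g \<in> Arr C" "Dom C g = Cod C f"
  shows "g \<cdot> f \<in> Arr C" "Dom C (g \<cdot> f) = Dom C f" "Cod C (g \<cdot> f) = Cod C g"
  using comp_hom[of f "Dom C f" "Cod C f" g "Cod C g"] assms by (auto simp: in_hom)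

lemma tensor_arr [simp]:
  assumes "f \<in> Arr C" "g \<in> Arr C"
  shows "f \<otimes> g \<in> Arr C" "Dom C (f \<otimes> g) = Dom C f \<odot> Dom C g"
    "Cod C (f \<otimes> g) = Cod C f \<odot> Cod C g"
  using tensor_hom[of f "Dom C f" "Cod C f" g "Dom C g" "Cod C g"] assms by (auto simp: in_hom)

lemma braid_arr [simp]:
  assumes "X \<in> Ob C" "Y \<in> Ob C"
  shows "braid C X Y \<in> Arr C" "Dom C (braid C X Y) = X \<odot> Y" "Cod C (braid C X Y) = Y \<odot> X"
  using braid_hom[OF assms] by (auto simp: in_hom)

lemma comp_ident [simp]:
  assumes "f \<in> Arr C"
  shows "Cod C f = Y \<Longrightarrow> ident C Y \<cdot> f = f" "Dom C f = X \<Longrightarrow> f \<cdot> ident C X = f"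
  using comp_ident_left comp_ident_right arr_hom[OF assms] by auto

lemma assoc:
  assumes "f \<in> Arr C" "g \<in> Arr C" "h \<in> Arr C" "Dom C g = Cod C f" "Dom C h = Cod C g"
  shows "(h \<cdot> g) \<cdot> f = h \<cdot> (g \<cdot> f)"
  using comp_assoc[of f "Dom C f" "Cod C f" g "Cod C g" h "Cod C h"] assms by (auto simp: in_hom)

lemma interchange:
  assumes "f \<in> Arr C" "f' \<in> Arr C" "g \<in> Arr C" "g' \<in> Arr C" "Dom C f' = Cod C f" "Dom C g' = Cod C g"
  shows "(f' \<otimes> g') \<cdot> (f \<otimes> g) = (f' \<cdot> f) \<otimes> (g' \<cdot> g)"
  using tensor_comp[of f "Dom C f" "Cod C f" f' "Cod C f'" g "Dom C g" "Cod C g" g' "Cod C g'"] assms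
  by (auto simp: in_hom)

lemma interchange_tail:
  assumes "f \<in> Arr C" "f' \<in> Arr C" "g \<in> Arr C" "g' \<in> Arr C" "Dom C f' = Cod C f" "Dom C g' = Cod C g"
    "k \<in> Arr C" "Cod C k = Dom C f \<odot> Dom C g"
  shows "(f' \<otimes> g') \<cdot> ((f \<otimes> g) \<cdot> k) = ((f' \<cdot> f) \<otimes> (g' \<cdot> g)) \<cdot> k"
  using assms by (simp add: interchange flip: assoc)

lemma naturality:
  assumes "f \<in> Arr C" "g \<in> Arr C" "Dom C f = X" "Cod C f = Y" "Dom C g = Z" "Cod C g = W"
  shows "braid C Y W \<cdot> (f \<otimes> g) = (g \<otimes> f) \<cdot> braid C X Z"
  using braid_natural[of f X Y g Z W] assms by (auto simp: in_hom)

lemma naturality_tail: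
  assumes "f \<in> Arr C" "g \<in> Arr C" "Dom C f = X" "Cod C f = Y" "Dom C g = Z" "Cod C g = W"
    "k \<in> Arr C" "Cod C k = X \<odot> Z"
  shows "braid C Y W \<cdot> ((f \<otimes> g) \<cdot> k) = (g \<otimes> f) \<cdot> (braid C X Z \<cdot> k)"
proof -
  have [simp]: "X \<in> Ob C" "Y \<in> Ob C" "Z \<in> Ob C" "W \<in> Ob C" using assms by auto
  have "braid C Y W \<cdot> ((f \<otimes> g) \<cdot> k) = (braid C Y W \<cdot> (f \<otimes> g)) \<cdot> k"
    using assms by (intro assoc[symmetric]) simp_all
  also have "\<dots> = ((g \<otimes> f) \<cdot> braid C X Z) \<cdot> k"
    using naturality assms(1-6) by simp
  also have "\<dots> = (g \<otimes> f) \<cdot> (braid C X Z \<cdot> k)"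
    using assms by (intro assoc) simp_all
  finally show ?thesis .
qed

lemma braid_inverse [simp]:
  "X \<in> Ob C \<Longrightarrow> Y \<in> Ob C \<Longrightarrow> braid C Y X \<cdot> braid C X Y = ident C (X \<odot> Y)"
  by (rule braid_symmetric)

text \<open>The hexagon with both trailing objects equal to \<open>\<K>\<close> makes this braiding
  idempotent, and an invertible idempotent is an identity.\<close>

lemma braid_unit_right [simp]:
  assumes [simp]: "X \<in> Ob C" shows "braid C X \<K> = ident C X"
proof -
  let ?b = "braid C X \<K>"
  have "?b = braid C X (\<K> \<odot> \<K>)" by simp
  also have "\<dots> = (ident C \<K> \<otimes> ?b) \<cdot> (?b \<otimes> ident C \<K>)" by (rule braid_hexagon) simp_all
  finally have idem: "?b \<cdot> ?b = ?b" by simp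
  have inv: "braid C \<K> X \<cdot> ?b = ident C X"
    using braid_symmetric[of X \<K>] by simp
  have "?b = (braid C \<K> X \<cdot> ?b) \<cdot> ?b" by (simp add: inv)
  also have "\<dots> = braid C \<K> X \<cdot> (?b \<cdot> ?b)" by (rule assoc) simp_all
  also have "\<dots> = ident C X" by (simp only: idem inv)
  finally show ?thesis .
qed

lemma braid_unit_left [simp]:
  assumes [simp]: "X \<in> Ob C" shows "braid C \<K> X = ident C X"
  using braid_symmetric[of X \<K>] by simp

text \<open>Only one hexagon is an axiom. The other follows by symmetry, since both sides are
  inverse to \<open>braid C Z (X \<odot> Y)\<close>.\<close>

lemma braid_hexagon':
  assumes [simp]: "X \<in> Ob C" "Y \<in> Ob C" "Z \<in> Ob C"
  shows "braid C (X \<odot> Y) Z = (braid C X Z \<otimes> ident C Y) \<cdot> (ident C X \<otimes> braid C Y Z)" (is "_ = ?r")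
proof -
  let ?l = "braid C (X \<odot> Y) Z" and ?m = "braid C Z (X \<odot> Y)"
  have m: "?m = (ident C X \<otimes> braid C Z Y) \<cdot> (braid C Z X \<otimes> ident C Y)"
    by (rule braid_hexagon) simp_all
  have "?m \<cdot> ?r = ident C (X \<odot> (Y \<odot> Z))"
    unfolding m by (simp add: assoc interchange interchange_tail)
  moreover have "?l \<cdot> ?m = ident C (Z \<odot> (X \<odot> Y))"
    using braid_symmetric[of Z "X \<odot> Y"] by simp
  ultimately have "?l \<cdot> (?m \<cdot> ?r) = ?l" "(?l \<cdot> ?m) \<cdot> ?r = ?r" by simp_all
  then show ?thesis by (simp flip: assoc)
qed

text \<open>
  For a coaction \<open>r\<close> of \<open>D\<close> on \<open>X\<close>, \<open>pair r p m\<close> is \<open>p(t\<^sub>1) \<otimes> m(t\<^sub>0)\<close> and \<open>rpair r m p\<close> is \<open>m(t\<^sub>0) \<otimes> p(t\<^sub>1)\<close>.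
  When \<open>D\<close> is cocommutative these two operations obey the rules of Sweedler calculations, with
  \<open>X = D \<otimes> A\<close> providing one linear variable in \<open>A\<close>.
\<close>

definition pair :: "'m \<Rightarrow> 'm \<Rightarrow> 'm \<Rightarrow> 'm" where
  "pair r p m = (p \<otimes> m) \<cdot> r"

definition rpair :: "'m \<Rightarrow> 'm \<Rightarrow> 'm \<Rightarrow> 'm" where
  "rpair r m p = braid C (Cod C p) (Cod C m) \<cdot> pair r p m"

end

section \<open>Cocommutative coalgebras, comodules and the Sweedler rules\<close>

locale cocommutative_coalgebra = strict_symmetric_monoidal_category C
  for C :: "('o, 'm, 'z) category_data_scheme" (structure) +
  fixes D :: 'o and d e :: 'm
  assumes D [simp]: "D \<in> Ob C"
    and d_hom: "d \<in> hom C D (D \<odot> D)" and e_hom: "e \<in> hom C D \<K>"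
    and counit: "(e \<otimes> ident C D) \<cdot> d = ident C D"
    and coassoc: "(d \<otimes> ident C D) \<cdot> d = (ident C D \<otimes> d) \<cdot> d"
    and cocomm: "braid C D D \<cdot> d = d"
begin

lemma d_arr [simp]: "d \<in> Arr C" "Dom C d = D" "Cod C d = D \<odot> D"
  and e_arr [simp]: "e \<in> Arr C" "Dom C e = D" "Cod C e = \<K>"
  using d_hom e_hom by (auto simp: in_hom)

end

locale comodule = cocommutative_coalgebra C D d e
  for C :: "('o, 'm, 'z) category_data_scheme" (structure) and D d e +
  fixes X :: 'o and r :: 'm
  assumes X [simp]: "X \<in> Ob C"
    and r_hom: "r \<in> hom C X (D \<odot> X)"
    and coact_counit: "(e \<otimes> ident C X) \<cdot> r = ident C X"
    and coact_coassoc: "(d \<otimes> ident C X) \<cdot> r = (ident C D \<otimes> r) \<cdot> r"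
begin

lemma r_arr [simp]: "r \<in> Arr C" "Dom C r = X" "Cod C r = D \<odot> X"
  using r_hom by (auto simp: in_hom)

lemma pair_arr [simp]:
  assumes "p \<in> Arr C" "Dom C p = D" "m \<in> Arr C" "Dom C m = X"
  shows "pair r p m \<in> Arr C" "Dom C (pair r p m) = X" "Cod C (pair r p m) = Cod C p \<odot> Cod C m"
  using assms by (simp_all add: pair_def)

lemma rpair_arr [simp]:
  assumes "p \<in> Arr C" "Dom C p = D" "m \<in> Arr C" "Dom C m = X"
  shows "rpair r m p \<in> Arr C" "Dom C (rpair r m p) = X" "Cod C (rpair r m p) = Cod C m \<odot> Cod C p"
  using assms by (simp_all add: rpair_def)

lemma tensor_pair:
  assumes "p \<in> Arr C" "Dom C p = D" "m \<in> Arr C" "Dom C m = X"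
    and "g \<in> Arr C" "Dom C g = Cod C p" "h \<in> Arr C" "Dom C h = Cod C m"
  shows "(g \<otimes> h) \<cdot> pair r p m = pair r (g \<cdot> p) (h \<cdot> m)"
  using assms by (simp add: pair_def interchange_tail)

lemma tensor_rpair:
  assumes "p \<in> Arr C" "Dom C p = D" "m \<in> Arr C" "Dom C m = X"
    and "g \<in> Arr C" "Dom C g = Cod C m" "h \<in> Arr C" "Dom C h = Cod C p"
  shows "(g \<otimes> h) \<cdot> rpair r m p = rpair r (g \<cdot> m) (h \<cdot> p)"
proof -
  have "rpair r (g \<cdot> m) (h \<cdot> p) = braid C (Cod C h) (Cod C g) \<cdot> ((h \<otimes> g) \<cdot> pair r p m)"
    using assms by (simp add: rpair_def tensor_pair)
  also have "\<dots> = (g \<otimes> h) \<cdot> (braid C (Cod C p) (Cod C m) \<cdot> pair r p m)"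
    using assms by (intro naturality_tail) simp_all
  finally show ?thesis by (simp add: rpair_def)
qed

lemma pair_counit [simp]:
  assumes "m \<in> Arr C" "Dom C m = X" shows "pair r e m = m"
proof -
  have "e \<otimes> m = m \<cdot> (e \<otimes> ident C X)"
    using assms interchange[of e "ident C \<K>" "ident C X" m] by simp
  then show ?thesis using assms by (simp add: pair_def assoc coact_counit)
qed

lemma rpair_counit [simp]:
  assumes "m \<in> Arr C" "Dom C m = X" shows "rpair r m e = m"
  using assms by (simp add: rpair_def)

lemma pair_assoc:
  assumes "p \<in> Arr C" "Dom C p = D" "q \<in> Arr C" "Dom C q = D" "m \<in> Arr C" "Dom C m = X"
  shows "pair r (pair d p q) m = pair r p (pair r q m)"
proof -
  have "pair r (pair d p q) m = ((p \<otimes> q) \<otimes> m) \<cdot> ((d \<otimes> ident C X) \<cdot> r)"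
    using assms by (simp add: pair_def interchange_tail)
  also have "\<dots> = (p \<otimes> (q \<otimes> m)) \<cdot> ((ident C D \<otimes> r) \<cdot> r)"
    using assms by (simp only: coact_coassoc tensor_assoc)
  also have "\<dots> = pair r p (pair r q m)"
    using assms by (simp add: pair_def interchange_tail)
  finally show ?thesis .
qed

end

text \<open>With \<open>X = D\<close> the linear variable is itself a function of the repeatable
  ones; left and right pairings then agree, as \<open>rpair_self\<close> records.\<close>

sublocale cocommutative_coalgebra \<subseteq> self: comodule C D d e D d
  by unfold_locales (simp_all add: d_hom counit coassoc)

context cocommutative_coalgebra
begin

lemma pair_swap:
  assumes "p \<in> Arr C" "Dom C p = D" "q \<in> Arr C" "Dom C q = D"
  shows "braid C (Cod C p) (Cod C q) \<cdot> pair d p q = pair d q p"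
  using assms naturality_tail[of p q D "Cod C p" D "Cod C q" d]
  by (simp add: pair_def cocomm)

lemma rpair_self:
  assumes "p \<in> Arr C" "Dom C p = D" "q \<in> Arr C" "Dom C q = D"
  shows "rpair d p q = pair d p q"
  using assms by (simp add: rpair_def pair_swap)

end

context comodule
begin

text \<open>Coassociativity yields the copies in the order \<open>q\<close>, \<open>p\<close>, and
  cocommutativity exchanges them. As a result left and right multiplications by functions of
  \<open>D\<close> commute.\<close>

lemma rpair_pair:
  assumes [simp]: "p \<in> Arr C" "Dom C p = D" "q \<in> Arr C" "Dom C q = D" "m \<in> Arr C" "Dom C m = X"
  shows "rpair r (pair r p m) q = pair r p (rpair r m q)"
proof -
  let ?P = "Cod C p" and ?Q = "Cod C q" and ?M = "Cod C m"
  have "rpair r (pair r p m) q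
      = (ident C ?P \<otimes> braid C ?Q ?M) \<cdot> ((braid C ?Q ?P \<otimes> ident C ?M) \<cdot> pair r (pair d q p) m)"
    by (simp add: rpair_def braid_hexagon assoc pair_assoc)
  also have "\<dots> = (ident C ?P \<otimes> braid C ?Q ?M) \<cdot> pair r (pair d p q) m"
    by (simp add: tensor_pair pair_swap)
  also have "\<dots> = pair r p (rpair r m q)"
    by (simp add: pair_assoc rpair_def tensor_pair)
  finally show ?thesis .
qed

lemma rpair_rpair:
  assumes [simp]: "p \<in> Arr C" "Dom C p = D" "q \<in> Arr C" "Dom C q = D" "m \<in> Arr C" "Dom C m = X"
  shows "rpair r (rpair r m p) q = rpair r m (pair d p q)"
proof -
  let ?P = "Cod C p" and ?Q = "Cod C q" and ?M = "Cod C m"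
  have swap: "rpair r (pair r p m) q = (ident C ?P \<otimes> braid C ?Q ?M) \<cdot> pair r (pair d p q) m"
    by (subst rpair_pair) (simp_all add: pair_assoc tensor_pair rpair_def)
  have "rpair r (rpair r m p) q = (braid C ?P ?M \<otimes> ident C ?Q) \<cdot> rpair r (pair r p m) q"
    by (simp add: tensor_rpair rpair_def[of _ m p])
  also have "\<dots> = rpair r m (pair d p q)"
    unfolding swap by (simp add: rpair_def braid_hexagon' assoc)
  finally show ?thesis .
qed

text \<open>The shuffle moves \<open>q\<close> past \<open>q'\<close>, but both are read off the
  same cocommutative coalgebra, so it only permutes copies. This is the shape met when an action is
  distributed over a product.\<close>

lemma pair_exchange:
  assumes [simp]: "p \<in> Arr C" "Dom C p = D" "q \<in> Arr C" "Dom C q = D"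
    "q' \<in> Arr C" "Dom C q' = D" "m \<in> Arr C" "Dom C m = X"
  shows "(ident C (Cod C p) \<otimes> (braid C (Cod C q) (Cod C q') \<otimes> ident C (Cod C m)))
      \<cdot> pair r (pair d p q) (pair r q' m) = pair r (pair d p q') (pair r q m)"
proof -
  have "(braid C (Cod C q) (Cod C q') \<otimes> ident C (Cod C m)) \<cdot> pair r q (pair r q' m)
      = pair r q' (pair r q m)"
    by (simp add: tensor_pair pair_swap flip: pair_assoc)
  then show ?thesis by (simp add: pair_assoc tensor_pair)
qed

lemma rpair_exchange:
  assumes [simp]: "p \<in> Arr C" "Dom C p = D" "q \<in> Arr C" "Dom C q = D"
    "s \<in> Arr C" "Dom C s = D" "m \<in> Arr C" "Dom C m = X"
  shows "(ident C (Cod C p) \<otimes> (braid C (Cod C q) (Cod C m) \<otimes> ident C (Cod C s)))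
      \<cdot> pair r (pair d p q) (rpair r m s) = rpair r (pair r p m) (pair d q s)"
proof -
  have "(braid C (Cod C q) (Cod C m) \<otimes> ident C (Cod C s)) \<cdot> pair r q (rpair r m s)
      = rpair r m (pair d q s)"
    by (simp add: tensor_rpair flip: rpair_pair rpair_rpair) (simp add: rpair_def)
  then show ?thesis by (simp add: pair_assoc tensor_pair rpair_pair)
qed

end

context strict_symmetric_monoidal_category
begin

text \<open>Adjacent identities are merged into one, the normal form of whiskered arrows;
  \<open>whisker_left\<close> and \<open>whisker_right\<close> factor such composites again.\<close>

lemma tensor_ident_ident [simp]:
  assumes "X \<in> Ob C" "Y \<in> Ob C" "f \<in> Arr C"
  shows "ident C X \<otimes> (ident C Y \<otimes> f) = ident C (X \<odot> Y) \<otimes> f"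
  using tensor_assoc[of "ident C X" "ident C Y" f] assms by simp

lemma whisker_right:
  assumes "f \<in> Arr C" "g \<in> Arr C" "X \<in> Ob C" "Y \<in> Ob C" "Dom C f \<odot> X = Cod C g"
  shows "(f \<otimes> ident C (X \<odot> Y)) \<cdot> (g \<otimes> ident C Y) = ((f \<otimes> ident C X) \<cdot> g) \<otimes> ident C Y"
proof -
  have "f \<otimes> ident C (X \<odot> Y) = (f \<otimes> ident C X) \<otimes> ident C Y"
    using assms by (simp add: tensor_assoc)
  then show ?thesis using assms by (simp add: interchange)
qed

lemma whisker_left:
  assumes "f \<in> Arr C" "g \<in> Arr C" "X \<in> Ob C" "Y \<in> Ob C" "Y \<odot> Dom C f = Cod C g"
  shows "(ident C (X \<odot> Y) \<otimes> f) \<cdot> (ident C X \<otimes> g) = ident C X \<otimes> ((ident C Y \<otimes> f) \<cdot> g)"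
proof -
  have "ident C (X \<odot> Y) \<otimes> f = ident C X \<otimes> (ident C Y \<otimes> f)"
    using assms by simp
  then show ?thesis using assms by (simp add: interchange del: tensor_ident_ident)
qed

lemma ident_tensor_comp:
  assumes "f \<in> Arr C" "g \<in> Arr C" "X \<in> Ob C" "Dom C f = Cod C g"
  shows "ident C X \<otimes> (f \<cdot> g) = (ident C X \<otimes> f) \<cdot> (ident C X \<otimes> g)"
  using assms by (simp add: interchange)

lemma comp_tensor_ident:
  assumes "f \<in> Arr C" "g \<in> Arr C" "X \<in> Ob C" "Dom C f = Cod C g"
  shows "(f \<cdot> g) \<otimes> ident C X = (f \<otimes> ident C X) \<cdot> (g \<otimes> ident C X)"
  using assms by (simp add: interchange)

text \<open>The added factor \<open>Y\<close> is inert. With \<open>Y\<close> the object of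
  \<open>A\<close> it holds an argument that is used once.\<close>

lemma comodule_tensor:
  assumes "comodule C D d e X r" and [simp]: "Y \<in> Ob C"
  shows "comodule C D d e (X \<odot> Y) (r \<otimes> ident C Y)"
proof -
  interpret comodule C D d e X r by fact
  have Y: "ident C (X \<odot> Y) = ident C X \<otimes> ident C Y" by simp
  show ?thesis
  proof unfold_locales
    show "r \<otimes> ident C Y \<in> hom C (X \<odot> Y) (D \<odot> (X \<odot> Y))" by (simp add: in_hom)
    show "(e \<otimes> ident C (X \<odot> Y)) \<cdot> (r \<otimes> ident C Y) = ident C (X \<odot> Y)"
      unfolding Y by (simp del: tensor_ident add: interchange coact_counit flip: tensor_assoc)
    show "(d \<otimes> ident C (X \<odot> Y)) \<cdot> (r \<otimes> ident C Y)
        = (ident C D \<otimes> (r \<otimes> ident C Y)) \<cdot> (r \<otimes> ident C Y)"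
      unfolding Y by (simp del: tensor_ident add: interchange coact_coassoc flip: tensor_assoc)
  qed simp
qed

end

context comodule
begin

lemma pair_comp:
  assumes "r \<cdot> k = (g \<otimes> k) \<cdot> r'"
    and "g \<in> Arr C" "Cod C g = D" "k \<in> Arr C" "Cod C k = X"
    and "r' \<in> Arr C" "Cod C r' = Dom C g \<odot> Dom C k"
    and "p \<in> Arr C" "Dom C p = D" "m \<in> Arr C" "Dom C m = X"
  shows "pair r p m \<cdot> k = pair r' (p \<cdot> g) (m \<cdot> k)"
  using assms by (simp add: pair_def assoc interchange_tail)

end

section \<open>Tensor products of cocommutative coalgebras\<close>

locale coalgebra_pair = D: cocommutative_coalgebra C D d e + E: cocommutative_coalgebra C E d' e'
  for C :: "('o, 'm, 'z) category_data_scheme" (structure) and D d e E d' e'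
begin

abbreviation \<Delta> :: 'm where "\<Delta> \<equiv> tensor_comul C D d E d'"

lemma \<Delta>_arr [simp]: "\<Delta> \<in> Arr C" "Dom C \<Delta> = D \<odot> E" "Cod C \<Delta> = D \<odot> (E \<odot> (D \<odot> E))"
  by (simp_all add: tensor_comul_def)

text \<open>Naturality of the braiding moves the shuffle inside \<open>\<Delta>\<close> behind all
  four arrows, so a calculation over \<open>D \<odot> E\<close> separates into one over
  \<open>D\<close> and one over \<open>E\<close>.\<close>

lemma pair_tensor:
  assumes [simp]: "p \<in> Arr C" "Dom C p = D" "q \<in> Arr C" "Dom C q = D"
    "p' \<in> Arr C" "Dom C p' = E" "q' \<in> Arr C" "Dom C q' = E"
  shows "D.pair \<Delta> (p \<otimes> p') (q \<otimes> q')
    = (ident C (Cod C p) \<otimes> (braid C (Cod C q) (Cod C p') \<otimes> ident C (Cod C q')))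
      \<cdot> (D.pair d p q \<otimes> D.pair d' p' q')"
proof -
  let ?c = "braid C (Cod C q) (Cod C p')"
  have nat: "(p' \<otimes> q) \<cdot> braid C D E = ?c \<cdot> (q \<otimes> p')"
    by (intro D.naturality[symmetric]) simp_all
  have "D.pair \<Delta> (p \<otimes> p') (q \<otimes> q')
      = (p \<otimes> ((p' \<otimes> q) \<otimes> q')) \<cdot> ((ident C D \<otimes> (braid C D E \<otimes> ident C E)) \<cdot> (d \<otimes> d'))"
    by (simp add: D.pair_def tensor_comul_def D.tensor_assoc)
  also have "\<dots> = (p \<otimes> ((?c \<cdot> (q \<otimes> p')) \<otimes> q')) \<cdot> (d \<otimes> d')"
    by (simp add: D.interchange_tail D.interchange nat)
  also have "\<dots> = (ident C (Cod C p) \<otimes> (?c \<otimes> ident C (Cod C q'))) \<cdot> ((p \<otimes> ((q \<otimes> p') \<otimes> q')) \<cdot> (d \<otimes> d'))"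
    by (simp add: D.interchange_tail D.interchange)
  also have "p \<otimes> ((q \<otimes> p') \<otimes> q') = (p \<otimes> q) \<otimes> (p' \<otimes> q')"
    by (simp add: D.tensor_assoc)
  finally show ?thesis by (simp add: D.pair_def D.interchange)
qed

text \<open>As \<open>p \<otimes> e'\<close> ignores \<open>E\<close>, the counit cancels the
  coproduct of \<open>E\<close> and only the \<open>D\<close>-variable is duplicated.\<close>

lemma pair_comul_left:
  assumes [simp]: "p \<in> Arr C" "Dom C p = D" "q \<in> Arr C" "Dom C q = D \<odot> E"
  shows "D.pair \<Delta> (p \<otimes> e') q = (p \<otimes> q) \<cdot> (d \<otimes> ident C E)"
proof -
  have "D.pair \<Delta> (p \<otimes> e') (ident C D \<otimes> ident C E) = D.pair d p (ident C D) \<otimes> ident C E"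
    by (subst pair_tensor) simp_all
  then have "D.pair \<Delta> (p \<otimes> e') (ident C (D \<odot> E)) = D.pair d p (ident C D) \<otimes> ident C E"
    by simp
  moreover have "D.pair \<Delta> (p \<otimes> e') q
      = (ident C (Cod C p) \<otimes> q) \<cdot> D.pair \<Delta> (p \<otimes> e') (ident C (D \<odot> E))"
    by (simp add: D.pair_def D.interchange_tail)
  moreover have "D.pair d p (ident C D) \<otimes> ident C E = (p \<otimes> ident C (D \<odot> E)) \<cdot> (d \<otimes> ident C E)"
    by (simp add: D.pair_def D.whisker_right)
  ultimately show ?thesis
    by (simp add: D.interchange_tail)
qed

lemma pair_comul_right:
  assumes [simp]: "p \<in> Arr C" "Dom C p = E" "q \<in> Arr C" "Dom C q = D \<odot> E"
  shows "D.pair \<Delta> q (e \<otimes> p) = (q \<otimes> p) \<cdot> (ident C D \<otimes> d')"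
proof -
  have "D.pair \<Delta> (ident C D \<otimes> ident C E) (e \<otimes> p)
      = D.pair d (ident C D) e \<otimes> D.pair d' (ident C E) p"
    by (subst pair_tensor) simp_all
  also have "D.pair d (ident C D) e = ident C D"
    using D.rpair_self[of "ident C D" e] by simp
  finally have "D.pair \<Delta> (ident C (D \<odot> E)) (e \<otimes> p) = ident C D \<otimes> D.pair d' (ident C E) p"
    by simp
  moreover have "D.pair \<Delta> q (e \<otimes> p)
      = (q \<otimes> ident C (Cod C p)) \<cdot> D.pair \<Delta> (ident C (D \<odot> E)) (e \<otimes> p)"
    by (simp add: D.pair_def D.interchange_tail)
  moreover have "ident C D \<otimes> D.pair d' (ident C E) p = (ident C (D \<odot> E) \<otimes> p) \<cdot> (ident C D \<otimes> d')"
    by (simp add: D.pair_def D.whisker_left)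
  ultimately show ?thesis
    by (simp add: D.interchange_tail)
qed

lemma tensor_counit: "((e \<otimes> e') \<otimes> ident C (D \<odot> E)) \<cdot> \<Delta> = ident C (D \<odot> E)"
  using pair_comul_left[of e "ident C (D \<odot> E)"] D.whisker_right[of e d D E]
  by (simp add: D.pair_def D.counit)

text \<open>By \<open>pair_tensor\<close> and coassociativity in each factor, both sides are a
  permutation after the same arrow \<open>?z\<close>; what remains is that two permutations of six
  factors agree.\<close>

lemma tensor_coassoc:
  "(\<Delta> \<otimes> ident C (D \<odot> E)) \<cdot> \<Delta> = (ident C (D \<odot> E) \<otimes> \<Delta>) \<cdot> \<Delta>"
proof -
  let ?iD = "ident C D" and ?iE = "ident C E" and ?c = "braid C D E"
  let ?m = "?iD \<otimes> (?c \<otimes> ?iE)"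
  have l: "(\<Delta> \<otimes> ident C (D \<odot> E)) \<cdot> \<Delta>
      = (?m \<otimes> (?iD \<otimes> ?iE)) \<cdot> D.pair \<Delta> (d \<otimes> d') (?iD \<otimes> ?iE)"
    by (simp add: D.pair_def D.interchange_tail) (simp add: tensor_comul_def D.tensor_assoc)
  have r: "(ident C (D \<odot> E) \<otimes> \<Delta>) \<cdot> \<Delta>
      = ((?iD \<otimes> ?iE) \<otimes> ?m) \<cdot> D.pair \<Delta> (?iD \<otimes> ?iE) (d \<otimes> d')"
    by (simp add: D.pair_def D.interchange_tail del: D.tensor_ident_ident)
      (simp add: tensor_comul_def D.tensor_assoc)
  have dd: "D.pair d d ?iD = D.pair d ?iD d" "D.pair d' d' ?iE = D.pair d' ?iE d'"
    by (simp_all add: D.pair_def D.coassoc E.coassoc)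
  \<comment> \<open>Expanding each block braiding by its hexagon produces the same first crossing
    \<open>?k\<close>; the other two crossings act on disjoint factors and commute.\<close>
  have "(?c \<otimes> ident C (E \<odot> D)) \<cdot> (?iD \<otimes> braid C D (E \<odot> E))
      = (ident C (E \<odot> D) \<otimes> ?c) \<cdot> (braid C (D \<odot> D) E \<otimes> ?iE)" (is "?L = ?R")
  proof -
    let ?k = "?iD \<otimes> (?c \<otimes> ?iE)"
    have "?iD \<otimes> braid C D (E \<odot> E) = (ident C (D \<odot> E) \<otimes> ?c) \<cdot> ?k"
      by (subst D.braid_hexagon) (simp_all add: D.whisker_left)
    moreover have "braid C (D \<odot> D) E \<otimes> ?iE = (?c \<otimes> ident C (D \<odot> E)) \<cdot> ?k"
      by (subst D.braid_hexagon') (simp_all add: D.whisker_right flip: D.tensor_assoc)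
    ultimately show ?thesis
      by (simp add: D.interchange_tail)
  qed
  then have "?iD \<otimes> (?L \<otimes> ?iE) = ?iD \<otimes> (?R \<otimes> ?iE)" by simp
  moreover have "?iD \<otimes> (?L \<otimes> ?iE)
      = (?m \<otimes> (?iD \<otimes> ?iE)) \<cdot> (ident C (D \<odot> D) \<otimes> (braid C D (E \<odot> E) \<otimes> ?iE))"
    by (simp add: D.tensor_assoc D.ident_tensor_comp D.comp_tensor_ident)
  moreover have "?iD \<otimes> (?R \<otimes> ?iE)
      = ((?iD \<otimes> ?iE) \<otimes> ?m) \<cdot> (?iD \<otimes> (braid C (D \<odot> D) E \<otimes> ident C (E \<odot> E)))"
    by (simp add: D.tensor_assoc D.ident_tensor_comp D.comp_tensor_ident)
  ultimately have perm: "(?m \<otimes> (?iD \<otimes> ?iE)) \<cdot> (ident C (D \<odot> D) \<otimes> (braid C D (E \<odot> E) \<otimes> ?iE))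
      = ((?iD \<otimes> ?iE) \<otimes> ?m) \<cdot> (?iD \<otimes> (braid C (D \<odot> D) E \<otimes> ident C (E \<odot> E)))"
    by simp
  let ?z = "D.pair d ?iD d \<otimes> D.pair d' ?iE d'"
  have "D.pair \<Delta> (d \<otimes> d') (?iD \<otimes> ?iE) = (ident C (D \<odot> D) \<otimes> (braid C D (E \<odot> E) \<otimes> ?iE)) \<cdot> ?z"
    by (subst pair_tensor) (simp_all add: dd)
  moreover have "D.pair \<Delta> (?iD \<otimes> ?iE) (d \<otimes> d') = (?iD \<otimes> (braid C (D \<odot> D) E \<otimes> ident C (E \<odot> E))) \<cdot> ?z"
    by (subst pair_tensor) simp_all
  ultimately show ?thesis
    unfolding l r using arg_cong[OF perm, of "\<lambda>k. k \<cdot> ?z"] by (simp add: D.assoc)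
qed

text \<open>The braiding of \<open>D \<odot> E\<close> with itself undoes a shuffle by
  \<open>?m'\<close>, braids the copies of \<open>D\<close> and of \<open>E\<close> separately, and
  reshuffles by \<open>?m\<close>. The shuffle undone is the one in \<open>\<Delta>\<close>.\<close>

lemma tensor_cocomm: "braid C (D \<odot> E) (D \<odot> E) \<cdot> \<Delta> = \<Delta>"
proof -
  let ?iD = "ident C D" and ?iE = "ident C E" and ?c = "braid C D E" and ?c' = "braid C E D"
  let ?m = "?iD \<otimes> (?c \<otimes> ?iE)" and ?m' = "?iD \<otimes> (?c' \<otimes> ?iE)"
  have \<Delta>: "\<Delta> = ?m \<cdot> (d \<otimes> d')" by (simp add: tensor_comul_def D.tensor_assoc)
  have "braid C (D \<odot> E) D = (braid C D D \<otimes> ?iE) \<cdot> (?iD \<otimes> ?c')"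
    "braid C (D \<odot> E) E = (?c \<otimes> ?iE) \<cdot> (?iD \<otimes> braid C E E)"
    by (simp_all add: D.braid_hexagon')
  then have "braid C (D \<odot> E) (D \<odot> E)
      = (?iD \<otimes> ((?c \<otimes> ?iE) \<cdot> (?iD \<otimes> braid C E E))) \<cdot> (((braid C D D \<otimes> ?iE) \<cdot> (?iD \<otimes> ?c')) \<otimes> ?iE)"
    using D.braid_hexagon[of "D \<odot> E" D E] by simp
  also have "\<dots> = ?m \<cdot> ((braid C D D \<otimes> braid C E E) \<cdot> ?m')"
    by (simp add: D.tensor_assoc D.ident_tensor_comp D.comp_tensor_ident D.assoc D.interchange_tail)
  finally have "braid C (D \<odot> E) (D \<odot> E) \<cdot> \<Delta>
      = ?m \<cdot> ((braid C D D \<otimes> braid C E E) \<cdot> (?m' \<cdot> (?m \<cdot> (d \<otimes> d'))))"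
    by (simp add: \<Delta> D.assoc)
  also have "?m' \<cdot> (?m \<cdot> (d \<otimes> d')) = d \<otimes> d'"
    by (simp add: D.interchange_tail D.interchange)
  finally show ?thesis
    by (simp add: \<Delta> D.interchange D.cocomm E.cocomm)
qed

end

sublocale coalgebra_pair \<subseteq> prod: cocommutative_coalgebra C "D \<odot> E" \<Delta> "e \<otimes> e'"
  by unfold_locales (simp_all add: D.in_hom tensor_counit tensor_coassoc tensor_cocomm)

context coalgebra_pair
begin

abbreviation \<pi>\<^sub>1 :: 'm where "\<pi>\<^sub>1 \<equiv> ident C D \<otimes> e'"
abbreviation \<pi>\<^sub>2 :: 'm where "\<pi>\<^sub>2 \<equiv> e \<otimes> ident C E"

text \<open>The identity is the generic pair \<open>(x, y)\<close>: an arrow out of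
  \<open>D \<odot> E\<close> is its own value at the two projections.\<close>

lemma pair_projections: "D.pair \<Delta> \<pi>\<^sub>1 \<pi>\<^sub>2 = ident C (D \<odot> E)"
proof -
  have "D.pair d (ident C D) e = ident C D"
    using D.rpair_self[of "ident C D" e] by simp
  then have "(ident C D \<otimes> e) \<cdot> d = ident C D" by (simp add: D.pair_def)
  then have "((ident C D \<otimes> e) \<otimes> ident C E) \<cdot> (d \<otimes> ident C E) = ident C (D \<odot> E)"
    by (simp add: D.interchange)
  then show ?thesis
    by (subst pair_comul_left) (simp_all add: D.tensor_assoc)
qed

text \<open>This makes the coordinates comultiplicative, hence admissible as variables that occur
  repeatedly.\<close>

lemma comul_projections:
  "d \<cdot> \<pi>\<^sub>1 = D.pair \<Delta> \<pi>\<^sub>1 \<pi>\<^sub>1" "d' \<cdot> \<pi>\<^sub>2 = D.pair \<Delta> \<pi>\<^sub>2 \<pi>\<^sub>2"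
proof -
  have "D.pair \<Delta> \<pi>\<^sub>1 \<pi>\<^sub>1 = (ident C (D \<odot> D) \<otimes> e') \<cdot> (d \<otimes> ident C E)"
    by (subst pair_comul_left) simp_all
  also have "\<dots> = d \<otimes> e'" by (simp add: D.interchange)
  also have "\<dots> = d \<cdot> \<pi>\<^sub>1"
    using D.interchange[of "ident C D" d e' "ident C \<K>"] by simp
  finally show "d \<cdot> \<pi>\<^sub>1 = D.pair \<Delta> \<pi>\<^sub>1 \<pi>\<^sub>1" by simp
  have "D.pair \<Delta> \<pi>\<^sub>2 \<pi>\<^sub>2 = (e \<otimes> ident C (E \<odot> E)) \<cdot> (ident C D \<otimes> d')"
    by (subst pair_comul_right) (simp_all add: D.tensor_assoc)
  also have "\<dots> = e \<otimes> d'" by (simp add: D.interchange)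
  also have "\<dots> = d' \<cdot> \<pi>\<^sub>2"
    using D.interchange[of e "ident C \<K>" "ident C E" d'] by simp
  finally show "d' \<cdot> \<pi>\<^sub>2 = D.pair \<Delta> \<pi>\<^sub>2 \<pi>\<^sub>2" by simp
qed

end

section \<open>Weak actions and elements over a coalgebra\<close>

locale weak_action = strict_symmetric_monoidal_category C
  for C :: "('o, 'm, 'z) category_data_scheme" (structure) +
  fixes H :: "('o, 'm) weak_hopf_data" and A :: "('o, 'm) module_algebra_data"
  assumes weak_hopf: "weak_hopf_algebra C H"
    and cocommutative: "cocommutative C H"
    and module_algebra: "weak_module_algebra C H A"

sublocale weak_action \<subseteq> H: cocommutative_coalgebra C "obj H" "\<delta>\<^bsub>H\<^esub>" "\<epsilon>\<^bsub>H\<^esub>"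
  using weak_hopf cocommutative
  by unfold_locales (auto simp: weak_hopf_algebra_def coalgebra_def cocommutative_def)

sublocale weak_action \<subseteq> HH: coalgebra_pair C "obj H" "\<delta>\<^bsub>H\<^esub>" "\<epsilon>\<^bsub>H\<^esub>" "obj H" "\<delta>\<^bsub>H\<^esub>" "\<epsilon>\<^bsub>H\<^esub>"
  by unfold_locales

context weak_action
begin

lemma ob [simp]: "obj A \<in> Ob C"
  using module_algebra by (auto simp: weak_module_algebra_def algebra_def)

lemma structure_arr [simp]:
  "\<eta>\<^bsub>H\<^esub> \<in> Arr C" "Dom C \<eta>\<^bsub>H\<^esub> = \<K>" "Cod C \<eta>\<^bsub>H\<^esub> = obj H"
  "\<mu>\<^bsub>H\<^esub> \<in> Arr C" "Dom C \<mu>\<^bsub>H\<^esub> = obj H \<odot> obj H" "Cod C \<mu>\<^bsub>H\<^esub> = obj H"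
  "\<eta>\<^bsub>A\<^esub> \<in> Arr C" "Dom C \<eta>\<^bsub>A\<^esub> = \<K>" "Cod C \<eta>\<^bsub>A\<^esub> = obj A"
  "\<mu>\<^bsub>A\<^esub> \<in> Arr C" "Dom C \<mu>\<^bsub>A\<^esub> = obj A \<odot> obj A" "Cod C \<mu>\<^bsub>A\<^esub> = obj A"
  "\<phi>\<^bsub>A\<^esub> \<in> Arr C" "Dom C \<phi>\<^bsub>A\<^esub> = obj H \<odot> obj A" "Cod C \<phi>\<^bsub>A\<^esub> = obj A"
  using weak_hopf module_algebra
  by (auto simp: weak_hopf_algebra_def weak_module_algebra_def algebra_def in_hom)

lemma unit_mult:
  "\<mu>\<^bsub>H\<^esub> \<cdot> (\<eta>\<^bsub>H\<^esub> \<otimes> ident C (obj H)) = ident C (obj H)"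
  "\<mu>\<^bsub>H\<^esub> \<cdot> (ident C (obj H) \<otimes> \<eta>\<^bsub>H\<^esub>) = ident C (obj H)"
  "\<mu>\<^bsub>A\<^esub> \<cdot> (\<eta>\<^bsub>A\<^esub> \<otimes> ident C (obj A)) = ident C (obj A)"
  "\<mu>\<^bsub>A\<^esub> \<cdot> (ident C (obj A) \<otimes> \<eta>\<^bsub>A\<^esub>) = ident C (obj A)"
  using weak_hopf module_algebra
  by (auto simp: weak_hopf_algebra_def weak_module_algebra_def algebra_def)

lemma mult_assoc: "\<mu>\<^bsub>A\<^esub> \<cdot> (\<mu>\<^bsub>A\<^esub> \<otimes> ident C (obj A)) = \<mu>\<^bsub>A\<^esub> \<cdot> (ident C (obj A) \<otimes> \<mu>\<^bsub>A\<^esub>)"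
  using module_algebra by (auto simp: weak_module_algebra_def algebra_def)

lemma comul_mult: "\<delta>\<^bsub>H\<^esub> \<cdot> \<mu>\<^bsub>H\<^esub> = (\<mu>\<^bsub>H\<^esub> \<otimes> \<mu>\<^bsub>H\<^esub>) \<cdot> HH.\<Delta>"
  using weak_hopf by (auto simp: weak_hopf_algebra_def comul2_def)

lemma act_mult: "\<phi>\<^bsub>A\<^esub> \<cdot> (ident C (obj H) \<otimes> \<mu>\<^bsub>A\<^esub>) = \<mu>\<^bsub>A\<^esub> \<cdot> ((\<phi>\<^bsub>A\<^esub> \<otimes> \<phi>\<^bsub>A\<^esub>) \<cdot>
    ((ident C (obj H) \<otimes> (braid C (obj H) (obj A) \<otimes> ident C (obj A))) \<cdot>
     (\<delta>\<^bsub>H\<^esub> \<otimes> (ident C (obj A) \<otimes> ident C (obj A)))))"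
proof -
  have "\<phi>\<^bsub>A\<^esub> \<cdot> (ident C (obj H) \<otimes> \<mu>\<^bsub>A\<^esub>) = \<mu>\<^bsub>A\<^esub> \<cdot> (\<phi>\<^bsub>A\<^esub> \<otimes> \<phi>\<^bsub>A\<^esub>)
      \<cdot> (ident C (obj H) \<otimes> braid C (obj H) (obj A) \<otimes> ident C (obj A))
      \<cdot> (\<delta>\<^bsub>H\<^esub> \<otimes> ident C (obj A) \<otimes> ident C (obj A))"
    using module_algebra unfolding weak_module_algebra_def by blast
  then show ?thesis by (simp add: assoc tensor_assoc)
qed

abbreviation u where "u \<equiv> u1 C H A"

lemma u_arr [simp]: "u \<in> Arr C" "Dom C u = obj H" "Cod C u = obj A"
  by (simp_all add: u1_def)

lemma act_u: "\<phi>\<^bsub>A\<^esub> \<cdot> (ident C (obj H) \<otimes> u) = u \<cdot> \<mu>\<^bsub>H\<^esub>"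
proof -
  have "\<mu>\<^bsub>H\<^esub> \<otimes> \<eta>\<^bsub>A\<^esub> = (ident C (obj H) \<otimes> \<eta>\<^bsub>A\<^esub>) \<cdot> \<mu>\<^bsub>H\<^esub>"
    using interchange[of "\<mu>\<^bsub>H\<^esub>" "ident C (obj H)" "ident C \<K>" "\<eta>\<^bsub>A\<^esub>"] by simp
  moreover have "\<phi>\<^bsub>A\<^esub> \<cdot> (\<mu>\<^bsub>H\<^esub> \<otimes> \<eta>\<^bsub>A\<^esub>) = \<phi>\<^bsub>A\<^esub> \<cdot> (ident C (obj H) \<otimes> u)"
    using module_algebra unfolding weak_module_algebra_def u1_def by blast
  ultimately show ?thesis
    by (simp add: u1_def assoc)
qed

lemma u_Pi: "u \<cdot> Pi_L C H = u"
proof -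
  have [simp]: "Pi_L C H \<in> Arr C" "Dom C (Pi_L C H) = obj H" "Cod C (Pi_L C H) = obj H"
    by (simp_all add: Pi_L_def)
  have "(ident C (obj H) \<otimes> \<eta>\<^bsub>A\<^esub>) \<cdot> Pi_L C H = Pi_L C H \<otimes> \<eta>\<^bsub>A\<^esub>"
    using interchange[of "Pi_L C H" "ident C (obj H)" "ident C \<K>" "\<eta>\<^bsub>A\<^esub>"] by simp
  moreover have "\<phi>\<^bsub>A\<^esub> \<cdot> (Pi_L C H \<otimes> \<eta>\<^bsub>A\<^esub>) = u"
    using module_algebra unfolding weak_module_algebra_def u1_def by blast
  ultimately show ?thesis
    by (simp add: u1_def assoc)
qed

text \<open>The left \<open>A\<close>-linear map \<open>a \<otimes> y \<mapsto> a g(y)\<close>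
  determined by \<open>g\<close>.\<close>

definition lin :: "'m \<Rightarrow> 'm" where
  "lin g = (\<mu>\<^bsub>A\<^esub> \<otimes> ident C (obj H)) \<cdot> (ident C (obj A) \<otimes> g)"

definition fibre :: "'m \<Rightarrow> 'm" where
  "fibre f = (f \<otimes> ident C (obj H)) \<cdot> \<delta>\<^bsub>H\<^esub>"

text \<open>\<open>tm f\<close> is the map \<open>a \<otimes> x \<mapsto> a f(x\<^sub>1) \<otimes> x\<^sub>2\<close>, the left \<open>A\<close>-linear extension of \<open>fibre f\<close>.\<close>

definition tm :: "'m \<Rightarrow> 'm" where
  "tm f = lin (fibre f)"

lemma lin_arr [simp]:
  assumes "g \<in> Arr C" "Cod C g = obj A \<odot> obj H"
  shows "lin g \<in> Arr C" "Dom C (lin g) = obj A \<odot> Dom C g" "Cod C (lin g) = obj A \<odot> obj H"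
  using assms by (simp_all add: lin_def)

lemma fibre_arr [simp]:
  assumes "f \<in> Arr C" "Dom C f = obj H" "Cod C f = obj A"
  shows "fibre f \<in> Arr C" "Dom C (fibre f) = obj H" "Cod C (fibre f) = obj A \<odot> obj H"
  using assms by (simp_all add: fibre_def)

lemma tm_arr [simp]:
  assumes "f \<in> Arr C" "Dom C f = obj H" "Cod C f = obj A"
  shows "tm f \<in> Arr C" "Dom C (tm f) = obj A \<odot> obj H" "Cod C (tm f) = obj A \<odot> obj H"
  using assms by (simp_all add: tm_def)

lemma psi_arr [simp]:
  "psi C H A \<in> Arr C" "Dom C (psi C H A) = obj H \<odot> obj A" "Cod C (psi C H A) = obj A \<odot> obj H"
  by (simp_all add: psi_def)

lemma sigma_arr [simp]:
  assumes "\<sigma> \<in> Arr C" "Dom C \<sigma> = obj H \<odot> obj H" "Cod C \<sigma> = obj A"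
  shows "sigma C H \<sigma> \<in> Arr C" "Dom C (sigma C H \<sigma>) = obj H \<odot> obj H"
    "Cod C (sigma C H \<sigma>) = obj A \<odot> obj H"
  using assms by (simp_all add: sigma_def comul2_def)

lemma lin_comp:
  assumes "g \<in> Arr C" "Cod C g = obj A \<odot> obj H" "k \<in> Arr C" "Cod C k = Dom C g"
  shows "lin g \<cdot> (ident C (obj A) \<otimes> k) = lin (g \<cdot> k)"
  using assms by (simp add: lin_def assoc interchange)

lemma lin_left:
  assumes [simp]: "g \<in> Arr C" "Cod C g = obj A \<odot> obj H"
  shows "lin g \<cdot> (\<mu>\<^bsub>A\<^esub> \<otimes> ident C (Dom C g))
    = (\<mu>\<^bsub>A\<^esub> \<otimes> ident C (obj H)) \<cdot> (ident C (obj A) \<otimes> lin g)"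
proof -
  let ?iA = "ident C (obj A)" and ?iH = "ident C (obj H)"
  have "(?iA \<otimes> g) \<cdot> (\<mu>\<^bsub>A\<^esub> \<otimes> ident C (Dom C g)) = (\<mu>\<^bsub>A\<^esub> \<otimes> (?iA \<otimes> ?iH)) \<cdot> (ident C (obj A \<odot> obj A) \<otimes> g)"
    by (simp add: interchange)
  also have "\<mu>\<^bsub>A\<^esub> \<otimes> (?iA \<otimes> ?iH) = (\<mu>\<^bsub>A\<^esub> \<otimes> ?iA) \<otimes> ?iH"
    by (rule tensor_assoc[symmetric]) simp_all
  finally have "lin g \<cdot> (\<mu>\<^bsub>A\<^esub> \<otimes> ident C (Dom C g))
      = ((\<mu>\<^bsub>A\<^esub> \<cdot> (\<mu>\<^bsub>A\<^esub> \<otimes> ?iA)) \<otimes> ?iH) \<cdot> (ident C (obj A \<odot> obj A) \<otimes> g)"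
    by (simp add: lin_def assoc interchange_tail)
  also have "\<dots> = (\<mu>\<^bsub>A\<^esub> \<otimes> ?iH) \<cdot> (((?iA \<otimes> \<mu>\<^bsub>A\<^esub>) \<otimes> ?iH) \<cdot> (ident C (obj A \<odot> obj A) \<otimes> g))"
    by (simp add: mult_assoc interchange_tail)
  also have "((?iA \<otimes> \<mu>\<^bsub>A\<^esub>) \<otimes> ?iH) \<cdot> (ident C (obj A \<odot> obj A) \<otimes> g) = ?iA \<otimes> lin g"
    by (simp add: lin_def tensor_assoc ident_tensor_comp)
  finally show ?thesis .
qed

lemma lin_lin:
  assumes "g \<in> Arr C" "Dom C g = obj H" "Cod C g = obj A \<odot> obj H" "k \<in> Arr C" "Cod C k = obj A \<odot> obj H"
  shows "lin g \<cdot> lin k = lin (lin g \<cdot> k)"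
proof -
  have "lin g \<cdot> lin k = (lin g \<cdot> (\<mu>\<^bsub>A\<^esub> \<otimes> ident C (Dom C g))) \<cdot> (ident C (obj A) \<otimes> k)"
    using assms by (simp add: lin_def[of k] assoc)
  also have "\<dots> = ((\<mu>\<^bsub>A\<^esub> \<otimes> ident C (obj H)) \<cdot> (ident C (obj A) \<otimes> lin g)) \<cdot> (ident C (obj A) \<otimes> k)"
    using assms lin_left[of g] by simp
  finally show ?thesis
    using assms by (simp add: lin_def[of "lin g \<cdot> k"] assoc interchange)
qed

lemma lin_unit:
  assumes [simp]: "g \<in> Arr C" "Cod C g = obj A \<odot> obj H" "Dom C g = Y"
  shows "lin g \<cdot> (\<eta>\<^bsub>A\<^esub> \<otimes> ident C Y) = g"
proof -
  have [simp]: "Y \<in> Ob C" using dom_closed[of g] by simp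
  have "(ident C (obj A) \<otimes> g) \<cdot> (\<eta>\<^bsub>A\<^esub> \<otimes> ident C Y)
      = (\<eta>\<^bsub>A\<^esub> \<otimes> ident C (obj A \<odot> obj H)) \<cdot> g"
    using interchange[of "ident C \<K>" "\<eta>\<^bsub>A\<^esub>" g "ident C (obj A \<odot> obj H)"]
    by (simp add: interchange)
  also have "\<eta>\<^bsub>A\<^esub> \<otimes> ident C (obj A \<odot> obj H) = (\<eta>\<^bsub>A\<^esub> \<otimes> ident C (obj A)) \<otimes> ident C (obj H)"
    by (simp add: tensor_assoc)
  finally have "lin g \<cdot> (\<eta>\<^bsub>A\<^esub> \<otimes> ident C Y)
      = ((\<mu>\<^bsub>A\<^esub> \<cdot> (\<eta>\<^bsub>A\<^esub> \<otimes> ident C (obj A))) \<otimes> ident C (obj H)) \<cdot> g"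
    by (simp add: lin_def assoc interchange_tail)
  then show ?thesis by (simp add: unit_mult)
qed

text \<open>At \<open>b = 1\<close> the action inside \<open>psi\<close> produces
  \<open>u(x_1) \<otimes> x_2\<close>; this is what identifies the idempotent \<open>nabla\<close>
  with \<open>tm u\<close>.\<close>

lemma fibre_u: "fibre u = psi C H A \<cdot> (ident C (obj H) \<otimes> \<eta>\<^bsub>A\<^esub>)"
proof -
  let ?iA = "ident C (obj A)" and ?iH = "ident C (obj H)" and ?c = "braid C (obj H) (obj A)"
  have "(\<delta>\<^bsub>H\<^esub> \<otimes> ?iA) \<cdot> (?iH \<otimes> \<eta>\<^bsub>A\<^esub>) = (?iH \<otimes> (?iH \<otimes> \<eta>\<^bsub>A\<^esub>)) \<cdot> \<delta>\<^bsub>H\<^esub>"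
    using interchange[of "\<delta>\<^bsub>H\<^esub>" "ident C (obj H \<odot> obj H)" "ident C \<K>" "\<eta>\<^bsub>A\<^esub>"]
    by (simp add: interchange)
  then have "psi C H A \<cdot> (?iH \<otimes> \<eta>\<^bsub>A\<^esub>)
      = (\<phi>\<^bsub>A\<^esub> \<otimes> ?iH) \<cdot> ((?iH \<otimes> (?c \<cdot> (?iH \<otimes> \<eta>\<^bsub>A\<^esub>))) \<cdot> \<delta>\<^bsub>H\<^esub>)"
    by (simp add: psi_def assoc interchange_tail del: tensor_ident_ident)
  also have "?c \<cdot> (?iH \<otimes> \<eta>\<^bsub>A\<^esub>) = \<eta>\<^bsub>A\<^esub> \<otimes> ?iH"
    using naturality[of ?iH "\<eta>\<^bsub>A\<^esub>" "obj H" "obj H" \<K> "obj A"] by simp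
  also have "?iH \<otimes> (\<eta>\<^bsub>A\<^esub> \<otimes> ?iH) = (?iH \<otimes> \<eta>\<^bsub>A\<^esub>) \<otimes> ?iH"
    by (simp add: tensor_assoc)
  finally show ?thesis by (simp add: fibre_def u1_def interchange_tail)
qed

lemma nabla_eq: "nabla C H A = tm u"
  by (simp add: nabla_def tm_def lin_def fibre_u assoc ident_tensor_comp tensor_assoc)

text \<open>The crossed product multiplication is the left \<open>A\<close>-linear extension of its restriction to
  \<open>1 \<otimes> x \<otimes> b \<otimes> y\<close>, so only that restriction has to be computed.\<close>

definition wcp_core :: "'m \<Rightarrow> 'm" where
  "wcp_core \<sigma> = lin (sigma C H \<sigma>) \<cdot> (psi C H A \<otimes> ident C (obj H))"

lemma wcp_core_arr [simp]:
  assumes "\<sigma> \<in> Arr C" "Dom C \<sigma> = obj H \<odot> obj H" "Cod C \<sigma> = obj A"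
  shows "wcp_core \<sigma> \<in> Arr C" "Dom C (wcp_core \<sigma>) = obj H \<odot> (obj A \<odot> obj H)"
    "Cod C (wcp_core \<sigma>) = obj A \<odot> obj H"
  using assms by (simp_all add: wcp_core_def)

lemma wcp_mul_eq:
  assumes "\<sigma> \<in> Arr C" "Dom C \<sigma> = obj H \<odot> obj H" "Cod C \<sigma> = obj A"
  shows "wcp_mul C H A \<sigma> = lin (wcp_core \<sigma>)"
proof -
  let ?iA = "ident C (obj A)" and ?iH = "ident C (obj H)" and ?s = "sigma C H \<sigma>"
  note [simp] = sigma_arr[OF assms]
  have "lin (wcp_core \<sigma>) = lin (lin ?s) \<cdot> (?iA \<otimes> (psi C H A \<otimes> ?iH))"
    by (simp add: wcp_core_def lin_comp)
  also have "lin (lin ?s) = lin ?s \<cdot> (\<mu>\<^bsub>A\<^esub> \<otimes> ident C (obj H \<odot> obj H))"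
    using lin_left[of ?s] by (simp add: lin_def[of "lin ?s"])
  also have "\<dots> = (\<mu>\<^bsub>A\<^esub> \<otimes> ?iH) \<cdot> (\<mu>\<^bsub>A\<^esub> \<otimes> ?s)"
    by (simp add: lin_def assoc interchange)
  finally show ?thesis by (simp add: wcp_mul_def tensor_assoc)
qed

text \<open>The restriction to \<open>1 \<otimes> x \<otimes> b \<otimes> y\<close> of the crossed
  product of \<open>tm f\<close> and \<open>tm g\<close>. The two coefficients are kept separate so
  that the second can be exchanged for \<open>u\<close> at \<open>y = 1\<close>.\<close>

definition twisted_core :: "'m \<Rightarrow> 'm \<Rightarrow> 'm \<Rightarrow> 'm" where
  "twisted_core f g \<sigma> = lin (wcp_core \<sigma>) \<cdot> (fibre f \<otimes> tm g)"

lemma twisted_core_arr [simp]: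
  assumes "\<sigma> \<in> Arr C" "Dom C \<sigma> = obj H \<odot> obj H" "Cod C \<sigma> = obj A"
    "f \<in> Arr C" "Dom C f = obj H" "Cod C f = obj A" "g \<in> Arr C" "Dom C g = obj H" "Cod C g = obj A"
  shows "twisted_core f g \<sigma> \<in> Arr C" "Dom C (twisted_core f g \<sigma>) = obj H \<odot> (obj A \<odot> obj H)"
    "Cod C (twisted_core f g \<sigma>) = obj A \<odot> obj H"
  using assms by (simp_all add: twisted_core_def)

lemma wcp_mul_tm:
  assumes "\<sigma> \<in> Arr C" "Dom C \<sigma> = obj H \<odot> obj H" "Cod C \<sigma> = obj A"
    "f \<in> Arr C" "Dom C f = obj H" "Cod C f = obj A" "g \<in> Arr C" "Dom C g = obj H" "Cod C g = obj A"
  shows "wcp_mul C H A \<sigma> \<cdot> (tm f \<otimes> tm g) = lin (twisted_core f g \<sigma>)"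
proof -
  let ?iA = "ident C (obj A)" and ?iH = "ident C (obj H)" and ?G = "wcp_core \<sigma>"
  let ?Y = "obj H \<odot> (obj A \<odot> obj H)"
  note [simp] = wcp_core_arr[OF assms(1-3)] fibre_arr[OF assms(4-6)] tm_arr[OF assms(7-9)]
  have "tm f \<otimes> tm g = ((\<mu>\<^bsub>A\<^esub> \<otimes> ?iH) \<cdot> (?iA \<otimes> fibre f)) \<otimes> (ident C (obj A \<odot> obj H) \<cdot> tm g)"
    by (simp add: tm_def[of f] lin_def[of "fibre f"])
  also have "\<dots> = ((\<mu>\<^bsub>A\<^esub> \<otimes> ?iH) \<otimes> ident C (obj A \<odot> obj H)) \<cdot> ((?iA \<otimes> fibre f) \<otimes> tm g)"
    by (rule interchange[symmetric]) simp_all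
  also have "\<dots> = (\<mu>\<^bsub>A\<^esub> \<otimes> ident C ?Y) \<cdot> (?iA \<otimes> (fibre f \<otimes> tm g))"
    by (simp add: tensor_assoc)
  finally have "wcp_mul C H A \<sigma> \<cdot> (tm f \<otimes> tm g)
      = (lin ?G \<cdot> (\<mu>\<^bsub>A\<^esub> \<otimes> ident C ?Y)) \<cdot> (?iA \<otimes> (fibre f \<otimes> tm g))"
    by (simp add: wcp_mul_eq assms assoc)
  also have "\<dots> = ((\<mu>\<^bsub>A\<^esub> \<otimes> ?iH) \<cdot> (?iA \<otimes> lin ?G)) \<cdot> (?iA \<otimes> (fibre f \<otimes> tm g))"
    using lin_left[of ?G] by simp
  also have "\<dots> = lin (twisted_core f g \<sigma>)"
    by (simp add: twisted_core_def lin_def[of "lin ?G \<cdot> (fibre f \<otimes> tm g)"] assoc interchange)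
  finally show ?thesis .
qed

end

section \<open>Sweedler calculus for a weak action\<close>

locale action_context = weak_action C H A + comodule C D d e X r
  for C :: "('o, 'm, 'z) category_data_scheme" (structure) and H A D d e X r
begin

abbreviation lmul where "lmul f m \<equiv> \<mu>\<^bsub>A\<^esub> \<cdot> pair r f m"
abbreviation rmul where "rmul m f \<equiv> \<mu>\<^bsub>A\<^esub> \<cdot> rpair r m f"
abbreviation actn where "actn x m \<equiv> \<phi>\<^bsub>A\<^esub> \<cdot> pair r x m"
abbreviation mulD where "mulD f g \<equiv> \<mu>\<^bsub>A\<^esub> \<cdot> pair d f g"
abbreviation actD where "actD x f \<equiv> \<phi>\<^bsub>A\<^esub> \<cdot> pair d x f"
abbreviation mulH where "mulH x y \<equiv> \<mu>\<^bsub>H\<^esub> \<cdot> pair d x y"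

text \<open>
  Only comultiplicative arrows to \<open>H\<close> may be repeated in a Sweedler expression. They are closed
  under products, but \<open>\<eta> \<circ> e\<close> is not one of them because \<open>H\<close> is only a weak bialgebra.
\<close>

definition element :: "'m \<Rightarrow> bool" where
  "element x \<longleftrightarrow> x \<in> Arr C \<and> Dom C x = D \<and> Cod C x = obj H \<and> \<delta>\<^bsub>H\<^esub> \<cdot> x = pair d x x"

lemma element_arr:
  assumes "element x"
  shows "x \<in> Arr C" "Dom C x = D" "Cod C x = obj H" "\<delta>\<^bsub>H\<^esub> \<cdot> x = pair d x x"
  using assms by (auto simp: element_def)

text \<open>A coefficient depends on the repeatable variables in \<open>D\<close> alone, whereas a
  \<open>vec\<close> may also contain the argument carried by \<open>X\<close>, which occurs
  once.\<close>

definition scal :: "'m \<Rightarrow> bool" where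
  "scal f \<longleftrightarrow> f \<in> Arr C \<and> Dom C f = D \<and> Cod C f = obj A"

definition vec :: "'m \<Rightarrow> bool" where
  "vec m \<longleftrightarrow> m \<in> Arr C \<and> Dom C m = X \<and> Cod C m = obj A"

lemma lmul_assoc:
  assumes "scal f" "scal g" "vec m"
  shows "lmul (mulD f g) m = lmul f (lmul g m)"
proof -
  note [simp] = assms[unfolded scal_def vec_def]
  have "lmul (mulD f g) m = \<mu>\<^bsub>A\<^esub> \<cdot> ((\<mu>\<^bsub>A\<^esub> \<otimes> ident C (obj A)) \<cdot> pair r (pair d f g) m)"
    by (simp add: tensor_pair)
  also have "\<dots> = \<mu>\<^bsub>A\<^esub> \<cdot> ((ident C (obj A) \<otimes> \<mu>\<^bsub>A\<^esub>) \<cdot> pair r f (pair r g m))"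
    by (simp add: mult_assoc pair_assoc flip: assoc)
  finally show ?thesis by (simp add: tensor_pair)
qed

lemma rmul_rmul:
  assumes "scal f" "scal g" "vec m"
  shows "rmul (rmul m f) g = rmul m (mulD f g)"
proof -
  note [simp] = assms[unfolded scal_def vec_def]
  have "rmul (rmul m f) g = \<mu>\<^bsub>A\<^esub> \<cdot> ((\<mu>\<^bsub>A\<^esub> \<otimes> ident C (obj A)) \<cdot> rpair r (rpair r m f) g)"
    by (simp add: tensor_rpair)
  also have "\<dots> = \<mu>\<^bsub>A\<^esub> \<cdot> ((ident C (obj A) \<otimes> \<mu>\<^bsub>A\<^esub>) \<cdot> rpair r m (pair d f g))"
    by (simp add: mult_assoc rpair_rpair flip: assoc)
  finally show ?thesis by (simp add: tensor_rpair)
qed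

lemma rmul_lmul:
  assumes "scal f" "scal g" "vec m"
  shows "rmul (lmul f m) g = lmul f (rmul m g)"
proof -
  note [simp] = assms[unfolded scal_def vec_def]
  have "rmul (lmul f m) g = \<mu>\<^bsub>A\<^esub> \<cdot> ((\<mu>\<^bsub>A\<^esub> \<otimes> ident C (obj A)) \<cdot> rpair r (pair r f m) g)"
    by (simp add: tensor_rpair)
  also have "\<dots> = \<mu>\<^bsub>A\<^esub> \<cdot> ((ident C (obj A) \<otimes> \<mu>\<^bsub>A\<^esub>) \<cdot> pair r f (rpair r m g))"
    by (simp add: mult_assoc rpair_pair flip: assoc)
  finally show ?thesis by (simp add: tensor_pair)
qed

text \<open>Axiom (b2) duplicates \<open>x\<close>; comultiplicativity turns its coproduct into two
  copies, and \<open>pair_exchange\<close> sends one of them past \<open>f\<close>.\<close>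

lemma actn_lmul:
  assumes "element x" "scal f" "vec m"
  shows "actn x (lmul f m) = lmul (actD x f) (actn x m)"
proof -
  note [simp] = assms(2,3)[unfolded scal_def vec_def] element_arr[OF assms(1)]
  let ?iH = "ident C (obj H)" and ?iA = "ident C (obj A)"
  have exchange: "(?iH \<otimes> (braid C (obj H) (obj A) \<otimes> ?iA)) \<cdot> pair r (pair d x x) (pair r f m)
      = pair r (pair d x f) (pair r x m)"
    using pair_exchange[of x x f m] by simp
  have "actn x (lmul f m) = (\<phi>\<^bsub>A\<^esub> \<cdot> (?iH \<otimes> \<mu>\<^bsub>A\<^esub>)) \<cdot> pair r x (pair r f m)"
    by (simp add: tensor_pair assoc)
  also have "\<dots> = \<mu>\<^bsub>A\<^esub> \<cdot> ((\<phi>\<^bsub>A\<^esub> \<otimes> \<phi>\<^bsub>A\<^esub>) \<cdot>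
    ((?iH \<otimes> (braid C (obj H) (obj A) \<otimes> ?iA)) \<cdot> pair r (pair d x x) (pair r f m)))"
    unfolding act_mult by (simp add: assoc) (simp add: tensor_pair)
  also have "\<dots> = lmul (actD x f) (actn x m)"
    unfolding exchange by (simp add: tensor_pair)
  finally show ?thesis .
qed

lemma actn_rmul:
  assumes "element x" "scal f" "vec m"
  shows "actn x (rmul m f) = rmul (actn x m) (actD x f)"
proof -
  note [simp] = assms(2,3)[unfolded scal_def vec_def] element_arr[OF assms(1)]
  let ?iH = "ident C (obj H)" and ?iA = "ident C (obj A)"
  have exchange: "(?iH \<otimes> (braid C (obj H) (obj A) \<otimes> ?iA)) \<cdot> pair r (pair d x x) (rpair r m f)
      = rpair r (pair r x m) (pair d x f)"
    using rpair_exchange[of x x f m] by simp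
  have "actn x (rmul m f) = (\<phi>\<^bsub>A\<^esub> \<cdot> (?iH \<otimes> \<mu>\<^bsub>A\<^esub>)) \<cdot> pair r x (rpair r m f)"
    by (simp add: tensor_pair assoc)
  also have "\<dots> = \<mu>\<^bsub>A\<^esub> \<cdot> ((\<phi>\<^bsub>A\<^esub> \<otimes> \<phi>\<^bsub>A\<^esub>) \<cdot>
    ((?iH \<otimes> (braid C (obj H) (obj A) \<otimes> ?iA)) \<cdot> pair r (pair d x x) (rpair r m f)))"
    unfolding act_mult by (simp add: assoc) (simp add: tensor_pair)
  also have "\<dots> = rmul (actn x m) (actD x f)"
    unfolding exchange by (simp add: tensor_rpair)
  finally show ?thesis .
qed

lemma comul_pair:
  assumes "element x" "element y"
  shows "HH.\<Delta> \<cdot> pair d x y = pair d (pair d x y) (pair d x y)"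
proof -
  note [simp] = element_arr[OF assms(1)] element_arr[OF assms(2)]
  have "HH.\<Delta> \<cdot> pair d x y = (ident C (obj H) \<otimes> (braid C (obj H) (obj H) \<otimes> ident C (obj H)))
      \<cdot> pair d (pair d x x) (pair d y y)"
    by (simp add: tensor_comul_def assoc self.tensor_pair tensor_assoc)
  then show ?thesis using self.pair_exchange[of x x y y] by simp
qed

text \<open>By (a1) the coproduct of \<open>x y\<close> is computed from \<open>HH.\<Delta>\<close>,
  and cocommutativity makes \<open>pair d x y\<close> comultiplicative for that coproduct.\<close>

lemma element_mulH:
  assumes "element x" "element y"
  shows "element (mulH x y)"
proof -
  note [simp] = element_arr[OF assms(1)] element_arr[OF assms(2)]
  have "\<delta>\<^bsub>H\<^esub> \<cdot> mulH x y = (\<mu>\<^bsub>H\<^esub> \<otimes> \<mu>\<^bsub>H\<^esub>) \<cdot> (HH.\<Delta> \<cdot> pair d x y)"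
    by (simp add: comul_mult flip: assoc)
  then show ?thesis
    by (simp add: element_def comul_pair assms self.tensor_pair)
qed

lemma unit_elem: "scal (\<eta>\<^bsub>A\<^esub> \<cdot> e)"
  by (simp add: scal_def)

lemma lmul_unit:
  assumes "vec m" shows "lmul (\<eta>\<^bsub>A\<^esub> \<cdot> e) m = m"
proof -
  note [simp] = assms[unfolded vec_def]
  have "lmul (\<eta>\<^bsub>A\<^esub> \<cdot> e) m = (\<mu>\<^bsub>A\<^esub> \<cdot> (\<eta>\<^bsub>A\<^esub> \<otimes> ident C (obj A))) \<cdot> pair r e m"
    by (simp add: tensor_pair assoc del: pair_counit)
  then show ?thesis by (simp add: unit_mult)
qed

lemma rmul_unit:
  assumes "vec m" shows "rmul m (\<eta>\<^bsub>A\<^esub> \<cdot> e) = m"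
proof -
  note [simp] = assms[unfolded vec_def]
  have "rmul m (\<eta>\<^bsub>A\<^esub> \<cdot> e) = (\<mu>\<^bsub>A\<^esub> \<cdot> (ident C (obj A) \<otimes> \<eta>\<^bsub>A\<^esub>)) \<cdot> rpair r m e"
    by (simp add: tensor_rpair assoc del: rpair_counit)
  then show ?thesis by (simp add: unit_mult)
qed

lemma actD_unit:
  assumes "element x" shows "actD x (\<eta>\<^bsub>A\<^esub> \<cdot> e) = u \<cdot> x"
proof -
  note [simp] = element_arr[OF assms(1)]
  have "actD x (\<eta>\<^bsub>A\<^esub> \<cdot> e) = u \<cdot> rpair d x e"
    by (simp add: u1_def assoc self.tensor_pair rpair_self del: self.rpair_counit)
  then show ?thesis by simp
qed

text \<open>Distribute the action of \<open>x\<close> over the product \<open>1 m\<close>; acting on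
  \<open>1\<close> leaves the factor \<open>u(x)\<close>.\<close>

lemma lmul_u:
  assumes "element x" "vec m" shows "lmul (u \<cdot> x) (actn x m) = actn x m"
  using actn_lmul[OF assms(1) unit_elem assms(2)] assms by (simp add: actD_unit lmul_unit)

lemma rmul_u:
  assumes "element x" "vec m" shows "rmul (actn x m) (u \<cdot> x) = actn x m"
  using actn_rmul[OF assms(1) unit_elem assms(2)] assms by (simp add: actD_unit rmul_unit)

lemma actD_u:
  assumes "element x" "element y" shows "actD x (u \<cdot> y) = u \<cdot> mulH x y"
proof -
  note [simp] = element_arr[OF assms(1)] element_arr[OF assms(2)]
  have "actD x (u \<cdot> y) = (\<phi>\<^bsub>A\<^esub> \<cdot> (ident C (obj H) \<otimes> u)) \<cdot> pair d x y"
    by (simp add: assoc self.tensor_pair)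
  then show ?thesis by (simp add: act_u assoc)
qed

lemma fibre_elem:
  assumes "element x" and [simp]: "f \<in> Arr C" "Dom C f = obj H" "Cod C f = obj A"
  shows "fibre f \<cdot> x = pair d (f \<cdot> x) x"
proof -
  note [simp] = element_arr[OF assms(1)]
  show ?thesis by (simp add: fibre_def assoc self.tensor_pair)
qed

text \<open>Evaluation rule common to \<open>tm\<close>, with \<open>g\<close> a fibre, and to the
  cocycle part of the product, with \<open>g = sigma C H \<sigma>\<close>.\<close>

lemma lin_elem:
  assumes "vec m" and [simp]: "g \<in> Arr C" "Dom C g = Y" "Cod C g = obj A \<odot> obj H"
    and [simp]: "y \<in> Arr C" "Dom C y = D" "Cod C y = Y"
    and [simp]: "scal f" "p \<in> Arr C" "Dom C p = D" "Cod C p = obj H"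
    and eq: "g \<cdot> y = pair d f p"
  shows "lin g \<cdot> rpair r m y = rpair r (rmul m f) p"
proof -
  note [simp] = assms(1)[unfolded vec_def] \<open>scal f\<close>[unfolded scal_def]
  have "lin g \<cdot> rpair r m y = (\<mu>\<^bsub>A\<^esub> \<otimes> ident C (obj H)) \<cdot> rpair r m (g \<cdot> y)"
    by (simp add: lin_def assoc tensor_rpair)
  also have "\<dots> = (\<mu>\<^bsub>A\<^esub> \<otimes> ident C (obj H)) \<cdot> rpair r (rpair r m f) p"
    by (simp add: eq rpair_rpair)
  finally show ?thesis by (simp add: tensor_rpair)
qed

lemma tm_elem:
  assumes "element x" "vec m" and [simp]: "f \<in> Arr C" "Dom C f = obj H" "Cod C f = obj A"
  shows "tm f \<cdot> rpair r m x = rpair r (rmul m (f \<cdot> x)) x"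
  unfolding tm_def
  using assms(1,2) element_arr[OF assms(1)] by (intro lin_elem) (simp_all add: fibre_elem scal_def)

lemma psi_elem:
  assumes "element x" "vec m"
  shows "psi C H A \<cdot> pair r x m = rpair r (actn x m) x"
proof -
  note [simp] = element_arr[OF assms(1)] assms(2)[unfolded vec_def]
  let ?iA = "ident C (obj A)" and ?iH = "ident C (obj H)" and ?c = "braid C (obj H) (obj A)"
  have "psi C H A \<cdot> pair r x m = (\<phi>\<^bsub>A\<^esub> \<otimes> ?iH) \<cdot> ((?iH \<otimes> ?c) \<cdot> ((\<delta>\<^bsub>H\<^esub> \<otimes> ?iA) \<cdot> pair r x m))"
    by (simp add: psi_def assoc)
  also have "(?iH \<otimes> ?c) \<cdot> ((\<delta>\<^bsub>H\<^esub> \<otimes> ?iA) \<cdot> pair r x m) = (?iH \<otimes> ?c) \<cdot> pair r x (pair r x m)"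
    by (simp add: tensor_pair pair_assoc)
  also have "\<dots> = pair r x (rpair r m x)"
    by (simp add: tensor_pair rpair_def)
  also have "(\<phi>\<^bsub>A\<^esub> \<otimes> ?iH) \<cdot> \<dots> = rpair r (actn x m) x"
    by (simp add: tensor_rpair flip: rpair_pair)
  finally show ?thesis .
qed

lemma sigma_elem:
  assumes "element x" "element y" "\<sigma> \<in> Arr C" "Dom C \<sigma> = obj H \<odot> obj H" "Cod C \<sigma> = obj A"
  shows "sigma C H \<sigma> \<cdot> pair d x y = pair d (\<sigma> \<cdot> pair d x y) (mulH x y)"
proof -
  note [simp] = element_arr[OF assms(1)] element_arr[OF assms(2)] assms(3-5)
  have "sigma C H \<sigma> \<cdot> pair d x y = (\<sigma> \<otimes> \<mu>\<^bsub>H\<^esub>) \<cdot> (HH.\<Delta> \<cdot> pair d x y)"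
    by (simp add: sigma_def comul2_def assoc)
  then show ?thesis by (simp add: comul_pair assms(1,2) self.tensor_pair)
qed

text \<open>\<open>psi\<close> moves \<open>x\<close> past the argument \<open>m\<close>, leaving
  one copy acting on it, and \<open>sigma\<close> merges the other copy with \<open>y\<close>: the
  usual crossed product formula.\<close>

lemma wcp_core_elem:
  assumes "element x" "element y" "vec m"
    "\<sigma> \<in> Arr C" "Dom C \<sigma> = obj H \<odot> obj H" "Cod C \<sigma> = obj A"
  shows "wcp_core \<sigma> \<cdot> pair r x (rpair r m y)
    = rpair r (rmul (actn x m) (\<sigma> \<cdot> pair d x y)) (mulH x y)"
proof -
  note [simp] = element_arr[OF assms(1)] element_arr[OF assms(2)] assms(4-6) assms(3)[unfolded vec_def]
  have v: "vec (actn x m)" by (simp add: vec_def)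
  have "(psi C H A \<otimes> ident C (obj H)) \<cdot> pair r x (rpair r m y)
      = (psi C H A \<otimes> ident C (obj H)) \<cdot> rpair r (pair r x m) y"
    by (simp add: rpair_pair)
  also have "\<dots> = rpair r (rpair r (actn x m) x) y"
    by (simp add: tensor_rpair psi_elem assms)
  also have "\<dots> = rpair r (actn x m) (pair d x y)"
    by (simp add: rpair_rpair)
  finally have "wcp_core \<sigma> \<cdot> pair r x (rpair r m y) = lin (sigma C H \<sigma>) \<cdot> rpair r (actn x m) (pair d x y)"
    by (simp add: wcp_core_def assoc)
  also have "\<dots> = rpair r (rmul (actn x m) (\<sigma> \<cdot> pair d x y)) (mulH x y)"
    by (intro lin_elem v) (simp_all add: scal_def sigma_elem assms(1,2))
  finally show ?thesis .
qed

lemma twisted_core_elem: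
  assumes "element x" "element y" "vec m"
    "\<sigma> \<in> Arr C" "Dom C \<sigma> = obj H \<odot> obj H" "Cod C \<sigma> = obj A"
    "f \<in> Arr C" "Dom C f = obj H" "Cod C f = obj A" "g \<in> Arr C" "Dom C g = obj H" "Cod C g = obj A"
  shows "twisted_core f g \<sigma> \<cdot> pair r x (rpair r m y)
    = rpair r (lmul (f \<cdot> x) (rmul (actn x (rmul m (g \<cdot> y))) (\<sigma> \<cdot> pair d x y))) (mulH x y)"
proof -
  note [simp] = element_arr[OF assms(1)] element_arr[OF assms(2)] assms(4-) assms(3)[unfolded vec_def]
  define n where "n = rmul m (g \<cdot> y)"
  define k where "k = rmul (actn x n) (\<sigma> \<cdot> pair d x y)"
  have [simp]: "n \<in> Arr C" "Dom C n = X" "Cod C n = obj A" by (simp_all add: n_def)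
  have [simp]: "k \<in> Arr C" "Dom C k = X" "Cod C k = obj A" by (simp_all add: k_def)
  have v: "vec n" by (simp add: vec_def)
  have "(fibre f \<otimes> tm g) \<cdot> pair r x (rpair r m y) = pair r (fibre f \<cdot> x) (tm g \<cdot> rpair r m y)"
    by (simp add: tensor_pair)
  also have "\<dots> = pair r (f \<cdot> x) (pair r x (rpair r n y))"
    by (simp add: fibre_elem tm_elem assms pair_assoc n_def)
  finally have "twisted_core f g \<sigma> \<cdot> pair r x (rpair r m y)
      = lin (wcp_core \<sigma>) \<cdot> pair r (f \<cdot> x) (pair r x (rpair r n y))"
    by (simp add: twisted_core_def assoc)
  also have "\<dots> = (\<mu>\<^bsub>A\<^esub> \<otimes> ident C (obj H)) \<cdot> pair r (f \<cdot> x) (wcp_core \<sigma> \<cdot> pair r x (rpair r n y))"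
    by (simp add: lin_def assoc tensor_pair)
  also have "\<dots> = (\<mu>\<^bsub>A\<^esub> \<otimes> ident C (obj H)) \<cdot> rpair r (pair r (f \<cdot> x) k) (mulH x y)"
    by (simp add: wcp_core_elem[OF assms(1,2) v assms(4-6)] rpair_pair k_def)
  also have "\<dots> = rpair r (lmul (f \<cdot> x) k) (mulH x y)"
    by (simp add: tensor_rpair)
  finally show ?thesis by (simp only: k_def n_def)
qed

end

sublocale action_context \<subseteq> base: action_context C H A D d e D d
  by unfold_locales

section \<open>Counit axioms and the map \<open>Pi_L\<close>\<close>

context weak_action
begin

lemma counit_mult: "\<epsilon>\<^bsub>H\<^esub> \<cdot> (\<mu>\<^bsub>H\<^esub> \<cdot> (\<mu>\<^bsub>H\<^esub> \<otimes> ident C (obj H))) = (\<epsilon>\<^bsub>H\<^esub> \<otimes> \<epsilon>\<^bsub>H\<^esub>) \<cdot>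
    ((\<mu>\<^bsub>H\<^esub> \<otimes> \<mu>\<^bsub>H\<^esub>) \<cdot> (ident C (obj H) \<otimes> (\<delta>\<^bsub>H\<^esub> \<otimes> ident C (obj H))))"
proof -
  have "\<epsilon>\<^bsub>H\<^esub> \<cdot> \<mu>\<^bsub>H\<^esub> \<cdot> (\<mu>\<^bsub>H\<^esub> \<otimes> ident C (obj H)) =
      (\<epsilon>\<^bsub>H\<^esub> \<otimes> \<epsilon>\<^bsub>H\<^esub>) \<cdot> (\<mu>\<^bsub>H\<^esub> \<otimes> \<mu>\<^bsub>H\<^esub>) \<cdot> (ident C (obj H) \<otimes> \<delta>\<^bsub>H\<^esub> \<otimes> ident C (obj H))"
    using weak_hopf unfolding weak_hopf_algebra_def by blast
  then show ?thesis by (simp add: assoc tensor_assoc)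
qed

lemma comul_unit: "(\<delta>\<^bsub>H\<^esub> \<otimes> ident C (obj H)) \<cdot> (\<delta>\<^bsub>H\<^esub> \<cdot> \<eta>\<^bsub>H\<^esub>)
    = (ident C (obj H) \<otimes> (\<mu>\<^bsub>H\<^esub> \<otimes> ident C (obj H))) \<cdot> ((\<delta>\<^bsub>H\<^esub> \<cdot> \<eta>\<^bsub>H\<^esub>) \<otimes> (\<delta>\<^bsub>H\<^esub> \<cdot> \<eta>\<^bsub>H\<^esub>))"
proof -
  have "(\<delta>\<^bsub>H\<^esub> \<otimes> ident C (obj H)) \<cdot> \<delta>\<^bsub>H\<^esub> \<cdot> \<eta>\<^bsub>H\<^esub> =
      (ident C (obj H) \<otimes> \<mu>\<^bsub>H\<^esub> \<otimes> ident C (obj H)) \<cdot> (\<delta>\<^bsub>H\<^esub> \<otimes> \<delta>\<^bsub>H\<^esub>) \<cdot> (\<eta>\<^bsub>H\<^esub> \<otimes> \<eta>\<^bsub>H\<^esub>)"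
    using weak_hopf unfolding weak_hopf_algebra_def by blast
  then show ?thesis by (simp add: assoc tensor_assoc interchange)
qed

abbreviation s where "s \<equiv> \<epsilon>\<^bsub>H\<^esub> \<cdot> \<mu>\<^bsub>H\<^esub>"

text \<open>Cocommutativity interchanges the two legs of \<open>\<delta>(1)\<close>, after which
  naturality removes the braiding of the definition:
  \<open>Pi_L(y) = 1_1 \<epsilon>(1_2 y)\<close>.\<close>

lemma Pi_L_eq: "Pi_L C H = (ident C (obj H) \<otimes> s) \<cdot> ((\<delta>\<^bsub>H\<^esub> \<cdot> \<eta>\<^bsub>H\<^esub>) \<otimes> ident C (obj H))"
proof -
  let ?iH = "ident C (obj H)" and ?c = "braid C (obj H) (obj H)"
  have "\<delta>\<^bsub>H\<^esub> \<cdot> \<eta>\<^bsub>H\<^esub> = ?c \<cdot> (\<delta>\<^bsub>H\<^esub> \<cdot> \<eta>\<^bsub>H\<^esub>)" by (simp add: H.cocomm flip: assoc)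
  then have "Pi_L C H = (s \<otimes> ?iH) \<cdot> ((?iH \<otimes> ?c) \<cdot> ((?c \<cdot> (\<delta>\<^bsub>H\<^esub> \<cdot> \<eta>\<^bsub>H\<^esub>)) \<otimes> ?iH))"
    unfolding Pi_L_def by (simp add: assoc)
  also have "\<dots> = (s \<otimes> ?iH) \<cdot> (braid C (obj H) (obj H \<odot> obj H) \<cdot> ((\<delta>\<^bsub>H\<^esub> \<cdot> \<eta>\<^bsub>H\<^esub>) \<otimes> ?iH))"
    by (simp add: braid_hexagon assoc comp_tensor_ident[of ?c "\<delta>\<^bsub>H\<^esub> \<cdot> \<eta>\<^bsub>H\<^esub>"])
  also have "\<dots> = ((s \<otimes> ?iH) \<cdot> braid C (obj H) (obj H \<odot> obj H)) \<cdot> ((\<delta>\<^bsub>H\<^esub> \<cdot> \<eta>\<^bsub>H\<^esub>) \<otimes> ?iH)"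
    by (simp add: assoc)
  also have "(s \<otimes> ?iH) \<cdot> braid C (obj H) (obj H \<odot> obj H) = ?iH \<otimes> s"
    using naturality[of ?iH s "obj H" "obj H" "obj H \<odot> obj H" \<K>] by simp
  finally show ?thesis .
qed

lemma Pi_L_arr [simp]: "Pi_L C H \<in> Arr C" "Dom C (Pi_L C H) = obj H" "Cod C (Pi_L C H) = obj H"
  by (simp_all add: Pi_L_eq)

text \<open>By (a3), \<open>1_1 \<otimes> 1_2 1'_1 \<otimes> 1'_2\<close> is the iterated coproduct
  of \<open>1\<close>; the counit on the middle leg gives both sides.\<close>

lemma Pi_L_unit: "(Pi_L C H \<otimes> ident C (obj H)) \<cdot> (\<delta>\<^bsub>H\<^esub> \<cdot> \<eta>\<^bsub>H\<^esub>) = \<delta>\<^bsub>H\<^esub> \<cdot> \<eta>\<^bsub>H\<^esub>"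
proof -
  let ?iH = "ident C (obj H)" and ?d = "\<delta>\<^bsub>H\<^esub> \<cdot> \<eta>\<^bsub>H\<^esub>"
  have "Pi_L C H \<otimes> ?iH = (?iH \<otimes> (s \<otimes> ?iH)) \<cdot> (?d \<otimes> ident C (obj H \<odot> obj H))"
    by (simp add: Pi_L_eq comp_tensor_ident tensor_assoc)
  then have "(Pi_L C H \<otimes> ?iH) \<cdot> ?d = (?iH \<otimes> (s \<otimes> ?iH)) \<cdot> (?d \<otimes> ?d)"
    by (simp add: assoc interchange[of "ident C \<K>" ?d ?d "ident C (obj H \<odot> obj H)", simplified] del: tensor_ident_ident)
  also have "\<dots> = (?iH \<otimes> (\<epsilon>\<^bsub>H\<^esub> \<otimes> ?iH)) \<cdot> ((?iH \<otimes> (\<mu>\<^bsub>H\<^esub> \<otimes> ?iH)) \<cdot> (?d \<otimes> ?d))"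
    by (simp add: interchange_tail interchange)
  also have "\<dots> = (?iH \<otimes> (\<epsilon>\<^bsub>H\<^esub> \<otimes> ?iH)) \<cdot> ((\<delta>\<^bsub>H\<^esub> \<otimes> ?iH) \<cdot> ?d)"
    by (simp add: comul_unit)
  also have "\<dots> = (((?iH \<otimes> \<epsilon>\<^bsub>H\<^esub>) \<cdot> \<delta>\<^bsub>H\<^esub>) \<otimes> ?iH) \<cdot> ?d"
    by (simp add: interchange_tail flip: tensor_assoc)
  also have "(?iH \<otimes> \<epsilon>\<^bsub>H\<^esub>) \<cdot> \<delta>\<^bsub>H\<^esub> = ?iH"
    using H.rpair_self[of ?iH "\<epsilon>\<^bsub>H\<^esub>"] by (simp add: pair_def)
  finally show ?thesis by simp
qed

lemma comul_unit_swap: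
  assumes [simp]: "f \<in> Arr C" "Dom C f = obj H"
  shows "(ident C (obj H) \<otimes> f) \<cdot> (\<delta>\<^bsub>H\<^esub> \<cdot> \<eta>\<^bsub>H\<^esub>)
    = braid C (Cod C f) (obj H) \<cdot> ((f \<otimes> ident C (obj H)) \<cdot> (\<delta>\<^bsub>H\<^esub> \<cdot> \<eta>\<^bsub>H\<^esub>))"
proof -
  have "\<delta>\<^bsub>H\<^esub> \<cdot> \<eta>\<^bsub>H\<^esub> = braid C (obj H) (obj H) \<cdot> (\<delta>\<^bsub>H\<^esub> \<cdot> \<eta>\<^bsub>H\<^esub>)"
    by (simp add: H.cocomm flip: assoc)
  then show ?thesis
    using naturality_tail[of f "ident C (obj H)" "obj H" "Cod C f" "obj H" "obj H" "\<delta>\<^bsub>H\<^esub> \<cdot> \<eta>\<^bsub>H\<^esub>"]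
    by simp
qed

lemma Pi_L_unit': "(ident C (obj H) \<otimes> Pi_L C H) \<cdot> (\<delta>\<^bsub>H\<^esub> \<cdot> \<eta>\<^bsub>H\<^esub>) = \<delta>\<^bsub>H\<^esub> \<cdot> \<eta>\<^bsub>H\<^esub>"
  by (simp add: comul_unit_swap Pi_L_unit) (simp add: H.cocomm flip: assoc)

text \<open>One direction holds because \<open>g(Pi_L(y)) = g(1_1) \<epsilon>(1_2 y)\<close> sees
  \<open>g\<close> only through \<open>g(1_1) \<otimes> 1_2\<close>, the other because
  \<open>Pi_L(1_1) \<otimes> 1_2 = 1_1 \<otimes> 1_2\<close>.\<close>

lemma fibre_unit_iff:
  assumes [simp]: "f \<in> Arr C" "Dom C f = obj H" "Cod C f = obj A"
  shows "fibre f \<cdot> \<eta>\<^bsub>H\<^esub> = fibre u \<cdot> \<eta>\<^bsub>H\<^esub> \<longleftrightarrow> f \<cdot> Pi_L C H = u"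
proof
  have *: "g \<cdot> Pi_L C H = (ident C (obj A) \<otimes> s) \<cdot> ((fibre g \<cdot> \<eta>\<^bsub>H\<^esub>) \<otimes> ident C (obj H))"
    if [simp]: "g \<in> Arr C" "Dom C g = obj H" "Cod C g = obj A" for g
  proof -
    have "g \<cdot> Pi_L C H = (g \<otimes> s) \<cdot> ((\<delta>\<^bsub>H\<^esub> \<cdot> \<eta>\<^bsub>H\<^esub>) \<otimes> ident C (obj H))"
      using interchange_tail[of "ident C (obj H)" g s "ident C \<K>" "(\<delta>\<^bsub>H\<^esub> \<cdot> \<eta>\<^bsub>H\<^esub>) \<otimes> ident C (obj H)"]
      by (simp add: Pi_L_eq)
    also have "\<dots> = (ident C (obj A) \<otimes> s) \<cdot> (((g \<otimes> ident C (obj H)) \<otimes> ident C (obj H))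
        \<cdot> ((\<delta>\<^bsub>H\<^esub> \<cdot> \<eta>\<^bsub>H\<^esub>) \<otimes> ident C (obj H)))"
      by (simp add: tensor_assoc interchange_tail)
    finally show ?thesis by (simp add: interchange fibre_def assoc)
  qed
  assume "fibre f \<cdot> \<eta>\<^bsub>H\<^esub> = fibre u \<cdot> \<eta>\<^bsub>H\<^esub>"
  then show "f \<cdot> Pi_L C H = u" using *[of f] *[of u] u_Pi by simp
next
  have *: "fibre g \<cdot> \<eta>\<^bsub>H\<^esub> = fibre (g \<cdot> Pi_L C H) \<cdot> \<eta>\<^bsub>H\<^esub>"
    if [simp]: "g \<in> Arr C" "Dom C g = obj H" "Cod C g = obj A" for g
    by (simp add: fibre_def assoc comp_tensor_ident Pi_L_unit)
  assume "f \<cdot> Pi_L C H = u"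
  then show "fibre f \<cdot> \<eta>\<^bsub>H\<^esub> = fibre u \<cdot> \<eta>\<^bsub>H\<^esub>"
    using *[of f] by simp
qed

end

context cocommutative_coalgebra
begin

lemma pair_scalar_swap:
  assumes "a \<in> Arr C" "Dom C a = D" "Cod C a = \<K>" "q \<in> Arr C" "Dom C q = D"
  shows "pair d a q = pair d q a"
  using pair_swap[of a q] assms by simp

end

context comodule
begin

lemma pair_scalar_left_commute:
  assumes [simp]: "a \<in> Arr C" "Dom C a = D" "Cod C a = \<K>" "p \<in> Arr C" "Dom C p = D"
    "m \<in> Arr C" "Dom C m = X"
  shows "pair r p (pair r a m) = pair r a (pair r p m)"
  using pair_scalar_swap[of a p] by (simp flip: pair_assoc)

lemma comp_pair_scalar:
  assumes [simp]: "a \<in> Arr C" "Dom C a = D" "Cod C a = \<K>"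
    "m \<in> Arr C" "Dom C m = X" "g \<in> Arr C" "Dom C g = Cod C m"
  shows "g \<cdot> pair r a m = pair r a (g \<cdot> m)"
  using tensor_pair[of a m "ident C \<K>" g] by simp

end

context action_context
begin

abbreviation cnt where "cnt x y \<equiv> \<epsilon>\<^bsub>H\<^esub> \<cdot> (\<mu>\<^bsub>H\<^esub> \<cdot> pair d x y)"

lemma counit_mulH:
  assumes "element x" "element y" "element z"
  shows "cnt (mulH x y) z = pair d (cnt x y) (cnt y z)"
proof -
  note [simp] = element_arr[OF assms(1)] element_arr[OF assms(2)] element_arr[OF assms(3)]
  let ?iH = "ident C (obj H)"
  have "cnt (mulH x y) z = (\<epsilon>\<^bsub>H\<^esub> \<cdot> (\<mu>\<^bsub>H\<^esub> \<cdot> (\<mu>\<^bsub>H\<^esub> \<otimes> ?iH))) \<cdot> pair d (pair d x y) z"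
    by (simp add: assoc) (simp add: self.tensor_pair)
  also have "\<dots> = (\<epsilon>\<^bsub>H\<^esub> \<otimes> \<epsilon>\<^bsub>H\<^esub>) \<cdot> ((\<mu>\<^bsub>H\<^esub> \<otimes> \<mu>\<^bsub>H\<^esub>) \<cdot> ((?iH \<otimes> (\<delta>\<^bsub>H\<^esub> \<otimes> ?iH)) \<cdot> pair d x (pair d y z)))"
    unfolding counit_mult by (simp add: assoc self.pair_assoc)
  also have "(?iH \<otimes> (\<delta>\<^bsub>H\<^esub> \<otimes> ?iH)) \<cdot> pair d x (pair d y z) = pair d (pair d x y) (pair d y z)"
    by (simp add: self.tensor_pair self.pair_assoc)
  finally show ?thesis by (simp add: self.tensor_pair)
qed

lemma counit_element:
  assumes "element z" and [simp]: "g \<in> Arr C" "Dom C g = obj H"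
  shows "pair d (\<epsilon>\<^bsub>H\<^esub> \<cdot> z) (g \<cdot> z) = g \<cdot> z"
proof -
  note [simp] = element_arr[OF assms(1)]
  have "pair d (\<epsilon>\<^bsub>H\<^esub> \<cdot> z) (g \<cdot> z) = (\<epsilon>\<^bsub>H\<^esub> \<otimes> g) \<cdot> (\<delta>\<^bsub>H\<^esub> \<cdot> z)"
    by (simp add: self.tensor_pair)
  also have "\<dots> = pair \<delta>\<^bsub>H\<^esub> \<epsilon>\<^bsub>H\<^esub> g \<cdot> z"
    by (simp add: pair_def assoc del: element_arr)
  finally show ?thesis by simp
qed

text \<open>Axiom (a2) splits off a factor \<open>\<epsilon>(x y)\<close>, which the product
  \<open>x y\<close> absorbs by the counit law.\<close>

lemma counit_mulH_absorb:
  assumes "element x" "element y" "element z"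
  shows "pair d (cnt (mulH x y) z) (mulH x y) = pair d (cnt y z) (mulH x y)"
proof -
  note [simp] = element_arr[OF assms(1)] element_arr[OF assms(2)] element_arr[OF assms(3)]
  have "pair d (cnt x y) (mulH x y) = mulH x y"
    using counit_element[OF element_mulH[OF assms(1,2)], of "ident C (obj H)"] by simp
  moreover have "pair d (cnt (mulH x y) z) (mulH x y)
      = pair d (cnt y z) (pair d (cnt x y) (mulH x y))"
    by (simp add: counit_mulH assms self.pair_assoc) (subst self.pair_scalar_left_commute; simp)
  ultimately show ?thesis by simp
qed

end

context weak_action
begin

text \<open>\<open>x Pi_L(y) = \<epsilon>(x\<^sub>1 y) x\<^sub>2\<close>: write \<open>\<epsilon>(x\<^sub>1 y) x\<^sub>2\<close> with \<open>x = x 1\<close>, and split \<open>\<epsilon>(x 1 y)\<close> by (a2). The unit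
  is inserted as a third variable and specialised only at the end.\<close>

lemma mult_Pi_L: "\<mu>\<^bsub>H\<^esub> \<cdot> (ident C (obj H) \<otimes> Pi_L C H) = pair HH.\<Delta> s HH.\<pi>\<^sub>1"
proof -
  let ?iH = "ident C (obj H)" and ?k = "ident C (obj H) \<otimes> (\<eta>\<^bsub>H\<^esub> \<otimes> ident C (obj H))"
  interpret T: coalgebra_pair C "obj H" "\<delta>\<^bsub>H\<^esub>" "\<epsilon>\<^bsub>H\<^esub>" "obj H \<odot> obj H" HH.\<Delta> "\<epsilon>\<^bsub>H\<^esub> \<otimes> \<epsilon>\<^bsub>H\<^esub>"
    by unfold_locales
  interpret E: action_context C H A "obj H \<odot> (obj H \<odot> obj H)" T.\<Delta> "\<epsilon>\<^bsub>H\<^esub> \<otimes> (\<epsilon>\<^bsub>H\<^esub> \<otimes> \<epsilon>\<^bsub>H\<^esub>)"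
    "obj H \<odot> (obj H \<odot> obj H)" T.\<Delta>
    by unfold_locales
  \<comment> \<open>The three coordinates of the triple product; \<open>y\<close> marks the slot
    that \<open>?k\<close> fills with \<open>1\<close> at the end.\<close>
  define x y z where "x = T.\<pi>\<^sub>1" and "y = HH.\<pi>\<^sub>1 \<cdot> T.\<pi>\<^sub>2" and "z = HH.\<pi>\<^sub>2 \<cdot> T.\<pi>\<^sub>2"
  have arr [simp]: "x \<in> Arr C" "Dom C x = obj H \<odot> (obj H \<odot> obj H)" "Cod C x = obj H"
    "y \<in> Arr C" "Dom C y = obj H \<odot> (obj H \<odot> obj H)" "Cod C y = obj H"
    "z \<in> Arr C" "Dom C z = obj H \<odot> (obj H \<odot> obj H)" "Cod C z = obj H"
    by (simp_all add: x_def y_def z_def)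
  have pair_p2: "pair HH.\<Delta> p q \<cdot> T.\<pi>\<^sub>2 = pair T.\<Delta> (p \<cdot> T.\<pi>\<^sub>2) (q \<cdot> T.\<pi>\<^sub>2)"
    if [simp]: "p \<in> Arr C" "Dom C p = obj H \<odot> obj H" "q \<in> Arr C" "Dom C q = obj H \<odot> obj H" for p q
    by (rule HH.prod.self.pair_comp) (simp_all add: in_hom T.comul_projections pair_def)
  have el: "E.element x" "E.element y" "E.element z"
    unfolding E.element_def
    by (simp_all add: x_def T.comul_projections)
       (simp_all add: y_def z_def HH.comul_projections pair_p2 flip: assoc)
  have yz: "pair T.\<Delta> y z = T.\<pi>\<^sub>2"
    using pair_p2[of HH.\<pi>\<^sub>1 HH.\<pi>\<^sub>2] by (simp add: y_def z_def HH.pair_projections)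
  have xy: "E.mulH x y = \<mu>\<^bsub>H\<^esub> \<cdot> (?iH \<otimes> HH.\<pi>\<^sub>1)"
  proof -
    have "pair T.\<Delta> x y = (?iH \<otimes> HH.\<pi>\<^sub>1) \<cdot> pair T.\<Delta> T.\<pi>\<^sub>1 T.\<pi>\<^sub>2"
      by (subst T.prod.self.tensor_pair) (simp_all add: x_def y_def)
    then show ?thesis by (simp add: T.pair_projections)
  qed
  have xyz: "pair T.\<Delta> (E.mulH x y) z = \<mu>\<^bsub>H\<^esub> \<otimes> ?iH"
  proof -
    have "pair T.\<Delta> (E.mulH x y) z = (\<mu>\<^bsub>H\<^esub> \<otimes> ?iH) \<cdot> pair T.\<Delta> x (pair T.\<Delta> y z)"
      by (simp add: T.prod.self.tensor_pair flip: T.prod.self.pair_assoc)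
    also have "\<dots> = \<mu>\<^bsub>H\<^esub> \<otimes> ?iH"
      unfolding yz by (simp add: x_def T.pair_projections)
    finally show ?thesis .
  qed
  have m: "E.element (E.mulH x y)" using el(1,2) by (rule E.element_mulH)
  have "pair HH.\<Delta> s HH.\<pi>\<^sub>1 \<cdot> (\<mu>\<^bsub>H\<^esub> \<otimes> ?iH) = pair T.\<Delta> (E.cnt (E.mulH x y) z) (E.mulH x y)"
  proof -
    have "\<mu>\<^bsub>H\<^esub> \<cdot> (?iH \<otimes> HH.\<pi>\<^sub>1) = HH.\<pi>\<^sub>1 \<cdot> (\<mu>\<^bsub>H\<^esub> \<otimes> ?iH)"
      using interchange[of "ident C (obj H \<odot> obj H)" "\<mu>\<^bsub>H\<^esub>" "\<epsilon>\<^bsub>H\<^esub>" "ident C \<K>"]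
      by (simp add: interchange)
    then have "HH.\<pi>\<^sub>1 \<cdot> (\<mu>\<^bsub>H\<^esub> \<otimes> ?iH) = E.mulH x y"
      by (simp add: xy)
    moreover have "pair HH.\<Delta> s HH.\<pi>\<^sub>1 \<cdot> pair T.\<Delta> (E.mulH x y) z
        = pair T.\<Delta> (s \<cdot> pair T.\<Delta> (E.mulH x y) z) (HH.\<pi>\<^sub>1 \<cdot> pair T.\<Delta> (E.mulH x y) z)"
      by (rule HH.prod.self.pair_comp) (simp_all add: in_hom E.comul_pair m el flip: pair_def)
    ultimately show ?thesis by (simp add: xyz assoc)
  qed
  also have "\<dots> = pair T.\<Delta> (E.cnt y z) (E.mulH x y)"
    using el by (rule E.counit_mulH_absorb)
  \<comment> \<open>The scalar \<open>\<epsilon>(y z)\<close> moves to the right, the position in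
    which \<open>T.pair_comul_right\<close> cancels the coproduct of \<open>x\<close>.\<close>
  also have "\<dots> = pair T.\<Delta> (E.mulH x y) (\<epsilon>\<^bsub>H\<^esub> \<otimes> s)"
  proof -
    have "E.cnt y z = \<epsilon>\<^bsub>H\<^esub> \<otimes> s"
      using interchange[of "\<epsilon>\<^bsub>H\<^esub>" "ident C \<K>" "ident C (obj H \<odot> obj H)" s]
      unfolding yz by (simp add: assoc)
    then show ?thesis
      using T.prod.pair_scalar_swap[of "\<epsilon>\<^bsub>H\<^esub> \<otimes> s" "E.mulH x y"] by simp
  qed
  also have "\<dots> = \<mu>\<^bsub>H\<^esub> \<cdot> (?iH \<otimes> ((?iH \<otimes> s) \<cdot> (\<delta>\<^bsub>H\<^esub> \<otimes> ?iH)))"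
  proof -
    have "pair HH.\<Delta> HH.\<pi>\<^sub>1 s = (?iH \<otimes> s) \<cdot> (\<delta>\<^bsub>H\<^esub> \<otimes> ?iH)"
      by (rule HH.pair_comul_left) simp_all
    moreover have "pair T.\<Delta> (E.mulH x y) (\<epsilon>\<^bsub>H\<^esub> \<otimes> s) = (E.mulH x y \<otimes> s) \<cdot> (?iH \<otimes> HH.\<Delta>)"
      by (rule T.pair_comul_right) simp_all
    moreover have "E.mulH x y \<otimes> s = \<mu>\<^bsub>H\<^esub> \<cdot> (?iH \<otimes> (HH.\<pi>\<^sub>1 \<otimes> s))"
      using interchange[of "?iH \<otimes> HH.\<pi>\<^sub>1" "\<mu>\<^bsub>H\<^esub>" s "ident C \<K>"] by (simp add: xy tensor_assoc)
    ultimately show ?thesis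
      by (simp add: assoc interchange pair_def)
  qed
  finally have "(pair HH.\<Delta> s HH.\<pi>\<^sub>1 \<cdot> (\<mu>\<^bsub>H\<^esub> \<otimes> ?iH)) \<cdot> ?k
      = (\<mu>\<^bsub>H\<^esub> \<cdot> (?iH \<otimes> ((?iH \<otimes> s) \<cdot> (\<delta>\<^bsub>H\<^esub> \<otimes> ?iH)))) \<cdot> ?k" by simp
  moreover have "(pair HH.\<Delta> s HH.\<pi>\<^sub>1 \<cdot> (\<mu>\<^bsub>H\<^esub> \<otimes> ?iH)) \<cdot> ?k = pair HH.\<Delta> s HH.\<pi>\<^sub>1"
  proof -
    have "?k = (?iH \<otimes> \<eta>\<^bsub>H\<^esub>) \<otimes> ?iH" by (simp add: tensor_assoc)
    then have "(\<mu>\<^bsub>H\<^esub> \<otimes> ?iH) \<cdot> ?k = ident C (obj H \<odot> obj H)"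
      by (simp add: interchange unit_mult)
    then show ?thesis by (simp add: assoc)
  qed
  moreover have "(\<mu>\<^bsub>H\<^esub> \<cdot> (?iH \<otimes> ((?iH \<otimes> s) \<cdot> (\<delta>\<^bsub>H\<^esub> \<otimes> ?iH)))) \<cdot> ?k = \<mu>\<^bsub>H\<^esub> \<cdot> (?iH \<otimes> Pi_L C H)"
    by (simp add: Pi_L_eq assoc interchange)
  ultimately show ?thesis by simp
qed

end

section \<open>Evaluation of the multiplicativity identity\<close>

context weak_action
begin

text \<open>Members of \<open>Reg2\<close> are invertible relative to \<open>u(x y)\<close>, not to
  the unit of convolution; this says that \<open>\<sigma>\<close> lies in the corner where
  \<open>u(x y)\<close> acts as the identity.\<close>

definition unital :: "'m \<Rightarrow> bool" where
  "unital \<sigma> \<longleftrightarrow> \<sigma> \<in> Arr C \<and> Dom C \<sigma> = obj H \<odot> obj H \<and> Cod C \<sigma> = obj A \<and>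
    \<mu>\<^bsub>A\<^esub> \<cdot> pair HH.\<Delta> (u \<cdot> \<mu>\<^bsub>H\<^esub>) \<sigma> = \<sigma> \<and> \<mu>\<^bsub>A\<^esub> \<cdot> pair HH.\<Delta> \<sigma> (u \<cdot> \<mu>\<^bsub>H\<^esub>) = \<sigma>"

lemma unital_arr:
  assumes "unital \<sigma>"
  shows "\<sigma> \<in> Arr C" "Dom C \<sigma> = obj H \<odot> obj H" "Cod C \<sigma> = obj A"
  using assms by (auto simp: unital_def)

end

context action_context
begin

lemma unital_elem:
  assumes "unital \<sigma>" "element x" "element y"
  shows "mulD (u \<cdot> mulH x y) (\<sigma> \<cdot> pair d x y) = \<sigma> \<cdot> pair d x y"
    "mulD (\<sigma> \<cdot> pair d x y) (u \<cdot> mulH x y) = \<sigma> \<cdot> pair d x y"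
proof -
  note [simp] = unital_arr[OF assms(1)] element_arr[OF assms(2)] element_arr[OF assms(3)]
  have *: "\<mu>\<^bsub>A\<^esub> \<cdot> pair d (p \<cdot> pair d x y) (q \<cdot> pair d x y) = (\<mu>\<^bsub>A\<^esub> \<cdot> pair HH.\<Delta> p q) \<cdot> pair d x y"
    if [simp]: "p \<in> Arr C" "Dom C p = obj H \<odot> obj H" "Cod C p = obj A"
      "q \<in> Arr C" "Dom C q = obj H \<odot> obj H" "Cod C q = obj A" for p q
  proof -
    have "pair HH.\<Delta> p q \<cdot> pair d x y = pair d (p \<cdot> pair d x y) (q \<cdot> pair d x y)"
      using comul_pair[OF assms(2,3)]
      by (intro HH.prod.self.pair_comp) (simp_all flip: pair_def)
    then show ?thesis by (simp add: assoc)
  qed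
  have u: "(u \<cdot> \<mu>\<^bsub>H\<^esub>) \<cdot> pair d x y = u \<cdot> mulH x y" by (simp add: assoc)
  have unit: "\<mu>\<^bsub>A\<^esub> \<cdot> pair HH.\<Delta> (u \<cdot> \<mu>\<^bsub>H\<^esub>) \<sigma> = \<sigma>" "\<mu>\<^bsub>A\<^esub> \<cdot> pair HH.\<Delta> \<sigma> (u \<cdot> \<mu>\<^bsub>H\<^esub>) = \<sigma>"
    using assms(1) by (simp_all add: unital_def)
  have "mulD ((u \<cdot> \<mu>\<^bsub>H\<^esub>) \<cdot> pair d x y) (\<sigma> \<cdot> pair d x y) = (\<mu>\<^bsub>A\<^esub> \<cdot> pair HH.\<Delta> (u \<cdot> \<mu>\<^bsub>H\<^esub>) \<sigma>) \<cdot> pair d x y"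
    by (rule *) simp_all
  then show "mulD (u \<cdot> mulH x y) (\<sigma> \<cdot> pair d x y) = \<sigma> \<cdot> pair d x y"
    by (simp only: u unit)
  have "mulD (\<sigma> \<cdot> pair d x y) ((u \<cdot> \<mu>\<^bsub>H\<^esub>) \<cdot> pair d x y) = (\<mu>\<^bsub>A\<^esub> \<cdot> pair HH.\<Delta> \<sigma> (u \<cdot> \<mu>\<^bsub>H\<^esub>)) \<cdot> pair d x y"
    by (rule *) simp_all
  then show "mulD (\<sigma> \<cdot> pair d x y) (u \<cdot> mulH x y) = \<sigma> \<cdot> pair d x y"
    by (simp only: u unit)
qed

text \<open>The action distributes over \<open>m u(y)\<close>, and \<open>x.u(y) = u(x y)\<close> is
  absorbed by \<open>\<sigma>\<close> from the left.\<close>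

lemma actn_rmul_u:
  assumes "unital \<sigma>" "element x" "element y" "vec m"
  shows "rmul (actn x (rmul m (u \<cdot> y))) (\<sigma> \<cdot> pair d x y) = rmul (actn x m) (\<sigma> \<cdot> pair d x y)"
proof -
  note [simp] = unital_arr[OF assms(1)] element_arr[OF assms(2)] element_arr[OF assms(3)]
    assms(4)[unfolded vec_def]
  have "actn x (rmul m (u \<cdot> y)) = rmul (actn x m) (u \<cdot> mulH x y)"
    by (subst actn_rmul) (simp_all add: assms scal_def actD_u)
  then have "rmul (actn x (rmul m (u \<cdot> y))) (\<sigma> \<cdot> pair d x y)
      = rmul (actn x m) (mulD (u \<cdot> mulH x y) (\<sigma> \<cdot> pair d x y))"
    by (simp only:) (rule rmul_rmul; simp add: scal_def vec_def)
  then show ?thesis using assms by (simp add: unital_elem)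
qed

text \<open>Inserting the idempotent in both arguments changes nothing: \<open>u(x)\<close>
  disappears into \<open>x.m\<close> and \<open>u(y)\<close> into \<open>\<sigma>\<close>.\<close>

lemma twisted_core_u:
  assumes "unital \<sigma>" "element x" "element y" "vec m"
  shows "twisted_core u u \<sigma> \<cdot> pair r x (rpair r m y)
    = rpair r (rmul (actn x m) (\<sigma> \<cdot> pair d x y)) (mulH x y)"
proof -
  note [simp] = unital_arr[OF assms(1)] element_arr[OF assms(2)] element_arr[OF assms(3)]
    assms(4)[unfolded vec_def]
  have "lmul (u \<cdot> x) (rmul (actn x m) (\<sigma> \<cdot> pair d x y)) = rmul (lmul (u \<cdot> x) (actn x m)) (\<sigma> \<cdot> pair d x y)"
    by (rule rmul_lmul[symmetric]) (simp_all add: scal_def vec_def)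
  then show ?thesis using assms by (simp add: twisted_core_elem actn_rmul_u lmul_u)
qed

text \<open>The last factor still contains \<open>z\<close>, so
  \<open>f(z_1) \<epsilon>(z_2) = f(z)\<close> removes the \<open>H\<close>-leg. Without such a
  factor a scalar \<open>\<epsilon>(z)\<close> would remain.\<close>

lemma strip_element:
  assumes "element z" "vec k" and [simp]: "f \<in> Arr C" "Dom C f = obj H" "Cod C f = obj A"
  shows "(ident C (obj A) \<otimes> \<epsilon>\<^bsub>H\<^esub>) \<cdot> rpair r (rmul k (f \<cdot> z)) z = rmul k (f \<cdot> z)"
proof -
  note [simp] = element_arr[OF assms(1)] assms(2)[unfolded vec_def]
  have "(ident C (obj A) \<otimes> \<epsilon>\<^bsub>H\<^esub>) \<cdot> rpair r (rmul k (f \<cdot> z)) z = rpair r (rmul k (f \<cdot> z)) (\<epsilon>\<^bsub>H\<^esub> \<cdot> z)"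
    by (simp add: tensor_rpair)
  also have "\<dots> = \<mu>\<^bsub>A\<^esub> \<cdot> rpair r (rpair r k (f \<cdot> z)) (\<epsilon>\<^bsub>H\<^esub> \<cdot> z)"
    using tensor_rpair[of "\<epsilon>\<^bsub>H\<^esub> \<cdot> z" "rpair r k (f \<cdot> z)" "\<mu>\<^bsub>A\<^esub>" "ident C \<K>"] by simp
  also have "\<dots> = \<mu>\<^bsub>A\<^esub> \<cdot> rpair r k (pair d (f \<cdot> z) (\<epsilon>\<^bsub>H\<^esub> \<cdot> z))"
    by (simp add: rpair_rpair)
  also have "pair d (f \<cdot> z) (\<epsilon>\<^bsub>H\<^esub> \<cdot> z) = f \<cdot> z"
    using pair_scalar_swap[of "\<epsilon>\<^bsub>H\<^esub> \<cdot> z" "f \<cdot> z"] counit_element[OF assms(1), of f] by simp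
  finally show ?thesis .
qed

text \<open>The two sides of the multiplicativity identity, evaluated at \<open>x\<close>, \<open>m\<close> and \<open>y\<close>.\<close>

definition source_mult :: "'m \<Rightarrow> 'm \<Rightarrow> 'm \<Rightarrow> 'm \<Rightarrow> 'm \<Rightarrow> 'm" where
  "source_mult f \<sigma> x y m = rmul (rmul (actn x m) (\<sigma> \<cdot> pair d x y)) (f \<cdot> mulH x y)"

definition target_mult :: "'m \<Rightarrow> 'm \<Rightarrow> 'm \<Rightarrow> 'm \<Rightarrow> 'm \<Rightarrow> 'm \<Rightarrow> 'm" where
  "target_mult f g \<sigma> x y m = lmul (f \<cdot> x) (rmul (actn x (rmul m (g \<cdot> y))) (\<sigma> \<cdot> pair d x y))"

lemma source_mult_elem:
  assumes "unital \<sigma>" "element x" "element y" "vec m"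
    and [simp]: "f \<in> Arr C" "Dom C f = obj H" "Cod C f = obj A"
  shows "(tm f \<cdot> twisted_core u u \<sigma>) \<cdot> pair r x (rpair r m y) = rpair r (source_mult f \<sigma> x y m) (mulH x y)"
    "(ident C (obj A) \<otimes> \<epsilon>\<^bsub>H\<^esub>) \<cdot> rpair r (source_mult f \<sigma> x y m) (mulH x y) = source_mult f \<sigma> x y m"
proof -
  note [simp] = unital_arr[OF assms(1)] element_arr[OF assms(2)] element_arr[OF assms(3)]
    assms(4)[unfolded vec_def]
  have xy: "element (mulH x y)" using assms(2,3) by (rule element_mulH)
  have v: "vec (rmul (actn x m) (\<sigma> \<cdot> pair d x y))" by (simp add: vec_def)
  have "(tm f \<cdot> twisted_core u u \<sigma>) \<cdot> pair r x (rpair r m y)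
      = tm f \<cdot> (twisted_core u u \<sigma> \<cdot> pair r x (rpair r m y))"
    by (simp add: assoc)
  then show "(tm f \<cdot> twisted_core u u \<sigma>) \<cdot> pair r x (rpair r m y) = rpair r (source_mult f \<sigma> x y m) (mulH x y)"
    unfolding source_mult_def by (simp only: twisted_core_u[OF assms(1-4)] tm_elem[OF xy v assms(5-7)])
  show "(ident C (obj A) \<otimes> \<epsilon>\<^bsub>H\<^esub>) \<cdot> rpair r (source_mult f \<sigma> x y m) (mulH x y) = source_mult f \<sigma> x y m"
    unfolding source_mult_def by (rule strip_element[OF xy v assms(5-7)])
qed

text \<open>\<open>tm u\<close> appends the factor \<open>u(x y)\<close>, which
  \<open>\<sigma>\<close> absorbs; written with this factor the value has the form required by
  \<open>strip_element\<close>.\<close>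

lemma target_mult_elem:
  assumes "unital \<sigma>" "element x" "element y" "vec m"
    and [simp]: "f \<in> Arr C" "Dom C f = obj H" "Cod C f = obj A" "g \<in> Arr C" "Dom C g = obj H" "Cod C g = obj A"
  shows "(tm u \<cdot> twisted_core f g \<sigma>) \<cdot> pair r x (rpair r m y) = rpair r (target_mult f g \<sigma> x y m) (mulH x y)"
    "(ident C (obj A) \<otimes> \<epsilon>\<^bsub>H\<^esub>) \<cdot> rpair r (target_mult f g \<sigma> x y m) (mulH x y) = target_mult f g \<sigma> x y m"
proof -
  note [simp] = unital_arr[OF assms(1)] element_arr[OF assms(2)] element_arr[OF assms(3)]
    assms(4)[unfolded vec_def]
  have xy: "element (mulH x y)" using assms(2,3) by (rule element_mulH)
  note [simp] = element_arr[OF xy]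
  define n where "n = actn x (rmul m (g \<cdot> y))"
  have n: "vec n" by (simp add: n_def vec_def)
  note [simp] = n[unfolded vec_def]
  define b where "b = \<sigma> \<cdot> pair d x y"
  have b: "scal b" by (simp add: b_def scal_def)
  note [simp] = b[unfolded scal_def]
  have v: "vec (target_mult f g \<sigma> x y m)" by (simp add: vec_def target_mult_def)
  have "rmul (target_mult f g \<sigma> x y m) (u \<cdot> mulH x y) = lmul (f \<cdot> x) (rmul (rmul n b) (u \<cdot> mulH x y))"
    unfolding target_mult_def n_def[symmetric] b_def[symmetric]
    by (rule rmul_lmul) (simp_all add: scal_def vec_def)
  also have "rmul (rmul n b) (u \<cdot> mulH x y) = rmul n (mulD b (u \<cdot> mulH x y))"
    by (rule rmul_rmul) (simp_all add: b n scal_def)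
  also have "mulD b (u \<cdot> mulH x y) = b"
    using unital_elem(2)[OF assms(1-3)] by (simp add: b_def)
  finally have eq: "rmul (target_mult f g \<sigma> x y m) (u \<cdot> mulH x y) = target_mult f g \<sigma> x y m"
    by (simp add: target_mult_def n_def b_def)
  have "(tm u \<cdot> twisted_core f g \<sigma>) \<cdot> pair r x (rpair r m y)
      = tm u \<cdot> (twisted_core f g \<sigma> \<cdot> pair r x (rpair r m y))"
    by (simp add: assoc)
  also have "\<dots> = tm u \<cdot> rpair r (target_mult f g \<sigma> x y m) (mulH x y)"
    unfolding target_mult_def by (subst twisted_core_elem) (simp_all add: assms(2-4))
  also have "\<dots> = rpair r (target_mult f g \<sigma> x y m) (mulH x y)"
    by (simp add: tm_elem[OF xy v] eq)
  finally show "(tm u \<cdot> twisted_core f g \<sigma>) \<cdot> pair r x (rpair r m y) = rpair r (target_mult f g \<sigma> x y m) (mulH x y)" .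
  show "(ident C (obj A) \<otimes> \<epsilon>\<^bsub>H\<^esub>) \<cdot> rpair r (target_mult f g \<sigma> x y m) (mulH x y) = target_mult f g \<sigma> x y m"
    using strip_element[OF xy v, of u] by (simp add: eq)
qed

end

section \<open>The generic argument \<open>(x, b, y)\<close>\<close>

context weak_action
begin

text \<open>Both \<open>H\<close>-variables stand before \<open>A\<close>, so that the coaction
  \<open>\<rho>\<close> is \<open>HH.\<Delta>\<close> beside an inert factor; the order
  \<open>H\<close>, \<open>A\<close>, \<open>H\<close> of the crossed product is restored by a
  braiding in \<open>generic_argument\<close>.\<close>

abbreviation HHA :: 'o where "HHA \<equiv> obj H \<odot> (obj H \<odot> obj A)"
abbreviation \<rho> :: 'm where "\<rho> \<equiv> HH.\<Delta> \<otimes> ident C (obj A)"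
abbreviation m\<^sub>2 :: 'm where "m\<^sub>2 \<equiv> (\<epsilon>\<^bsub>H\<^esub> \<otimes> \<epsilon>\<^bsub>H\<^esub>) \<otimes> ident C (obj A)"

lemma action_context_HHA:
  "action_context C H A (obj H \<odot> obj H) HH.\<Delta> (\<epsilon>\<^bsub>H\<^esub> \<otimes> \<epsilon>\<^bsub>H\<^esub>) HHA \<rho>"
proof -
  have "comodule C (obj H \<odot> obj H) HH.\<Delta> (\<epsilon>\<^bsub>H\<^esub> \<otimes> \<epsilon>\<^bsub>H\<^esub>) (obj H \<odot> obj H \<odot> obj A) \<rho>"
    by (rule comodule_tensor) (simp_all add: HH.prod.self.comodule_axioms)
  then interpret comodule C "obj H \<odot> obj H" HH.\<Delta> "\<epsilon>\<^bsub>H\<^esub> \<otimes> \<epsilon>\<^bsub>H\<^esub>" HHA \<rho>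
    by simp
  show ?thesis by unfold_locales
qed

lemma action_context_HA:
  "action_context C H A (obj H) \<delta>\<^bsub>H\<^esub> \<epsilon>\<^bsub>H\<^esub> (obj H \<odot> obj A) (\<delta>\<^bsub>H\<^esub> \<otimes> ident C (obj A))"
proof -
  interpret comodule C "obj H" "\<delta>\<^bsub>H\<^esub>" "\<epsilon>\<^bsub>H\<^esub>" "obj H \<odot> obj A" "\<delta>\<^bsub>H\<^esub> \<otimes> ident C (obj A)"
    by (rule comodule_tensor) (simp_all add: H.self.comodule_axioms)
  show ?thesis by unfold_locales
qed

end

context cocommutative_coalgebra
begin

lemma pair_cofree:
  assumes [simp]: "Y \<in> Ob C" "p \<in> Arr C" "Dom C p = D"
  shows "pair (d \<otimes> ident C Y) p (e \<otimes> ident C Y) = p \<otimes> ident C Y"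
proof -
  have "(p \<otimes> e) \<cdot> d = p"
    using rpair_self[of p e] by (simp add: pair_def)
  then show ?thesis by (simp add: pair_def interchange flip: tensor_assoc)
qed

end

context weak_action
begin

text \<open>The generic triple \<open>(x, b, y)\<close> is invertible, so an arrow out of \<open>H \<otimes> A \<otimes> H\<close> is determined by its
  value there.\<close>

lemma generic_argument:
  "pair \<rho> HH.\<pi>\<^sub>1 (rpair \<rho> m\<^sub>2 HH.\<pi>\<^sub>2) = ident C (obj H) \<otimes> braid C (obj H) (obj A)"
proof -
  interpret Q: action_context C H A "obj H \<odot> obj H" HH.\<Delta> "\<epsilon>\<^bsub>H\<^esub> \<otimes> \<epsilon>\<^bsub>H\<^esub>" HHA \<rho>
    by (rule action_context_HHA)
  have "pair \<rho> HH.\<pi>\<^sub>1 (rpair \<rho> m\<^sub>2 HH.\<pi>\<^sub>2)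
      = (ident C (obj H) \<otimes> braid C (obj H) (obj A)) \<cdot> pair \<rho> HH.\<pi>\<^sub>1 (pair \<rho> HH.\<pi>\<^sub>2 m\<^sub>2)"
    by (simp add: Q.tensor_pair rpair_def)
  also have "pair \<rho> HH.\<pi>\<^sub>1 (pair \<rho> HH.\<pi>\<^sub>2 m\<^sub>2) = pair \<rho> (pair HH.\<Delta> HH.\<pi>\<^sub>1 HH.\<pi>\<^sub>2) m\<^sub>2"
    by (rule Q.pair_assoc[symmetric]) simp_all
  also have "\<dots> = ident C HHA"
    by (simp add: HH.pair_projections HH.prod.pair_cofree)
  finally show ?thesis by simp
qed

end

section \<open>The commutation and coboundary conditions\<close>

context weak_action
begin

definition commuting :: "'m \<Rightarrow> bool" where
  "commuting f \<longleftrightarrow> \<mu>\<^bsub>A\<^esub> \<cdot> (ident C (obj A) \<otimes> f) \<cdot> psi C H A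
    = \<mu>\<^bsub>A\<^esub> \<cdot> (f \<otimes> \<phi>\<^bsub>A\<^esub>) \<cdot> (\<delta>\<^bsub>H\<^esub> \<otimes> ident C (obj A))"

text \<open>This is the coboundary condition with \<open>f(x Pi_L(y))\<close> replaced by \<open>f(x)\<close>; the factor \<open>\<epsilon>(x y)\<close> by which
  the two differ is absorbed by \<open>\<beta>\<close>.\<close>

definition cohomologous :: "'m \<Rightarrow> 'm \<Rightarrow> 'm \<Rightarrow> bool" where
  "cohomologous f \<alpha> \<beta> \<longleftrightarrow> \<mu>\<^bsub>A\<^esub> \<cdot> pair HH.\<Delta> \<alpha> (f \<cdot> \<mu>\<^bsub>H\<^esub>) = \<mu>\<^bsub>A\<^esub> \<cdot> pair HH.\<Delta>
    (\<mu>\<^bsub>A\<^esub> \<cdot> pair HH.\<Delta> (\<phi>\<^bsub>A\<^esub> \<cdot> (ident C (obj H) \<otimes> f)) (f \<cdot> HH.\<pi>\<^sub>1)) \<beta>"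

end

context action_context
begin

lemma commuting_elem:
  assumes "commuting f" "element x" "vec m" and [simp]: "f \<in> Arr C" "Dom C f = obj H" "Cod C f = obj A"
  shows "rmul (actn x m) (f \<cdot> x) = lmul (f \<cdot> x) (actn x m)"
proof -
  note [simp] = element_arr[OF assms(2)] assms(3)[unfolded vec_def]
  have "rmul (actn x m) (f \<cdot> x) = \<mu>\<^bsub>A\<^esub> \<cdot> ((ident C (obj A) \<otimes> f) \<cdot> rpair r (actn x m) x)"
    by (simp add: tensor_rpair)
  also have "\<dots> = (\<mu>\<^bsub>A\<^esub> \<cdot> (ident C (obj A) \<otimes> f) \<cdot> psi C H A) \<cdot> pair r x m"
    by (simp add: assoc psi_elem[OF assms(2,3)])
  also have "\<dots> = \<mu>\<^bsub>A\<^esub> \<cdot> ((f \<otimes> \<phi>\<^bsub>A\<^esub>) \<cdot> ((\<delta>\<^bsub>H\<^esub> \<otimes> ident C (obj A)) \<cdot> pair r x m))"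
    using assms(1) unfolding commuting_def by (simp add: assoc)
  also have "(\<delta>\<^bsub>H\<^esub> \<otimes> ident C (obj A)) \<cdot> pair r x m = pair r x (pair r x m)"
    by (simp add: tensor_pair pair_assoc)
  finally show ?thesis by (simp add: tensor_pair)
qed

end

context action_context
begin

text \<open>The hypothesis turns \<open>\<alpha>(x, y) f(x y)\<close> into
  \<open>f(x) (x.f(y)) \<beta>(x, y)\<close>, commutation brings \<open>f(x)\<close> in front of
  \<open>x.b\<close>, and the action reassembles \<open>x.b\<close> and \<open>x.f(y)\<close> into
  \<open>x.(b f(y))\<close>.\<close>

lemma source_mult_eq_target_mult:
  assumes "commuting f" "element x" "element y" "vec m"
    and [simp]: "f \<in> Arr C" "Dom C f = obj H" "Cod C f = obj A"
    and [simp]: "\<alpha> \<in> Arr C" "Dom C \<alpha> = obj H \<odot> obj H" "Cod C \<alpha> = obj A"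
    and [simp]: "\<beta> \<in> Arr C" "Dom C \<beta> = obj H \<odot> obj H" "Cod C \<beta> = obj A"
    and eq: "mulD (\<alpha> \<cdot> pair d x y) (f \<cdot> mulH x y)
      = mulD (mulD (actD x (f \<cdot> y)) (f \<cdot> x)) (\<beta> \<cdot> pair d x y)"
  shows "source_mult f \<alpha> x y m = target_mult f f \<beta> x y m"
proof -
  note [simp] = element_arr[OF assms(2)] element_arr[OF assms(3)] assms(4)[unfolded vec_def]
  define n p q where "n = actn x m" and "p = actD x (f \<cdot> y)" and "q = f \<cdot> x"
  define a b c where "a = \<alpha> \<cdot> pair d x y" and "b = \<beta> \<cdot> pair d x y" and "c = f \<cdot> mulH x y"
  have s: "scal p" "scal q" "scal a" "scal b" "scal c" "vec n"
    by (simp_all add: scal_def vec_def n_def p_def q_def a_def b_def c_def)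
  have s': "scal (mulD k l)" if "scal k" "scal l" for k l
    using that by (simp add: scal_def)
  have v': "vec (rmul k l)" "vec (lmul l k)" if "vec k" "scal l" for k l
    using that by (simp_all add: scal_def vec_def)
  \<comment> \<open>The commutation condition with \<open>f(y)\<close> in place of the free
    argument, read over \<open>D\<close> itself, where \<open>rpair\<close> and \<open>pair\<close>
    agree.\<close>
  have qp: "mulD q p = mulD p q"
  proof -
    have "rpair d p q = pair d p q" using s by (simp add: scal_def rpair_self)
    moreover have "base.vec (f \<cdot> y)" by (simp add: base.vec_def)
    ultimately show ?thesis
      using base.commuting_elem[OF assms(1,2), of "f \<cdot> y"] by (simp add: p_def q_def)
  qed
  have "source_mult f \<alpha> x y m = rmul n (mulD a c)"
    unfolding source_mult_def n_def[symmetric] a_def[symmetric] c_def[symmetric]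
    by (rule rmul_rmul) (simp_all add: s)
  also have "mulD a c = mulD (mulD q p) b"
    using eq unfolding qp by (simp add: a_def b_def c_def p_def q_def)
  also have "rmul n \<dots> = rmul (rmul (rmul n q) p) b"
    by (simp add: rmul_rmul s s' v')
  also have "rmul n q = lmul q n"
    unfolding n_def q_def using assms(1,2,4) by (simp add: commuting_elem)
  also have "rmul (rmul (lmul q n) p) b = lmul q (rmul (rmul n p) b)"
    by (simp add: rmul_lmul s s' v')
  also have "rmul n p = actn x (rmul m (f \<cdot> y))"
    unfolding n_def p_def using assms(2,4) by (simp add: actn_rmul scal_def)
  finally show ?thesis by (simp add: target_mult_def q_def b_def)
qed

end

section \<open>Specialisation at \<open>y = 1\<close> and absorption of scalars\<close>

context weak_action
begin

lemma elements_HH: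
  "action_context.element C H (obj H \<odot> obj H) HH.\<Delta> HH.\<pi>\<^sub>1"
  "action_context.element C H (obj H \<odot> obj H) HH.\<Delta> HH.\<pi>\<^sub>2"
proof -
  interpret Q: action_context C H A "obj H \<odot> obj H" HH.\<Delta> "\<epsilon>\<^bsub>H\<^esub> \<otimes> \<epsilon>\<^bsub>H\<^esub>" HHA \<rho>
    by (rule action_context_HHA)
  show "Q.element HH.\<pi>\<^sub>1" "Q.element HH.\<pi>\<^sub>2"
    by (simp_all add: Q.element_def HH.comul_projections)
qed

lemma mult_projections: "\<mu>\<^bsub>H\<^esub> \<cdot> pair HH.\<Delta> HH.\<pi>\<^sub>1 HH.\<pi>\<^sub>2 = \<mu>\<^bsub>H\<^esub>"
  by (simp add: HH.pair_projections)

text \<open>Setting a variable equal to \<open>1\<close> leads out of the calculus, since \<open>\<eta>\<close> is not comultiplicative; it is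
  harmless when the other factor does not involve that variable.\<close>

lemma pair_first_unit:
  assumes [simp]: "\<sigma> \<in> Arr C" "Dom C \<sigma> = obj H \<odot> obj H"
  shows "pair HH.\<Delta> \<sigma> HH.\<pi>\<^sub>1 \<cdot> (ident C (obj H) \<otimes> \<eta>\<^bsub>H\<^esub>)
    = pair \<delta>\<^bsub>H\<^esub> (\<sigma> \<cdot> (ident C (obj H) \<otimes> \<eta>\<^bsub>H\<^esub>)) (ident C (obj H))"
proof -
  let ?iH = "ident C (obj H)" and ?c = "braid C (obj H) (Cod C \<sigma>)"
  have "(\<delta>\<^bsub>H\<^esub> \<otimes> ?iH) \<cdot> (?iH \<otimes> \<eta>\<^bsub>H\<^esub>) = (?iH \<otimes> (?iH \<otimes> \<eta>\<^bsub>H\<^esub>)) \<cdot> \<delta>\<^bsub>H\<^esub>"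
    using interchange[of "\<delta>\<^bsub>H\<^esub>" "ident C (obj H \<odot> obj H)" "ident C \<K>" "\<eta>\<^bsub>H\<^esub>"]
    by (simp add: interchange)
  then have "pair HH.\<Delta> HH.\<pi>\<^sub>1 \<sigma> \<cdot> (?iH \<otimes> \<eta>\<^bsub>H\<^esub>) = (?iH \<otimes> \<sigma>) \<cdot> ((?iH \<otimes> (?iH \<otimes> \<eta>\<^bsub>H\<^esub>)) \<cdot> \<delta>\<^bsub>H\<^esub>)"
    using HH.pair_comul_left[of ?iH \<sigma>] by (simp add: assoc)
  also have "\<dots> = pair \<delta>\<^bsub>H\<^esub> ?iH (\<sigma> \<cdot> (?iH \<otimes> \<eta>\<^bsub>H\<^esub>))"
    by (simp add: pair_def interchange_tail del: tensor_ident_ident)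
  finally have "?c \<cdot> (pair HH.\<Delta> HH.\<pi>\<^sub>1 \<sigma> \<cdot> (?iH \<otimes> \<eta>\<^bsub>H\<^esub>))
      = ?c \<cdot> pair \<delta>\<^bsub>H\<^esub> ?iH (\<sigma> \<cdot> (?iH \<otimes> \<eta>\<^bsub>H\<^esub>))" by simp
  moreover have "?c \<cdot> pair HH.\<Delta> HH.\<pi>\<^sub>1 \<sigma> = pair HH.\<Delta> \<sigma> HH.\<pi>\<^sub>1"
    using HH.prod.pair_swap[of HH.\<pi>\<^sub>1 \<sigma>] by simp
  moreover have "?c \<cdot> pair \<delta>\<^bsub>H\<^esub> ?iH (\<sigma> \<cdot> (?iH \<otimes> \<eta>\<^bsub>H\<^esub>)) = pair \<delta>\<^bsub>H\<^esub> (\<sigma> \<cdot> (?iH \<otimes> \<eta>\<^bsub>H\<^esub>)) ?iH"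
    using H.pair_swap[of ?iH "\<sigma> \<cdot> (?iH \<otimes> \<eta>\<^bsub>H\<^esub>)"] by simp
  ultimately show ?thesis by (simp flip: assoc)
qed

text \<open>Here the factor free of \<open>y\<close> also carries the argument in \<open>A\<close>;
  precomposition with \<open>HH.\<pi>\<^sub>1\<close> expresses that \<open>y\<close> does not occur
  in it.\<close>

lemma rpair_first_unit:
  assumes [simp]: "\<sigma> \<in> Arr C" "Dom C \<sigma> = obj H \<odot> obj H"
    "n \<in> Arr C" "Dom C n = obj H \<odot> obj A"
  shows "rpair \<rho> (n \<cdot> (HH.\<pi>\<^sub>1 \<otimes> ident C (obj A))) \<sigma> \<cdot> (ident C (obj H) \<otimes> (\<eta>\<^bsub>H\<^esub> \<otimes> ident C (obj A)))
    = rpair (\<delta>\<^bsub>H\<^esub> \<otimes> ident C (obj A)) n (\<sigma> \<cdot> (ident C (obj H) \<otimes> \<eta>\<^bsub>H\<^esub>))"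
proof -
  let ?iH = "ident C (obj H)" and ?iA = "ident C (obj A)" and ?k = "ident C (obj H) \<otimes> (\<eta>\<^bsub>H\<^esub> \<otimes> ident C (obj A))"
  let ?n = "n \<cdot> (HH.\<pi>\<^sub>1 \<otimes> ?iA)" and ?s = "\<sigma> \<cdot> (?iH \<otimes> \<eta>\<^bsub>H\<^esub>)"
  have k: "?k = (?iH \<otimes> \<eta>\<^bsub>H\<^esub>) \<otimes> ?iA" by (simp add: tensor_assoc)
  have "\<sigma> \<otimes> ?n = (ident C (Cod C \<sigma>) \<otimes> n) \<cdot> ((\<sigma> \<otimes> HH.\<pi>\<^sub>1) \<otimes> ?iA)"
    by (simp add: tensor_assoc interchange)
  then have "pair \<rho> \<sigma> ?n \<cdot> ?k
      = ((ident C (Cod C \<sigma>) \<otimes> n) \<cdot> ((\<sigma> \<otimes> HH.\<pi>\<^sub>1) \<otimes> ?iA)) \<cdot> \<rho> \<cdot> ?k"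
    by (simp only: pair_def)
  also have "\<dots> = (ident C (Cod C \<sigma>) \<otimes> n) \<cdot> (((\<sigma> \<otimes> HH.\<pi>\<^sub>1) \<otimes> ?iA) \<cdot> (\<rho> \<cdot> ?k))"
    by (simp add: assoc)
  also have "((\<sigma> \<otimes> HH.\<pi>\<^sub>1) \<otimes> ?iA) \<cdot> (\<rho> \<cdot> ?k) = (pair HH.\<Delta> \<sigma> HH.\<pi>\<^sub>1 \<cdot> (?iH \<otimes> \<eta>\<^bsub>H\<^esub>)) \<otimes> ?iA"
    unfolding k by (simp add: interchange pair_def assoc)
  also have "\<dots> = ((?s \<otimes> ?iH) \<otimes> ?iA) \<cdot> (\<delta>\<^bsub>H\<^esub> \<otimes> ?iA)"
    unfolding pair_first_unit[OF assms(1,2)] by (simp add: interchange pair_def)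
  also have "(ident C (Cod C \<sigma>) \<otimes> n) \<cdot> \<dots> = pair (\<delta>\<^bsub>H\<^esub> \<otimes> ?iA) ?s n"
    by (simp add: pair_def tensor_assoc interchange_tail)
  finally have eq: "pair \<rho> \<sigma> ?n \<cdot> ?k = pair (\<delta>\<^bsub>H\<^esub> \<otimes> ?iA) ?s n" .
  interpret Q: action_context C H A "obj H \<odot> obj H" HH.\<Delta> "\<epsilon>\<^bsub>H\<^esub> \<otimes> \<epsilon>\<^bsub>H\<^esub>" HHA \<rho>
    by (rule action_context_HHA)
  show ?thesis by (simp add: rpair_def assoc flip: eq)
qed

text \<open>Since \<open>x y\<close> is comultiplicative,
  \<open>\<epsilon>(x y) u(x y) = u(x y)\<close>; now insert
  \<open>\<sigma> = u(x y) \<sigma>\<close>.\<close>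

lemma scalar_absorb:
  assumes "unital \<sigma>"
  shows "pair HH.\<Delta> s \<sigma> = \<sigma>"
proof -
  note [simp] = unital_arr[OF assms]
  interpret Q: action_context C H A "obj H \<odot> obj H" HH.\<Delta> "\<epsilon>\<^bsub>H\<^esub> \<otimes> \<epsilon>\<^bsub>H\<^esub>" HHA \<rho>
    by (rule action_context_HHA)
  have "Q.element \<mu>\<^bsub>H\<^esub>"
    using Q.element_mulH[OF elements_HH] by (simp add: mult_projections)
  then have "pair HH.\<Delta> s (u \<cdot> \<mu>\<^bsub>H\<^esub>) = u \<cdot> \<mu>\<^bsub>H\<^esub>"
    by (rule Q.counit_element) simp_all
  moreover have "\<mu>\<^bsub>A\<^esub> \<cdot> pair HH.\<Delta> (pair HH.\<Delta> s (u \<cdot> \<mu>\<^bsub>H\<^esub>)) \<sigma> = pair HH.\<Delta> s (\<mu>\<^bsub>A\<^esub> \<cdot> pair HH.\<Delta> (u \<cdot> \<mu>\<^bsub>H\<^esub>) \<sigma>)"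
    by (simp add: HH.prod.self.pair_assoc HH.prod.self.comp_pair_scalar)
  ultimately show ?thesis using assms by (simp add: unital_def)
qed

lemma d12_eq:
  assumes [simp]: "f \<in> Arr C" "Dom C f = obj H"
  shows "d12 C H f = pair HH.\<Delta> s (f \<cdot> HH.\<pi>\<^sub>1)"
proof -
  have "d12 C H f = f \<cdot> pair HH.\<Delta> s HH.\<pi>\<^sub>1"
    by (simp add: d12_def assoc flip: mult_Pi_L)
  then show ?thesis by (simp add: HH.prod.self.comp_pair_scalar)
qed

lemma cohomologous_iff:
  assumes "unital \<alpha>" "unital \<beta>" and [simp]: "f \<in> Arr C" "Dom C f = obj H" "Cod C f = obj A"
  shows "conv C (comul2 C H) A \<alpha> (d11 C H f)
        = conv C (comul2 C H) A (conv C (comul2 C H) A (d10 C H A f) (d12 C H f)) \<beta>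
    \<longleftrightarrow> cohomologous f \<alpha> \<beta>"
proof -
  note [simp] = unital_arr[OF assms(1)] unital_arr[OF assms(2)]
  have conv: "conv C (comul2 C H) A p q = \<mu>\<^bsub>A\<^esub> \<cdot> pair HH.\<Delta> p q"
    if [simp]: "p \<in> Arr C" "Dom C p = obj H \<odot> obj H" "Cod C p = obj A"
      "q \<in> Arr C" "Dom C q = obj H \<odot> obj H" "Cod C q = obj A" for p q
    by (simp add: conv_def comul2_def pair_def assoc)
  define a where "a = \<phi>\<^bsub>A\<^esub> \<cdot> (ident C (obj H) \<otimes> f)"
  have [simp]: "a \<in> Arr C" "Dom C a = obj H \<odot> obj H" "Cod C a = obj A"
    by (simp_all add: a_def)
  define k where "k = \<mu>\<^bsub>A\<^esub> \<cdot> pair HH.\<Delta> a (f \<cdot> HH.\<pi>\<^sub>1)"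
  have [simp]: "k \<in> Arr C" "Dom C k = obj H \<odot> obj H" "Cod C k = obj A"
    by (simp_all add: k_def)
  have "\<mu>\<^bsub>A\<^esub> \<cdot> pair HH.\<Delta> a (pair HH.\<Delta> s (f \<cdot> HH.\<pi>\<^sub>1)) = pair HH.\<Delta> s k"
    unfolding k_def
    by (subst HH.prod.self.pair_scalar_left_commute)
      (simp_all add: HH.prod.self.comp_pair_scalar)
  moreover have "\<mu>\<^bsub>A\<^esub> \<cdot> pair HH.\<Delta> (pair HH.\<Delta> s k) \<beta> = \<mu>\<^bsub>A\<^esub> \<cdot> pair HH.\<Delta> k \<beta>"
  proof -
    have "pair HH.\<Delta> (pair HH.\<Delta> s k) \<beta> = pair HH.\<Delta> k (pair HH.\<Delta> s \<beta>)"
      by (simp add: HH.prod.self.pair_assoc) (rule HH.prod.self.pair_scalar_left_commute[symmetric]; simp)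
    then show ?thesis using scalar_absorb[OF assms(2)] by simp
  qed
  ultimately have "conv C (comul2 C H) A (conv C (comul2 C H) A (d10 C H A f) (d12 C H f)) \<beta>
      = \<mu>\<^bsub>A\<^esub> \<cdot> pair HH.\<Delta> k \<beta>"
    by (simp add: conv d12_eq d10_def flip: a_def)
  moreover have "conv C (comul2 C H) A \<alpha> (d11 C H f) = \<mu>\<^bsub>A\<^esub> \<cdot> pair HH.\<Delta> \<alpha> (f \<cdot> \<mu>\<^bsub>H\<^esub>)"
    by (simp add: conv d11_def)
  ultimately show ?thesis
    by (simp add: cohomologous_def k_def a_def)
qed

text \<open>Replacing \<open>1_2\<close> by \<open>Pi_L(1_2)\<close> beside a coproduct of
  \<open>x\<close> prepares a later factor \<open>x 1_2\<close> for
  \<open>mult_Pi_L\<close>.\<close>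

lemma comul2_unit:
  "(ident C (obj H \<odot> (obj H \<odot> obj H)) \<otimes> Pi_L C H) \<cdot> (HH.\<Delta> \<cdot> (ident C (obj H) \<otimes> \<eta>\<^bsub>H\<^esub>))
    = HH.\<Delta> \<cdot> (ident C (obj H) \<otimes> \<eta>\<^bsub>H\<^esub>)"
proof -
  let ?iH = "ident C (obj H)" and ?d = "\<delta>\<^bsub>H\<^esub> \<cdot> \<eta>\<^bsub>H\<^esub>"
  let ?p = "ident C (obj H \<odot> (obj H \<odot> obj H)) \<otimes> Pi_L C H"
  let ?m = "(?iH \<otimes> braid C (obj H) (obj H)) \<otimes> ?iH"
  have \<Delta>: "HH.\<Delta> \<cdot> (?iH \<otimes> \<eta>\<^bsub>H\<^esub>) = ?m \<cdot> (\<delta>\<^bsub>H\<^esub> \<otimes> ?d)"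
    by (simp add: tensor_comul_def assoc interchange)
  have "?p \<cdot> (?m \<cdot> (\<delta>\<^bsub>H\<^esub> \<otimes> ?d)) = (?p \<cdot> ?m) \<cdot> (\<delta>\<^bsub>H\<^esub> \<otimes> ?d)"
    by (simp add: assoc)
  also have "?p \<cdot> ?m = ?m \<cdot> ?p"
    by (simp add: interchange)
  also have "(?m \<cdot> ?p) \<cdot> (\<delta>\<^bsub>H\<^esub> \<otimes> ?d) = ?m \<cdot> (?p \<cdot> (\<delta>\<^bsub>H\<^esub> \<otimes> ?d))"
    by (simp add: assoc)
  also have "?p \<cdot> (\<delta>\<^bsub>H\<^esub> \<otimes> ?d) = \<delta>\<^bsub>H\<^esub> \<otimes> ((?iH \<otimes> Pi_L C H) \<cdot> ?d)"
  proof -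
    have "?p = ident C (obj H \<odot> obj H) \<otimes> (?iH \<otimes> Pi_L C H)" by simp
    then show ?thesis by (simp add: interchange del: tensor_ident_ident)
  qed
  finally show ?thesis by (simp add: \<Delta> Pi_L_unit')
qed

text \<open>The unit law does not apply to \<open>\<alpha>(x_1, 1_1) f(x_2 1_2)\<close>. Writing
  \<open>1_2\<close> as \<open>Pi_L(1_2)\<close> turns \<open>f(x Pi_L(y))\<close> into
  \<open>\<epsilon>(x_1 y) f(x_2)\<close>; \<open>\<alpha>\<close> absorbs the scalar, and then the
  unit occurs in \<open>\<alpha>\<close> only, leaving \<open>u(x_1) f(x_2) = f(x)\<close>.\<close>

lemma conv_unit:
  assumes "unital \<alpha>" "\<alpha> \<cdot> (ident C (obj H) \<otimes> \<eta>\<^bsub>H\<^esub>) = u"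
    and [simp]: "f \<in> Arr C" "Dom C f = obj H" "Cod C f = obj A"
    and uf: "\<mu>\<^bsub>A\<^esub> \<cdot> pair \<delta>\<^bsub>H\<^esub> u f = f"
  shows "(\<mu>\<^bsub>A\<^esub> \<cdot> pair HH.\<Delta> \<alpha> (f \<cdot> \<mu>\<^bsub>H\<^esub>)) \<cdot> (ident C (obj H) \<otimes> \<eta>\<^bsub>H\<^esub>) = f"
proof -
  note [simp] = unital_arr[OF assms(1)]
  let ?iH = "ident C (obj H)" and ?e = "ident C (obj H) \<otimes> \<eta>\<^bsub>H\<^esub>"
  have "pair HH.\<Delta> \<alpha> (f \<cdot> \<mu>\<^bsub>H\<^esub>) \<cdot> ?e
      = (\<alpha> \<otimes> (f \<cdot> \<mu>\<^bsub>H\<^esub>)) \<cdot> ((ident C (obj H \<odot> (obj H \<odot> obj H)) \<otimes> Pi_L C H) \<cdot> (HH.\<Delta> \<cdot> ?e))"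
    by (simp add: comul2_unit pair_def assoc)
  also have "ident C (obj H \<odot> (obj H \<odot> obj H)) \<otimes> Pi_L C H
      = ident C (obj H \<odot> obj H) \<otimes> (?iH \<otimes> Pi_L C H)" by simp
  also have "(\<alpha> \<otimes> (f \<cdot> \<mu>\<^bsub>H\<^esub>)) \<cdot> ((ident C (obj H \<odot> obj H) \<otimes> (?iH \<otimes> Pi_L C H)) \<cdot> (HH.\<Delta> \<cdot> ?e))
      = pair HH.\<Delta> \<alpha> (f \<cdot> (\<mu>\<^bsub>H\<^esub> \<cdot> (?iH \<otimes> Pi_L C H))) \<cdot> ?e"
    by (simp add: pair_def assoc interchange_tail del: tensor_ident_ident)
  also have "pair HH.\<Delta> \<alpha> (f \<cdot> (\<mu>\<^bsub>H\<^esub> \<cdot> (?iH \<otimes> Pi_L C H))) = pair HH.\<Delta> \<alpha> (f \<cdot> HH.\<pi>\<^sub>1)"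
  proof -
    have "pair HH.\<Delta> \<alpha> (pair HH.\<Delta> s (f \<cdot> HH.\<pi>\<^sub>1)) = pair HH.\<Delta> (pair HH.\<Delta> s \<alpha>) (f \<cdot> HH.\<pi>\<^sub>1)"
      by (simp add: HH.prod.self.pair_assoc) (rule HH.prod.self.pair_scalar_left_commute; simp)
    then show ?thesis
      by (simp add: mult_Pi_L HH.prod.self.comp_pair_scalar scalar_absorb[OF assms(1)])
  qed
  also have "\<dots> \<cdot> ?e = (ident C (obj A) \<otimes> f) \<cdot> (pair HH.\<Delta> \<alpha> HH.\<pi>\<^sub>1 \<cdot> ?e)"
    by (simp add: HH.prod.self.tensor_pair flip: assoc)
  also have "\<dots> = pair \<delta>\<^bsub>H\<^esub> u f"
    by (simp add: pair_first_unit assms(2) H.self.tensor_pair)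
  finally show ?thesis by (simp add: assoc uf)
qed

end

section \<open>Multiplicativity versus the commutation and coboundary conditions\<close>

context weak_action
begin

text \<open>Evaluation at the generic argument loses nothing because that argument is invertible;
  the \<open>H\<close>-leg is \<open>x y\<close> on both sides and is stripped by the
  counit.\<close>

lemma twisted_core_eq_iff:
  assumes "unital \<alpha>" "unital \<beta>" and [simp]: "f \<in> Arr C" "Dom C f = obj H" "Cod C f = obj A"
  shows "tm f \<cdot> twisted_core u u \<alpha> = tm u \<cdot> twisted_core f f \<beta> \<longleftrightarrow>
    action_context.source_mult C H A HH.\<Delta> \<rho> f \<alpha> HH.\<pi>\<^sub>1 HH.\<pi>\<^sub>2 m\<^sub>2
      = action_context.target_mult C A HH.\<Delta> \<rho> f f \<beta> HH.\<pi>\<^sub>1 HH.\<pi>\<^sub>2 m\<^sub>2"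
    (is "?K = ?K' \<longleftrightarrow> _")
proof -
  interpret Q: action_context C H A "obj H \<odot> obj H" HH.\<Delta> "\<epsilon>\<^bsub>H\<^esub> \<otimes> \<epsilon>\<^bsub>H\<^esub>" HHA \<rho>
    by (rule action_context_HHA)
  note [simp] = unital_arr[OF assms(1)] unital_arr[OF assms(2)]
  let ?g = "ident C (obj H) \<otimes> braid C (obj H) (obj A)"
  let ?g' = "ident C (obj H) \<otimes> braid C (obj A) (obj H)"
  let ?l = "Q.source_mult f \<alpha> HH.\<pi>\<^sub>1 HH.\<pi>\<^sub>2 m\<^sub>2" and ?r = "Q.target_mult f f \<beta> HH.\<pi>\<^sub>1 HH.\<pi>\<^sub>2 m\<^sub>2"
  have v: "Q.vec m\<^sub>2" by (simp add: Q.vec_def)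
  have l: "?K \<cdot> ?g = rpair \<rho> ?l \<mu>\<^bsub>H\<^esub>" "(ident C (obj A) \<otimes> \<epsilon>\<^bsub>H\<^esub>) \<cdot> rpair \<rho> ?l \<mu>\<^bsub>H\<^esub> = ?l"
    using Q.source_mult_elem[OF assms(1) elements_HH v, of f]
    unfolding generic_argument mult_projections by simp_all
  have r: "?K' \<cdot> ?g = rpair \<rho> ?r \<mu>\<^bsub>H\<^esub>" "(ident C (obj A) \<otimes> \<epsilon>\<^bsub>H\<^esub>) \<cdot> rpair \<rho> ?r \<mu>\<^bsub>H\<^esub> = ?r"
    using Q.target_mult_elem[OF assms(2) elements_HH v, of f f]
    unfolding generic_argument mult_projections by simp_all
  have cancel: "(k \<cdot> ?g) \<cdot> ?g' = k"
    if "k \<in> Arr C" "Dom C k = obj H \<odot> (obj A \<odot> obj H)" for k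
    using that by (simp add: assoc interchange)
  show ?thesis
  proof
    assume "?K = ?K'"
    then show "?l = ?r" using l r by metis
  next
    assume "?l = ?r"
    then have "?K \<cdot> ?g = ?K' \<cdot> ?g" using l r by metis
    then have "(?K \<cdot> ?g) \<cdot> ?g' = (?K' \<cdot> ?g) \<cdot> ?g'" by simp
    then show "?K = ?K'" by (simp only: cancel comp_arr twisted_core_arr tm_arr assms
      unital_arr[OF assms(1)] unital_arr[OF assms(2)] u_arr)
  qed
qed

text \<open>By left linearity \<open>T_g (b \<otimes> 1) = b T_g (1 \<otimes> 1)\<close>, so at
  \<open>y = 1\<close> the coefficient \<open>g\<close> is seen only through its fibre over
  \<open>1\<close>.\<close>

lemma twisted_core_unit:
  assumes [simp]: "\<sigma> \<in> Arr C" "Dom C \<sigma> = obj H \<odot> obj H" "Cod C \<sigma> = obj A"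
    "f \<in> Arr C" "Dom C f = obj H" "Cod C f = obj A" "g \<in> Arr C" "Dom C g = obj H" "Cod C g = obj A"
    "g' \<in> Arr C" "Dom C g' = obj H" "Cod C g' = obj A"
    and eq: "fibre g \<cdot> \<eta>\<^bsub>H\<^esub> = fibre g' \<cdot> \<eta>\<^bsub>H\<^esub>"
  shows "twisted_core f g \<sigma> \<cdot> (ident C (obj H) \<otimes> (ident C (obj A) \<otimes> \<eta>\<^bsub>H\<^esub>))
    = twisted_core f g' \<sigma> \<cdot> (ident C (obj H) \<otimes> (ident C (obj A) \<otimes> \<eta>\<^bsub>H\<^esub>))"
proof -
  have *: "twisted_core f k \<sigma> \<cdot> (ident C (obj H) \<otimes> (ident C (obj A) \<otimes> \<eta>\<^bsub>H\<^esub>))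
      = lin (wcp_core \<sigma>) \<cdot> (fibre f \<otimes> lin (fibre k \<cdot> \<eta>\<^bsub>H\<^esub>))"
    if [simp]: "k \<in> Arr C" "Dom C k = obj H" "Cod C k = obj A" for k
  proof -
    have "tm k \<cdot> (ident C (obj A) \<otimes> \<eta>\<^bsub>H\<^esub>) = lin (fibre k \<cdot> \<eta>\<^bsub>H\<^esub>)"
      unfolding tm_def by (rule lin_comp) simp_all
    then show ?thesis
      by (simp add: twisted_core_def assoc interchange del: tensor_ident_ident)
  qed
  show ?thesis using *[of g] *[of g'] eq by simp
qed

text \<open>At \<open>y = 1\<close> the two sides of multiplicativity reduce to
  \<open>(x_1.b) f(x_2)\<close> and \<open>f(x_1) (x_2.b) u(x_3)\<close>, and \<open>x.b\<close>
  absorbs \<open>u(x)\<close>.\<close>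

lemma commutingI:
  assumes "unital \<alpha>" "unital \<beta>"
    and \<alpha>1: "\<alpha> \<cdot> (ident C (obj H) \<otimes> \<eta>\<^bsub>H\<^esub>) = u" and \<beta>1: "\<beta> \<cdot> (ident C (obj H) \<otimes> \<eta>\<^bsub>H\<^esub>) = u"
    and [simp]: "f \<in> Arr C" "Dom C f = obj H" "Cod C f = obj A"
    and uf: "\<mu>\<^bsub>A\<^esub> \<cdot> pair \<delta>\<^bsub>H\<^esub> u f = f" and f1: "fibre f \<cdot> \<eta>\<^bsub>H\<^esub> = fibre u \<cdot> \<eta>\<^bsub>H\<^esub>"
    and eq: "tm f \<cdot> twisted_core u u \<alpha> = tm u \<cdot> twisted_core f f \<beta>"
  shows "commuting f"
proof -
  interpret Q: action_context C H A "obj H \<odot> obj H" HH.\<Delta> "\<epsilon>\<^bsub>H\<^esub> \<otimes> \<epsilon>\<^bsub>H\<^esub>" HHA \<rho>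
    by (rule action_context_HHA)
  let ?\<rho> = "\<delta>\<^bsub>H\<^esub> \<otimes> ident C (obj A)"
  interpret P: action_context C H A "obj H" "\<delta>\<^bsub>H\<^esub>" "\<epsilon>\<^bsub>H\<^esub>" "obj H \<odot> obj A" ?\<rho>
    by (rule action_context_HA)
  note [simp] = unital_arr[OF assms(1)] unital_arr[OF assms(2)]
  let ?iA = "ident C (obj A)" and ?iH = "ident C (obj H)"
  let ?g = "?iH \<otimes> braid C (obj H) (obj A)" and ?k = "?iH \<otimes> (\<eta>\<^bsub>H\<^esub> \<otimes> ?iA)"
    and ?e = "?iH \<otimes> (?iA \<otimes> \<eta>\<^bsub>H\<^esub>)" and ?j = "HH.\<pi>\<^sub>1 \<otimes> ident C (obj A)"
  let ?l = "Q.source_mult f \<alpha> HH.\<pi>\<^sub>1 HH.\<pi>\<^sub>2 m\<^sub>2" and ?r = "Q.target_mult f u \<beta> HH.\<pi>\<^sub>1 HH.\<pi>\<^sub>2 m\<^sub>2"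
  have v: "Q.vec m\<^sub>2" by (simp add: Q.vec_def)
  have larr [simp]: "?l \<in> Arr C" "Dom C ?l = HHA" "Cod C ?l = obj A"
    "?r \<in> Arr C" "Dom C ?r = HHA" "Cod C ?r = obj A"
    by (simp_all add: Q.source_mult_def Q.target_mult_def)
  have l: "(tm f \<cdot> twisted_core u u \<alpha>) \<cdot> ?g = rpair \<rho> ?l \<mu>\<^bsub>H\<^esub>"
    "(?iA \<otimes> \<epsilon>\<^bsub>H\<^esub>) \<cdot> rpair \<rho> ?l \<mu>\<^bsub>H\<^esub> = ?l"
    using Q.source_mult_elem[OF assms(1) elements_HH v, of f]
    unfolding generic_argument mult_projections by simp_all
  have r: "(tm u \<cdot> twisted_core f u \<beta>) \<cdot> ?g = rpair \<rho> ?r \<mu>\<^bsub>H\<^esub>"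
    "(?iA \<otimes> \<epsilon>\<^bsub>H\<^esub>) \<cdot> rpair \<rho> ?r \<mu>\<^bsub>H\<^esub> = ?r"
    using Q.target_mult_elem[OF assms(2) elements_HH v, of f u]
    unfolding generic_argument mult_projections by simp_all
  have gk: "?g \<cdot> ?k = ?e"
    using naturality[of "\<eta>\<^bsub>H\<^esub>" ?iA \<K> "obj H" "obj A" "obj A"] by (simp add: interchange)
  \<comment> \<open>The second \<open>f\<close> on the right becomes \<open>u\<close>, since both
    have the same fibre over \<open>1\<close>.\<close>
  have "(tm f \<cdot> twisted_core u u \<alpha>) \<cdot> ?e = (tm u \<cdot> twisted_core f u \<beta>) \<cdot> ?e"
    unfolding eq using twisted_core_unit[of \<beta> f f u] f1 by (simp add: assoc)
  then have "rpair \<rho> ?l \<mu>\<^bsub>H\<^esub> \<cdot> ?k = rpair \<rho> ?r \<mu>\<^bsub>H\<^esub> \<cdot> ?k"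
    unfolding l(1)[symmetric] r(1)[symmetric] by (simp add: assoc gk)
  then have "((?iA \<otimes> \<epsilon>\<^bsub>H\<^esub>) \<cdot> rpair \<rho> ?l \<mu>\<^bsub>H\<^esub>) \<cdot> ?k = ((?iA \<otimes> \<epsilon>\<^bsub>H\<^esub>) \<cdot> rpair \<rho> ?r \<mu>\<^bsub>H\<^esub>) \<cdot> ?k"
    by (simp add: assoc)
  then have lr: "?l \<cdot> ?k = ?r \<cdot> ?k"
    unfolding l(2) r(2) .
  have n: "Q.actn HH.\<pi>\<^sub>1 m\<^sub>2 = \<phi>\<^bsub>A\<^esub> \<cdot> ?j"
    using HH.prod.pair_cofree[of "obj A" HH.\<pi>\<^sub>1] by simp
  have vn: "Q.vec (\<phi>\<^bsub>A\<^esub> \<cdot> ?j)" by (simp add: Q.vec_def)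
  have "?l \<cdot> ?k = P.rmul \<phi>\<^bsub>A\<^esub> f"
  proof -
    \<comment> \<open>All occurrences of \<open>y\<close> are collected in \<open>?c\<close>, so the
      other factor is free of \<open>y\<close> and \<open>rpair_first_unit\<close> applies.\<close>
    let ?c = "\<mu>\<^bsub>A\<^esub> \<cdot> pair HH.\<Delta> \<alpha> (f \<cdot> \<mu>\<^bsub>H\<^esub>)"
    have "?l = Q.rmul (\<phi>\<^bsub>A\<^esub> \<cdot> ?j) ?c"
      unfolding Q.source_mult_def n HH.pair_projections
      using Q.rmul_rmul[OF _ _ vn, of \<alpha> "f \<cdot> \<mu>\<^bsub>H\<^esub>"] by (simp add: Q.scal_def)
    then have "?l \<cdot> ?k = \<mu>\<^bsub>A\<^esub> \<cdot> (rpair \<rho> (\<phi>\<^bsub>A\<^esub> \<cdot> ?j) ?c \<cdot> ?k)"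
      by (simp add: assoc)
    also have "\<dots> = \<mu>\<^bsub>A\<^esub> \<cdot> rpair ?\<rho> \<phi>\<^bsub>A\<^esub> (?c \<cdot> (?iH \<otimes> \<eta>\<^bsub>H\<^esub>))"
      by (subst rpair_first_unit) simp_all
    also have "?c \<cdot> (?iH \<otimes> \<eta>\<^bsub>H\<^esub>) = f"
      using assms(1) \<alpha>1 assms(5-7) uf by (rule conv_unit)
    finally show ?thesis .
  qed
  moreover have "?r \<cdot> ?k = P.lmul f \<phi>\<^bsub>A\<^esub>"
  proof -
    have p: "P.vec (ident C (obj A) \<cdot> \<phi>\<^bsub>A\<^esub>)" by (simp add: P.vec_def)
    \<comment> \<open>\<open>\<epsilon> \<otimes> A\<close> is the generic vector \<open>b\<close>
      over \<open>H \<odot> A\<close>, so \<open>\<phi>\<close> itself is the value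
      \<open>x.b\<close>.\<close>
    have phi: "P.actn ?iH (\<epsilon>\<^bsub>H\<^esub> \<otimes> ?iA) = \<phi>\<^bsub>A\<^esub>"
      using H.pair_cofree[of "obj A" ?iH] by simp
    have eH: "P.element ?iH" by (simp add: P.element_def pair_def)
    have "?r = Q.lmul (f \<cdot> HH.\<pi>\<^sub>1) (Q.rmul (\<phi>\<^bsub>A\<^esub> \<cdot> ?j) \<beta>)"
      using Q.actn_rmul_u[OF assms(2) elements_HH v]
      unfolding Q.target_mult_def n HH.pair_projections by simp
    also have "\<dots> = Q.rmul (Q.lmul (f \<cdot> HH.\<pi>\<^sub>1) (\<phi>\<^bsub>A\<^esub> \<cdot> ?j)) \<beta>"
      by (rule Q.rmul_lmul[symmetric]) (simp_all add: Q.scal_def vn)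
    also have "Q.lmul (f \<cdot> HH.\<pi>\<^sub>1) (\<phi>\<^bsub>A\<^esub> \<cdot> ?j) = P.lmul f \<phi>\<^bsub>A\<^esub> \<cdot> ?j"
    proof -
      have "?\<rho> \<cdot> ?j = (HH.\<pi>\<^sub>1 \<otimes> ?j) \<cdot> \<rho>"
        by (simp add: interchange HH.comul_projections(1) flip: tensor_assoc) (simp add: pair_def tensor_assoc)
      then have "pair ?\<rho> f \<phi>\<^bsub>A\<^esub> \<cdot> ?j = pair \<rho> (f \<cdot> HH.\<pi>\<^sub>1) (\<phi>\<^bsub>A\<^esub> \<cdot> ?j)"
        by (rule P.pair_comp) simp_all
      then show ?thesis by (simp add: assoc)
    qed
    finally have "?r \<cdot> ?k = \<mu>\<^bsub>A\<^esub> \<cdot> (rpair \<rho> (P.lmul f \<phi>\<^bsub>A\<^esub> \<cdot> ?j) \<beta> \<cdot> ?k)"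
      by (simp add: assoc)
    also have "\<dots> = P.rmul (P.lmul f \<phi>\<^bsub>A\<^esub>) u"
      by (subst rpair_first_unit) (simp_all add: \<beta>1)
    also have "\<dots> = P.lmul f (P.rmul \<phi>\<^bsub>A\<^esub> u)"
      by (rule P.rmul_lmul) (simp_all add: P.scal_def P.vec_def)
    also have "P.rmul \<phi>\<^bsub>A\<^esub> u = \<phi>\<^bsub>A\<^esub>"
      using P.rmul_u[OF eH, of "\<epsilon>\<^bsub>H\<^esub> \<otimes> ?iA"] by (simp add: phi P.vec_def)
    finally show ?thesis .
  qed
  moreover have "\<mu>\<^bsub>A\<^esub> \<cdot> (?iA \<otimes> f) \<cdot> psi C H A = P.rmul \<phi>\<^bsub>A\<^esub> f"
  proof -
    have phi: "P.actn ?iH (\<epsilon>\<^bsub>H\<^esub> \<otimes> ?iA) = \<phi>\<^bsub>A\<^esub>" and id: "pair ?\<rho> ?iH (\<epsilon>\<^bsub>H\<^esub> \<otimes> ?iA) = ident C (obj H \<odot> obj A)"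
      using H.pair_cofree[of "obj A" ?iH] by simp_all
    have eH: "P.element ?iH" by (simp add: P.element_def pair_def)
    have "psi C H A = rpair ?\<rho> \<phi>\<^bsub>A\<^esub> ?iH"
      using P.psi_elem[OF eH, of "\<epsilon>\<^bsub>H\<^esub> \<otimes> ?iA"] unfolding phi id by (simp add: P.vec_def)
    then show ?thesis by (simp add: assoc P.tensor_rpair)
  qed
  moreover have "\<mu>\<^bsub>A\<^esub> \<cdot> (f \<otimes> \<phi>\<^bsub>A\<^esub>) \<cdot> (\<delta>\<^bsub>H\<^esub> \<otimes> ?iA) = P.lmul f \<phi>\<^bsub>A\<^esub>"
    by (simp add: pair_def assoc)
  ultimately show ?thesis using lr by (simp add: commuting_def)
qed

lemma twisted_core_eqI:
  assumes "unital \<alpha>" "unital \<beta>" and [simp]: "f \<in> Arr C" "Dom C f = obj H" "Cod C f = obj A"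
    and "commuting f" "cohomologous f \<alpha> \<beta>"
  shows "tm f \<cdot> twisted_core u u \<alpha> = tm u \<cdot> twisted_core f f \<beta>"
proof -
  interpret Q: action_context C H A "obj H \<odot> obj H" HH.\<Delta> "\<epsilon>\<^bsub>H\<^esub> \<otimes> \<epsilon>\<^bsub>H\<^esub>" HHA \<rho>
    by (rule action_context_HHA)
  note [simp] = unital_arr[OF assms(1)] unital_arr[OF assms(2)]
  have v: "Q.vec m\<^sub>2" by (simp add: Q.vec_def)
  have "pair HH.\<Delta> HH.\<pi>\<^sub>1 (f \<cdot> HH.\<pi>\<^sub>2) = ident C (obj H) \<otimes> f"
    using HH.prod.self.tensor_pair[of HH.\<pi>\<^sub>1 HH.\<pi>\<^sub>2 "ident C (obj H)" f]
    by (simp add: HH.pair_projections)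
  then have "Q.source_mult f \<alpha> HH.\<pi>\<^sub>1 HH.\<pi>\<^sub>2 m\<^sub>2 = Q.target_mult f f \<beta> HH.\<pi>\<^sub>1 HH.\<pi>\<^sub>2 m\<^sub>2"
    using assms(7)
    by (intro Q.source_mult_eq_target_mult assms elements_HH v)
      (simp_all add: HH.pair_projections cohomologous_def)
  then show ?thesis using twisted_core_eq_iff[OF assms(1-5)] by simp
qed

text \<open>With \<open>b = 1\<close> no free argument remains, so \<open>X = H \<odot> H\<close>
  suffices and \<open>rpair\<close> becomes \<open>pair\<close>. Commutation then reverses
  \<open>f(x) (x.f(y))\<close> into the order of the coboundary condition.\<close>

lemma cohomologousI:
  assumes "unital \<alpha>" "unital \<beta>" and [simp]: "f \<in> Arr C" "Dom C f = obj H" "Cod C f = obj A"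
    and "commuting f" and eq: "tm f \<cdot> twisted_core u u \<alpha> = tm u \<cdot> twisted_core f f \<beta>"
  shows "cohomologous f \<alpha> \<beta>"
proof -
  interpret Q: action_context C H A "obj H \<odot> obj H" HH.\<Delta> "\<epsilon>\<^bsub>H\<^esub> \<otimes> \<epsilon>\<^bsub>H\<^esub>" "obj H \<odot> obj H" HH.\<Delta>
    by unfold_locales
  note [simp] = unital_arr[OF assms(1)] unital_arr[OF assms(2)]
  let ?x = HH.\<pi>\<^sub>1 and ?y = HH.\<pi>\<^sub>2
  define m where "m = \<eta>\<^bsub>A\<^esub> \<cdot> (\<epsilon>\<^bsub>H\<^esub> \<otimes> \<epsilon>\<^bsub>H\<^esub>)"
  have v: "Q.vec m" by (simp add: Q.vec_def m_def)
  have "rpair HH.\<Delta> (Q.source_mult f \<alpha> ?x ?y m) \<mu>\<^bsub>H\<^esub> = rpair HH.\<Delta> (Q.target_mult f f \<beta> ?x ?y m) \<mu>\<^bsub>H\<^esub>"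
    using Q.source_mult_elem(1)[OF assms(1) elements_HH v, of f] Q.target_mult_elem(1)[OF assms(2) elements_HH v, of f f]
    by (simp add: eq mult_projections)
  then have lr: "Q.source_mult f \<alpha> ?x ?y m = Q.target_mult f f \<beta> ?x ?y m"
    using Q.source_mult_elem(2)[OF assms(1) elements_HH v, of f] Q.target_mult_elem(2)[OF assms(2) elements_HH v, of f f]
    by (simp add: mult_projections)
  have comm: "rpair HH.\<Delta> p q = pair HH.\<Delta> p q"
    if "p \<in> Arr C" "Dom C p = obj H \<odot> obj H" "q \<in> Arr C" "Dom C q = obj H \<odot> obj H" for p q
    using that by (rule HH.prod.rpair_self)
  have actx: "Q.actn ?x m = u \<cdot> ?x"
    using Q.actD_unit[OF elements_HH(1)] by (simp add: m_def)
  \<comment> \<open>\<open>\<alpha>\<close> absorbs \<open>u(x y)\<close>, which equals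
    \<open>x.u(y)\<close> and therefore absorbs \<open>u(x)\<close>.\<close>
  have "Q.lmul (u \<cdot> ?x) \<alpha> = \<alpha>"
  proof -
    have a: "\<alpha> = Q.lmul (Q.actn ?x (u \<cdot> ?y)) \<alpha>"
      using assms(1) Q.actD_u[OF elements_HH] by (simp add: mult_projections unital_def)
    have "Q.lmul (u \<cdot> ?x) (Q.lmul (Q.actn ?x (u \<cdot> ?y)) \<alpha>)
        = Q.lmul (Q.lmul (u \<cdot> ?x) (Q.actn ?x (u \<cdot> ?y))) \<alpha>"
      by (rule Q.lmul_assoc[symmetric]) (simp_all add: Q.scal_def Q.vec_def)
    also have "Q.lmul (u \<cdot> ?x) (Q.actn ?x (u \<cdot> ?y)) = Q.actn ?x (u \<cdot> ?y)"
      by (rule Q.lmul_u[OF elements_HH(1)]) (simp add: Q.vec_def)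
    finally show ?thesis using a by simp
  qed
  then have "Q.source_mult f \<alpha> ?x ?y m = \<mu>\<^bsub>A\<^esub> \<cdot> pair HH.\<Delta> \<alpha> (f \<cdot> \<mu>\<^bsub>H\<^esub>)"
    by (simp add: Q.source_mult_def actx mult_projections HH.pair_projections comm)
  moreover have "Q.target_mult f f \<beta> ?x ?y m
    = \<mu>\<^bsub>A\<^esub> \<cdot> pair HH.\<Delta> (\<mu>\<^bsub>A\<^esub> \<cdot> pair HH.\<Delta> (\<phi>\<^bsub>A\<^esub> \<cdot> (ident C (obj H) \<otimes> f)) (f \<cdot> ?x)) \<beta>"
  proof -
    have "pair HH.\<Delta> ?x (f \<cdot> ?y) = ident C (obj H) \<otimes> f"
      using HH.prod.self.tensor_pair[of ?x ?y "ident C (obj H)" f]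
      by (simp add: HH.pair_projections)
    then have p: "\<phi>\<^bsub>A\<^esub> \<cdot> (ident C (obj H) \<otimes> f) = Q.actn ?x (f \<cdot> ?y)" by simp
    have fy: "Q.vec (f \<cdot> ?y)" by (simp add: Q.vec_def)
    have "Q.rmul m (f \<cdot> ?y) = f \<cdot> ?y"
      using Q.lmul_unit[OF fy] by (simp add: comm m_def)
    then have "Q.target_mult f f \<beta> ?x ?y m = Q.lmul (f \<cdot> ?x) (Q.lmul (Q.actn ?x (f \<cdot> ?y)) \<beta>)"
      by (simp add: Q.target_mult_def HH.pair_projections comm)
    also have "\<dots> = Q.lmul (Q.lmul (f \<cdot> ?x) (Q.actn ?x (f \<cdot> ?y))) \<beta>"
      by (rule Q.lmul_assoc[symmetric]) (simp_all add: Q.scal_def Q.vec_def)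
    also have "Q.lmul (f \<cdot> ?x) (Q.actn ?x (f \<cdot> ?y)) = Q.rmul (Q.actn ?x (f \<cdot> ?y)) (f \<cdot> ?x)"
      by (rule Q.commuting_elem[OF assms(6) elements_HH(1) fy, symmetric]) simp_all
    finally show ?thesis by (simp add: p comm)
  qed
  ultimately show ?thesis using lr by (simp add: cohomologous_def)
qed

end

section \<open>Regular morphisms and linear colinear endomorphisms\<close>

context weak_action
begin

lemma conv_pair:
  assumes "cocommutative_coalgebra C D d e"
    and "f \<in> hom C D (obj A)" "g \<in> hom C D (obj A)"
  shows "conv C d A f g = \<mu>\<^bsub>A\<^esub> \<cdot> pair d f g"
proof -
  interpret cocommutative_coalgebra C D d e by fact
  show ?thesis using assms(2,3) by (simp add: conv_def pair_def in_hom assoc)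
qed

text \<open>Inside the triple products \<open>f g\<close> and \<open>g f\<close> can be replaced by
  \<open>u'\<close>; the resulting absorption laws are what composites of the maps \<open>tm\<close>
  deliver.\<close>

lemma regular_iff:
  assumes "cocommutative_coalgebra C D d e" and u': "u' \<in> hom C D (obj A)"
  shows "f \<in> regular C D d A u' \<longleftrightarrow> f \<in> hom C D (obj A) \<and> (\<exists>g \<in> hom C D (obj A).
    \<mu>\<^bsub>A\<^esub> \<cdot> pair d f g = u' \<and> \<mu>\<^bsub>A\<^esub> \<cdot> pair d g f = u' \<and> \<mu>\<^bsub>A\<^esub> \<cdot> pair d u' f = f \<and> \<mu>\<^bsub>A\<^esub> \<cdot> pair d u' g = g)"
proof -
  have "conv C d A f g = u' \<and> conv C d A g f = u' \<and>
      conv C d A (conv C d A f g) f = f \<and> conv C d A (conv C d A g f) g = g \<longleftrightarrow>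
    \<mu>\<^bsub>A\<^esub> \<cdot> pair d f g = u' \<and> \<mu>\<^bsub>A\<^esub> \<cdot> pair d g f = u' \<and>
      \<mu>\<^bsub>A\<^esub> \<cdot> pair d u' f = f \<and> \<mu>\<^bsub>A\<^esub> \<cdot> pair d u' g = g"
    if f: "f \<in> hom C D (obj A)" and g: "g \<in> hom C D (obj A)" for f g
    using conv_pair[OF assms(1) f g] conv_pair[OF assms(1) g f]
      conv_pair[OF assms(1) u' f] conv_pair[OF assms(1) u' g]
    by metis
  then show ?thesis unfolding regular_def by blast
qed

text \<open>The right law follows from the left one by bracketing \<open>f g f\<close> in both
  ways.\<close>

lemma regular_unital:
  assumes "cocommutative_coalgebra C D d e" and u': "u' \<in> hom C D (obj A)"
    and "f \<in> regular C D d A u'"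
  shows "\<mu>\<^bsub>A\<^esub> \<cdot> pair d u' f = f" "\<mu>\<^bsub>A\<^esub> \<cdot> pair d f u' = f"
proof -
  interpret cocommutative_coalgebra C D d e by fact
  interpret action_context C H A D d e D d by unfold_locales
  obtain g where f: "f \<in> hom C D (obj A)" and g: "g \<in> hom C D (obj A)"
    and eqs: "\<mu>\<^bsub>A\<^esub> \<cdot> pair d f g = u'" "\<mu>\<^bsub>A\<^esub> \<cdot> pair d g f = u'" "\<mu>\<^bsub>A\<^esub> \<cdot> pair d u' f = f"
    using assms(3) regular_iff[OF assms(1,2)] by auto
  have "lmul (mulD f g) f = lmul f (lmul g f)"
    using f g by (intro lmul_assoc) (simp_all add: scal_def vec_def in_hom)
  then show "\<mu>\<^bsub>A\<^esub> \<cdot> pair d u' f = f" "\<mu>\<^bsub>A\<^esub> \<cdot> pair d f u' = f"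
    by (simp_all add: eqs)
qed

lemma Reg1_iff:
  "f \<in> Reg1 C H A \<longleftrightarrow> f \<in> hom C (obj H) (obj A) \<and> (\<exists>g \<in> hom C (obj H) (obj A).
    \<mu>\<^bsub>A\<^esub> \<cdot> pair \<delta>\<^bsub>H\<^esub> f g = u \<and> \<mu>\<^bsub>A\<^esub> \<cdot> pair \<delta>\<^bsub>H\<^esub> g f = u \<and>
    \<mu>\<^bsub>A\<^esub> \<cdot> pair \<delta>\<^bsub>H\<^esub> u f = f \<and> \<mu>\<^bsub>A\<^esub> \<cdot> pair \<delta>\<^bsub>H\<^esub> u g = g)"
  unfolding Reg1_def by (rule regular_iff[OF H.cocommutative_coalgebra_axioms]) (simp add: in_hom)

lemma Reg1_unital:
  assumes "f \<in> Reg1 C H A"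
  shows "\<mu>\<^bsub>A\<^esub> \<cdot> pair \<delta>\<^bsub>H\<^esub> u f = f" "\<mu>\<^bsub>A\<^esub> \<cdot> pair \<delta>\<^bsub>H\<^esub> f u = f"
  using regular_unital[OF H.cocommutative_coalgebra_axioms _ assms[unfolded Reg1_def]]
  by (simp_all add: in_hom)

lemma Reg2_plus_unital:
  assumes "\<sigma> \<in> Reg2_plus C H A"
  shows "unital \<sigma>" "\<sigma> \<cdot> (ident C (obj H) \<otimes> \<eta>\<^bsub>H\<^esub>) = u"
proof -
  have "\<mu>\<^bsub>H\<^esub> \<otimes> \<eta>\<^bsub>A\<^esub> = (ident C (obj H) \<otimes> \<eta>\<^bsub>A\<^esub>) \<cdot> \<mu>\<^bsub>H\<^esub>"
    using interchange[of "\<mu>\<^bsub>H\<^esub>" "ident C (obj H)" "ident C \<K>" "\<eta>\<^bsub>A\<^esub>"] by simp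
  then have u2: "u2 C H A = u \<cdot> \<mu>\<^bsub>H\<^esub>"
    by (simp add: u2_def u1_def assoc)
  have reg: "\<sigma> \<in> regular C (obj H \<odot> obj H) HH.\<Delta> A (u \<cdot> \<mu>\<^bsub>H\<^esub>)"
    using assms by (simp add: Reg2_plus_def Reg2_def comul2_def u2)
  then have "\<sigma> \<in> hom C (obj H \<odot> obj H) (obj A)" by (simp add: regular_def)
  then show "unital \<sigma>"
    using regular_unital[OF HH.prod.cocommutative_coalgebra_axioms _ reg]
    by (simp add: unital_def in_hom)
  show "\<sigma> \<cdot> (ident C (obj H) \<otimes> \<eta>\<^bsub>H\<^esub>) = u"
    using assms by (simp add: Reg2_plus_def)
qed

lemma fibre_counit:
  assumes [simp]: "f \<in> Arr C" "Dom C f = obj H" "Cod C f = obj A"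
  shows "(ident C (obj A) \<otimes> \<epsilon>\<^bsub>H\<^esub>) \<cdot> fibre f = f"
proof -
  have "(ident C (obj A) \<otimes> \<epsilon>\<^bsub>H\<^esub>) \<cdot> fibre f = pair \<delta>\<^bsub>H\<^esub> f \<epsilon>\<^bsub>H\<^esub>"
    by (simp add: fibre_def interchange_tail pair_def)
  then show ?thesis
    using H.rpair_self[of f "\<epsilon>\<^bsub>H\<^esub>"] by simp
qed

lemma tm_unit:
  assumes [simp]: "f \<in> Arr C" "Dom C f = obj H" "Cod C f = obj A"
  shows "tm f \<cdot> (\<eta>\<^bsub>A\<^esub> \<otimes> ident C (obj H)) = fibre f"
  unfolding tm_def by (rule lin_unit) simp_all

lemma tm_inject:
  assumes "f \<in> Arr C" "Dom C f = obj H" "Cod C f = obj A"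
    "g \<in> Arr C" "Dom C g = obj H" "Cod C g = obj A"
  shows "tm f = tm g \<longleftrightarrow> f = g"
  using assms tm_unit fibre_counit by metis

text \<open>Each map multiplies the coefficient on the right, so the map applied first contributes
  the left factor and the order is reversed.\<close>

lemma tm_comp:
  assumes [simp]: "f \<in> Arr C" "Dom C f = obj H" "Cod C f = obj A"
    "g \<in> Arr C" "Dom C g = obj H" "Cod C g = obj A"
  shows "tm f \<cdot> tm g = tm (\<mu>\<^bsub>A\<^esub> \<cdot> pair \<delta>\<^bsub>H\<^esub> g f)"
proof -
  interpret P: action_context C H A "obj H" "\<delta>\<^bsub>H\<^esub>" "\<epsilon>\<^bsub>H\<^esub>" "obj H" "\<delta>\<^bsub>H\<^esub>"
    by unfold_locales
  have fib: "fibre k = rpair \<delta>\<^bsub>H\<^esub> k (ident C (obj H))"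
    if [simp]: "k \<in> Arr C" "Dom C k = obj H" "Cod C k = obj A" for k
    by (simp add: fibre_def H.rpair_self pair_def)
  have "P.element (ident C (obj H))" "P.vec g"
    by (simp_all add: P.element_def P.vec_def pair_def)
  then have "tm f \<cdot> fibre g = rpair \<delta>\<^bsub>H\<^esub> (\<mu>\<^bsub>A\<^esub> \<cdot> rpair \<delta>\<^bsub>H\<^esub> g f) (ident C (obj H))"
    using P.tm_elem[of "ident C (obj H)" g f] by (simp add: fib)
  then have "tm f \<cdot> fibre g = fibre (\<mu>\<^bsub>A\<^esub> \<cdot> pair \<delta>\<^bsub>H\<^esub> g f)"
    by (simp add: H.rpair_self fib)
  moreover have "tm f \<cdot> tm g = lin (tm f \<cdot> fibre g)"
    unfolding tm_def by (rule lin_lin) simp_all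
  ultimately show ?thesis by (simp add: tm_def[of "\<mu>\<^bsub>A\<^esub> \<cdot> pair \<delta>\<^bsub>H\<^esub> g f"])
qed

lemma tm_linear:
  assumes [simp]: "f \<in> Arr C" "Dom C f = obj H" "Cod C f = obj A"
  shows "tm f \<cdot> (\<mu>\<^bsub>A\<^esub> \<otimes> ident C (obj H)) = (\<mu>\<^bsub>A\<^esub> \<otimes> ident C (obj H)) \<cdot> (ident C (obj A) \<otimes> tm f)"
  using lin_left[of "fibre f"] by (simp add: tm_def)

lemma fibre_colinear:
  assumes [simp]: "f \<in> Arr C" "Dom C f = obj H" "Cod C f = obj A"
  shows "(ident C (obj A) \<otimes> \<delta>\<^bsub>H\<^esub>) \<cdot> fibre f = (fibre f \<otimes> ident C (obj H)) \<cdot> \<delta>\<^bsub>H\<^esub>"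
proof -
  have "(ident C (obj A) \<otimes> \<delta>\<^bsub>H\<^esub>) \<cdot> fibre f = (f \<otimes> ident C (obj H \<odot> obj H)) \<cdot> ((ident C (obj H) \<otimes> \<delta>\<^bsub>H\<^esub>) \<cdot> \<delta>\<^bsub>H\<^esub>)"
    by (simp add: fibre_def interchange_tail)
  also have "\<dots> = ((f \<otimes> ident C (obj H \<odot> obj H)) \<cdot> (\<delta>\<^bsub>H\<^esub> \<otimes> ident C (obj H))) \<cdot> \<delta>\<^bsub>H\<^esub>"
    by (simp add: assoc flip: H.coassoc)
  finally show ?thesis by (simp add: whisker_right fibre_def)
qed

lemma tm_colinear:
  assumes [simp]: "f \<in> Arr C" "Dom C f = obj H" "Cod C f = obj A"
  shows "(ident C (obj A) \<otimes> \<delta>\<^bsub>H\<^esub>) \<cdot> tm f = (tm f \<otimes> ident C (obj H)) \<cdot> (ident C (obj A) \<otimes> \<delta>\<^bsub>H\<^esub>)"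
proof -
  let ?iA = "ident C (obj A)" and ?iH = "ident C (obj H)"
  have "(?iA \<otimes> \<delta>\<^bsub>H\<^esub>) \<cdot> tm f = ((?iA \<otimes> \<delta>\<^bsub>H\<^esub>) \<cdot> (\<mu>\<^bsub>A\<^esub> \<otimes> ?iH)) \<cdot> (?iA \<otimes> fibre f)"
    by (simp add: tm_def lin_def assoc)
  also have "(?iA \<otimes> \<delta>\<^bsub>H\<^esub>) \<cdot> (\<mu>\<^bsub>A\<^esub> \<otimes> ?iH) = (\<mu>\<^bsub>A\<^esub> \<otimes> (?iH \<otimes> ?iH)) \<cdot> (?iA \<otimes> (?iA \<otimes> \<delta>\<^bsub>H\<^esub>))"
    by (simp add: interchange)
  also have "((\<mu>\<^bsub>A\<^esub> \<otimes> (?iH \<otimes> ?iH)) \<cdot> (?iA \<otimes> (?iA \<otimes> \<delta>\<^bsub>H\<^esub>))) \<cdot> (?iA \<otimes> fibre f)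
      = (\<mu>\<^bsub>A\<^esub> \<otimes> (?iH \<otimes> ?iH)) \<cdot> (?iA \<otimes> ((?iA \<otimes> \<delta>\<^bsub>H\<^esub>) \<cdot> fibre f))"
    by (simp add: assoc interchange del: tensor_ident_ident)
  also have "\<dots> = (\<mu>\<^bsub>A\<^esub> \<otimes> (?iH \<otimes> ?iH)) \<cdot> ((?iA \<otimes> (fibre f \<otimes> ?iH)) \<cdot> (?iA \<otimes> \<delta>\<^bsub>H\<^esub>))"
    by (simp add: fibre_colinear interchange)
  also have "\<dots> = ((\<mu>\<^bsub>A\<^esub> \<otimes> (?iH \<otimes> ?iH)) \<cdot> (?iA \<otimes> (fibre f \<otimes> ?iH))) \<cdot> (?iA \<otimes> \<delta>\<^bsub>H\<^esub>)"
    by (simp add: assoc)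
  also have "(\<mu>\<^bsub>A\<^esub> \<otimes> (?iH \<otimes> ?iH)) \<cdot> (?iA \<otimes> (fibre f \<otimes> ?iH)) = tm f \<otimes> ?iH"
  proof -
    have "(\<mu>\<^bsub>A\<^esub> \<otimes> (?iH \<otimes> ?iH)) \<cdot> (?iA \<otimes> (fibre f \<otimes> ?iH))
        = ((\<mu>\<^bsub>A\<^esub> \<otimes> ?iH) \<otimes> ?iH) \<cdot> ((?iA \<otimes> fibre f) \<otimes> ?iH)"
      by (simp only: tensor_assoc ident_arr structure_arr fibre_arr assms H.D ob)
    then show ?thesis by (simp add: interchange tm_def lin_def)
  qed
  finally show ?thesis .
qed

text \<open>Linearity determines \<open>W\<close> by its restriction \<open>g\<close> to
  \<open>1 \<otimes> x\<close>. The counit on the middle leg of the colinearity of \<open>g\<close>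
  shows that \<open>g\<close> is the fibre of \<open>f = (A \<otimes> \<epsilon>) g\<close>.\<close>

lemma linear_colinear_eq_tm:
  assumes [simp]: "W \<in> Arr C" "Dom C W = obj A \<odot> obj H" "Cod C W = obj A \<odot> obj H"
    and lin: "W \<cdot> (\<mu>\<^bsub>A\<^esub> \<otimes> ident C (obj H)) = (\<mu>\<^bsub>A\<^esub> \<otimes> ident C (obj H)) \<cdot> (ident C (obj A) \<otimes> W)"
    and colin: "(ident C (obj A) \<otimes> \<delta>\<^bsub>H\<^esub>) \<cdot> W = (W \<otimes> ident C (obj H)) \<cdot> (ident C (obj A) \<otimes> \<delta>\<^bsub>H\<^esub>)"
  obtains f where "f \<in> Arr C" "Dom C f = obj H" "Cod C f = obj A" "W = tm f"
proof -
  let ?iA = "ident C (obj A)" and ?iH = "ident C (obj H)"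
  define g where "g = W \<cdot> (\<eta>\<^bsub>A\<^esub> \<otimes> ?iH)"
  define f where "f = (?iA \<otimes> \<epsilon>\<^bsub>H\<^esub>) \<cdot> g"
  have [simp]: "g \<in> Arr C" "Dom C g = obj H" "Cod C g = obj A \<odot> obj H"
    by (simp_all add: g_def)
  have f [simp]: "f \<in> Arr C" "Dom C f = obj H" "Cod C f = obj A"
    by (simp_all add: f_def)
  have "ident C (obj A \<odot> obj H) = (\<mu>\<^bsub>A\<^esub> \<otimes> ?iH) \<cdot> ((?iA \<otimes> \<eta>\<^bsub>A\<^esub>) \<otimes> ?iH)"
    by (simp add: interchange unit_mult)
  then have "W = W \<cdot> ((\<mu>\<^bsub>A\<^esub> \<otimes> ?iH) \<cdot> ((?iA \<otimes> \<eta>\<^bsub>A\<^esub>) \<otimes> ?iH))"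
    by (metis assms(1,2) comp_ident(2))
  also have "\<dots> = (W \<cdot> (\<mu>\<^bsub>A\<^esub> \<otimes> ?iH)) \<cdot> (?iA \<otimes> (\<eta>\<^bsub>A\<^esub> \<otimes> ?iH))"
    by (simp add: assoc tensor_assoc)
  also have "\<dots> = lin g"
    unfolding lin by (simp add: lin_def g_def assoc interchange)
  finally have W: "W = lin g" .
  have "(g \<otimes> ?iH) \<cdot> \<delta>\<^bsub>H\<^esub> = (W \<otimes> ?iH) \<cdot> (((\<eta>\<^bsub>A\<^esub> \<otimes> ?iH) \<otimes> ?iH) \<cdot> \<delta>\<^bsub>H\<^esub>)"
    by (simp add: g_def interchange_tail)
  also have "((\<eta>\<^bsub>A\<^esub> \<otimes> ?iH) \<otimes> ?iH) \<cdot> \<delta>\<^bsub>H\<^esub> = (?iA \<otimes> \<delta>\<^bsub>H\<^esub>) \<cdot> (\<eta>\<^bsub>A\<^esub> \<otimes> ?iH)"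
    using interchange[of "ident C \<K>" "\<eta>\<^bsub>A\<^esub>" "\<delta>\<^bsub>H\<^esub>" "ident C (obj H \<odot> obj H)"]
    by (simp add: tensor_assoc interchange)
  also have "(W \<otimes> ?iH) \<cdot> ((?iA \<otimes> \<delta>\<^bsub>H\<^esub>) \<cdot> (\<eta>\<^bsub>A\<^esub> \<otimes> ?iH))
      = ((W \<otimes> ?iH) \<cdot> (?iA \<otimes> \<delta>\<^bsub>H\<^esub>)) \<cdot> (\<eta>\<^bsub>A\<^esub> \<otimes> ?iH)"
    by (simp add: assoc)
  also have "\<dots> = (?iA \<otimes> \<delta>\<^bsub>H\<^esub>) \<cdot> g"
    unfolding colin[symmetric] by (simp add: g_def assoc)
  finally have g: "(g \<otimes> ?iH) \<cdot> \<delta>\<^bsub>H\<^esub> = (?iA \<otimes> \<delta>\<^bsub>H\<^esub>) \<cdot> g" .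
  have "fibre f = ((?iA \<otimes> \<epsilon>\<^bsub>H\<^esub>) \<otimes> ?iH) \<cdot> ((g \<otimes> ?iH) \<cdot> \<delta>\<^bsub>H\<^esub>)"
    by (simp add: fibre_def f_def interchange_tail)
  also have "\<dots> = (?iA \<otimes> ((\<epsilon>\<^bsub>H\<^esub> \<otimes> ?iH) \<cdot> \<delta>\<^bsub>H\<^esub>)) \<cdot> g"
    by (simp add: g tensor_assoc interchange_tail)
  also have "\<dots> = g" by (simp add: H.counit)
  finally have "W = tm f" using W by (simp add: tm_def)
  then show ?thesis using that f by blast
qed

end

section \<open>Equivalences of weak crossed products\<close>

locale wcp_splitting = weak_action C H A
  for C :: "('o, 'm, 'z) category_data_scheme" (structure) and H A +
  fixes Z :: 'o and i p :: 'm
  assumes split: "splits_through C (nabla C H A) (obj A \<odot> obj H) Z i p"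
begin

lemma split_arr [simp]:
  "i \<in> Arr C" "Dom C i = Z" "Cod C i = obj A \<odot> obj H"
  "p \<in> Arr C" "Dom C p = obj A \<odot> obj H" "Cod C p = Z"
  using split by (simp_all add: splits_through_def in_hom)

lemma Z [simp]: "Z \<in> Ob C"
  using dom_closed[of i] by simp

lemma pi [simp]: "p \<cdot> i = ident C Z"
  and ip: "i \<cdot> p = tm u"
  using split by (simp_all add: splits_through_def nabla_eq)

lemma pi_tail: "k \<in> Arr C \<Longrightarrow> Cod C k = Z \<Longrightarrow> p \<cdot> (i \<cdot> k) = k"
  by (simp flip: assoc)

lemma nabla_i: "tm u \<cdot> i = i"
  unfolding ip[symmetric] by (simp add: assoc)

lemma p_nabla: "p \<cdot> tm u = p"
  unfolding ip[symmetric] by (simp add: pi_tail)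

text \<open>Carries endomorphisms of the retract \<open>Z\<close> to the endomorphisms of
  \<open>A \<otimes> H\<close> that absorb the idempotent \<open>tm u\<close> on both sides;
  composition is preserved and the identity becomes \<open>tm u\<close>.\<close>

definition extend :: "'m \<Rightarrow> 'm" where "extend T = i \<cdot> (T \<cdot> p)"

definition restrict :: "'m \<Rightarrow> 'm" where "restrict W = p \<cdot> (W \<cdot> i)"

lemma extend_arr [simp]:
  assumes "T \<in> Arr C" "Dom C T = Z" "Cod C T = Z"
  shows "extend T \<in> Arr C" "Dom C (extend T) = obj A \<odot> obj H" "Cod C (extend T) = obj A \<odot> obj H"
  using assms by (simp_all add: extend_def)

lemma restrict_arr [simp]:
  assumes "W \<in> Arr C" "Dom C W = obj A \<odot> obj H" "Cod C W = obj A \<odot> obj H"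
  shows "restrict W \<in> Arr C" "Dom C (restrict W) = Z" "Cod C (restrict W) = Z"
  using assms by (simp_all add: restrict_def)

lemma restrict_extend:
  assumes "T \<in> Arr C" "Dom C T = Z" "Cod C T = Z"
  shows "restrict (extend T) = T"
  using assms by (simp add: restrict_def extend_def pi_tail assoc)

lemma extend_restrict:
  assumes "W \<in> Arr C" "Dom C W = obj A \<odot> obj H" "Cod C W = obj A \<odot> obj H"
  shows "extend (restrict W) = tm u \<cdot> (W \<cdot> tm u)"
  using assms by (simp add: restrict_def extend_def assoc flip: ip)

lemma extend_comp:
  assumes "S \<in> Arr C" "Dom C S = Z" "Cod C S = Z" "T \<in> Arr C" "Dom C T = Z" "Cod C T = Z"
  shows "extend S \<cdot> extend T = extend (S \<cdot> T)"
  using assms by (simp add: extend_def pi_tail assoc)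

lemma extend_ident: "extend (ident C Z) = tm u"
  by (simp add: extend_def ip)

lemma extend_nabla:
  assumes "T \<in> Arr C" "Dom C T = Z" "Cod C T = Z"
  shows "tm u \<cdot> extend T = extend T" "extend T \<cdot> tm u = extend T"
  using assms extend_comp[of "ident C Z" T] extend_comp[of T "ident C Z"] by (simp_all add: extend_ident)

lemma wcp_act_arr [simp]:
  "wcp_act C H A i p \<in> Arr C" "Dom C (wcp_act C H A i p) = obj A \<odot> Z" "Cod C (wcp_act C H A i p) = Z"
  by (simp_all add: wcp_act_def)

lemma wcp_coact_arr [simp]:
  "wcp_coact C H A i p \<in> Arr C" "Dom C (wcp_coact C H A i p) = Z" "Cod C (wcp_coact C H A i p) = Z \<odot> obj H"
  by (simp_all add: wcp_coact_def)

text \<open>The idempotent \<open>tm u\<close> is itself linear, so the action on \<open>Z\<close>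
  corresponds to plain multiplication on \<open>A \<otimes> H\<close>, and composing with
  \<open>i\<close> and \<open>p\<close> is reversible.\<close>

lemma linear_iff:
  assumes [simp]: "T \<in> Arr C" "Dom C T = Z" "Cod C T = Z"
  shows "T \<cdot> wcp_act C H A i p = wcp_act C H A i p \<cdot> (ident C (obj A) \<otimes> T) \<longleftrightarrow>
    extend T \<cdot> (\<mu>\<^bsub>A\<^esub> \<otimes> ident C (obj H)) = (\<mu>\<^bsub>A\<^esub> \<otimes> ident C (obj H)) \<cdot> (ident C (obj A) \<otimes> extend T)"
proof -
  let ?iA = "ident C (obj A)" and ?m = "\<mu>\<^bsub>A\<^esub> \<otimes> ident C (obj H)" and ?a = "wcp_act C H A i p"
  have act: "?a \<cdot> (?iA \<otimes> p) = p \<cdot> ?m"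
  proof -
    have "?a \<cdot> (?iA \<otimes> p) = p \<cdot> (?m \<cdot> (?iA \<otimes> tm u))"
      by (simp add: wcp_act_def assoc interchange ip)
    also have "\<dots> = (p \<cdot> tm u) \<cdot> ?m" by (simp add: assoc tm_linear)
    finally show ?thesis by (simp add: p_nabla)
  qed
  have l: "i \<cdot> ((T \<cdot> ?a) \<cdot> (?iA \<otimes> p)) = extend T \<cdot> ?m"
    by (simp add: assoc act extend_def)
  have r: "i \<cdot> ((?a \<cdot> (?iA \<otimes> T)) \<cdot> (?iA \<otimes> p)) = ?m \<cdot> (?iA \<otimes> extend T)"
  proof -
    have "i \<cdot> ((?a \<cdot> (?iA \<otimes> T)) \<cdot> (?iA \<otimes> p)) = i \<cdot> (p \<cdot> (?m \<cdot> (?iA \<otimes> extend T)))"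
      by (simp add: wcp_act_def assoc interchange extend_def)
    also have "\<dots> = (i \<cdot> p) \<cdot> (?m \<cdot> (?iA \<otimes> extend T))"
      by (simp add: assoc)
    also have "\<dots> = (tm u \<cdot> ?m) \<cdot> (?iA \<otimes> extend T)"
      by (simp add: assoc ip)
    also have "\<dots> = ?m \<cdot> ((?iA \<otimes> tm u) \<cdot> (?iA \<otimes> extend T))"
      by (simp add: assoc tm_linear)
    finally show ?thesis by (simp add: interchange extend_nabla)
  qed
  have cancel: "p \<cdot> ((i \<cdot> (k \<cdot> (?iA \<otimes> p))) \<cdot> (?iA \<otimes> i)) = k"
    if "k \<in> Arr C" "Dom C k = obj A \<odot> Z" "Cod C k = Z" for k
    using that by (simp add: assoc interchange pi_tail)
  have cancel1: "p \<cdot> ((i \<cdot> ((T \<cdot> ?a) \<cdot> (?iA \<otimes> p))) \<cdot> (?iA \<otimes> i)) = T \<cdot> ?a"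
    by (rule cancel) simp_all
  have cancel2: "p \<cdot> ((i \<cdot> ((?a \<cdot> (?iA \<otimes> T)) \<cdot> (?iA \<otimes> p))) \<cdot> (?iA \<otimes> i)) = ?a \<cdot> (?iA \<otimes> T)"
    by (rule cancel) simp_all
  show ?thesis
  proof
    assume "T \<cdot> ?a = ?a \<cdot> (?iA \<otimes> T)"
    then show "extend T \<cdot> ?m = ?m \<cdot> (?iA \<otimes> extend T)" using l r by metis
  next
    assume "extend T \<cdot> ?m = ?m \<cdot> (?iA \<otimes> extend T)"
    then have "i \<cdot> ((T \<cdot> ?a) \<cdot> (?iA \<otimes> p)) = i \<cdot> ((?a \<cdot> (?iA \<otimes> T)) \<cdot> (?iA \<otimes> p))"
      using l r by metis
    then show "T \<cdot> ?a = ?a \<cdot> (?iA \<otimes> T)"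
      using cancel1 cancel2 by metis
  qed
qed

lemma colinear_iff:
  assumes [simp]: "T \<in> Arr C" "Dom C T = Z" "Cod C T = Z"
  shows "wcp_coact C H A i p \<cdot> T = (T \<otimes> ident C (obj H)) \<cdot> wcp_coact C H A i p \<longleftrightarrow>
    (ident C (obj A) \<otimes> \<delta>\<^bsub>H\<^esub>) \<cdot> extend T
      = (extend T \<otimes> ident C (obj H)) \<cdot> (ident C (obj A) \<otimes> \<delta>\<^bsub>H\<^esub>)"
proof -
  let ?iH = "ident C (obj H)" and ?d = "ident C (obj A) \<otimes> \<delta>\<^bsub>H\<^esub>" and ?r = "wcp_coact C H A i p"
  have coact: "(i \<otimes> ?iH) \<cdot> ?r = ?d \<cdot> i"
  proof -
    have "(i \<otimes> ?iH) \<cdot> ?r = ((tm u \<otimes> ?iH) \<cdot> ?d) \<cdot> i"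
      by (simp add: wcp_coact_def assoc interchange_tail ip)
    also have "\<dots> = ?d \<cdot> (tm u \<cdot> i)" by (simp add: assoc flip: tm_colinear)
    finally show ?thesis by (simp add: nabla_i)
  qed
  have l: "((i \<otimes> ?iH) \<cdot> (?r \<cdot> T)) \<cdot> p = ?d \<cdot> extend T"
  proof -
    have "((i \<otimes> ?iH) \<cdot> (?r \<cdot> T)) \<cdot> p = ((i \<otimes> ?iH) \<cdot> ?r) \<cdot> (T \<cdot> p)"
      by (simp add: assoc)
    then show ?thesis unfolding coact by (simp add: assoc extend_def)
  qed
  have r: "((i \<otimes> ?iH) \<cdot> ((T \<otimes> ?iH) \<cdot> ?r)) \<cdot> p = (extend T \<otimes> ?iH) \<cdot> ?d"
  proof -
    have "((i \<otimes> ?iH) \<cdot> ((T \<otimes> ?iH) \<cdot> ?r)) \<cdot> p = (extend T \<otimes> ?iH) \<cdot> (?d \<cdot> (i \<cdot> p))"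
      by (simp add: wcp_coact_def assoc interchange_tail extend_def)
    also have "\<dots> = (extend T \<otimes> ?iH) \<cdot> ((tm u \<otimes> ?iH) \<cdot> ?d)"
      by (simp add: ip tm_colinear)
    finally show ?thesis by (simp add: interchange_tail extend_nabla)
  qed
  have cancel: "(p \<otimes> ?iH) \<cdot> ((((i \<otimes> ?iH) \<cdot> k) \<cdot> p) \<cdot> i) = k"
    if "k \<in> Arr C" "Dom C k = Z" "Cod C k = Z \<odot> obj H" for k
    using that by (simp add: assoc interchange_tail)
  have cancel1: "(p \<otimes> ?iH) \<cdot> ((((i \<otimes> ?iH) \<cdot> (?r \<cdot> T)) \<cdot> p) \<cdot> i) = ?r \<cdot> T"
    by (rule cancel) simp_all
  have cancel2: "(p \<otimes> ?iH) \<cdot> ((((i \<otimes> ?iH) \<cdot> ((T \<otimes> ?iH) \<cdot> ?r)) \<cdot> p) \<cdot> i) = (T \<otimes> ?iH) \<cdot> ?r"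
    by (rule cancel) simp_all
  show ?thesis
  proof
    assume "?r \<cdot> T = (T \<otimes> ?iH) \<cdot> ?r"
    then show "?d \<cdot> extend T = (extend T \<otimes> ?iH) \<cdot> ?d" using l r by metis
  next
    assume "?d \<cdot> extend T = (extend T \<otimes> ?iH) \<cdot> ?d"
    then have "((i \<otimes> ?iH) \<cdot> (?r \<cdot> T)) \<cdot> p = ((i \<otimes> ?iH) \<cdot> ((T \<otimes> ?iH) \<cdot> ?r)) \<cdot> p"
      using l r by metis
    then show "?r \<cdot> T = (T \<otimes> ?iH) \<cdot> ?r"
      using cancel1 cancel2 by metis
  qed
qed

text \<open>After the split monomorphism \<open>i\<close>, the preunit is \<open>tm u\<close> at
  \<open>1 \<otimes> 1\<close> and its image under \<open>T\<close> is \<open>tm f\<close> there, so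
  only fibres over \<open>1\<close> are compared.\<close>

lemma unit_iff:
  assumes [simp]: "T \<in> Arr C" "Dom C T = Z" "Cod C T = Z"
    and f [simp]: "f \<in> Arr C" "Dom C f = obj H" "Cod C f = obj A" and T: "extend T = tm f"
  shows "T \<cdot> (p \<cdot> wcp_preunit C H A) = p \<cdot> wcp_preunit C H A \<longleftrightarrow> fibre f \<cdot> \<eta>\<^bsub>H\<^esub> = fibre u \<cdot> \<eta>\<^bsub>H\<^esub>"
proof -
  have unit: "tm g \<cdot> (\<eta>\<^bsub>A\<^esub> \<otimes> \<eta>\<^bsub>H\<^esub>) = fibre g \<cdot> \<eta>\<^bsub>H\<^esub>"
    if [simp]: "g \<in> Arr C" "Dom C g = obj H" "Cod C g = obj A" for g
  proof -
    have "\<eta>\<^bsub>A\<^esub> \<otimes> \<eta>\<^bsub>H\<^esub> = (\<eta>\<^bsub>A\<^esub> \<otimes> ident C (obj H)) \<cdot> \<eta>\<^bsub>H\<^esub>"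
      using interchange[of "ident C \<K>" "\<eta>\<^bsub>A\<^esub>" "\<eta>\<^bsub>H\<^esub>" "ident C (obj H)"] by simp
    then show ?thesis using tm_unit[of g] by (simp flip: assoc)
  qed
  have nu: "wcp_preunit C H A = i \<cdot> (p \<cdot> (\<eta>\<^bsub>A\<^esub> \<otimes> \<eta>\<^bsub>H\<^esub>))"
    by (simp add: wcp_preunit_def nabla_eq assoc flip: ip)
  have arr [simp]: "wcp_preunit C H A \<in> Arr C" "Dom C (wcp_preunit C H A) = \<K>"
    "Cod C (wcp_preunit C H A) = obj A \<odot> obj H"
    by (simp_all add: nu)
  have l: "i \<cdot> (T \<cdot> (p \<cdot> wcp_preunit C H A)) = fibre f \<cdot> \<eta>\<^bsub>H\<^esub>"
  proof -
    have "i \<cdot> (T \<cdot> (p \<cdot> wcp_preunit C H A)) = extend T \<cdot> (\<eta>\<^bsub>A\<^esub> \<otimes> \<eta>\<^bsub>H\<^esub>)"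
      by (simp add: nu extend_def assoc pi_tail)
    then show ?thesis by (simp add: T unit)
  qed
  have r: "i \<cdot> (p \<cdot> wcp_preunit C H A) = fibre u \<cdot> \<eta>\<^bsub>H\<^esub>"
  proof -
    have "i \<cdot> (p \<cdot> wcp_preunit C H A) = (i \<cdot> p) \<cdot> (\<eta>\<^bsub>A\<^esub> \<otimes> \<eta>\<^bsub>H\<^esub>)"
      by (simp add: nu assoc pi_tail)
    then show ?thesis by (simp add: ip unit)
  qed
  show ?thesis
    using l r pi_tail[of "T \<cdot> (p \<cdot> wcp_preunit C H A)"] pi_tail[of "p \<cdot> wcp_preunit C H A"] by auto
qed

lemma wcp_mul_arr [simp]:
  assumes "unital \<sigma>"
  shows "wcp_mul C H A \<sigma> \<in> Arr C" "Dom C (wcp_mul C H A \<sigma>) = obj A \<odot> (obj H \<odot> (obj A \<odot> obj H))"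
    "Cod C (wcp_mul C H A \<sigma>) = obj A \<odot> obj H"
  using unital_arr[OF assms] by (simp_all add: wcp_mul_eq)

text \<open>Composing with the split monomorphism \<open>i\<close> and the split epimorphism
  \<open>p \<otimes> p\<close> loses nothing; the resulting maps are left \<open>A\<close>-linear
  and hence determined by their cores.\<close>

lemma mult_iff:
  assumes [simp]: "T \<in> Arr C" "Dom C T = Z" "Cod C T = Z"
    and f [simp]: "f \<in> Arr C" "Dom C f = obj H" "Cod C f = obj A" and T: "extend T = tm f"
    and "unital \<alpha>" "unital \<beta>"
  shows "T \<cdot> (p \<cdot> wcp_mul C H A \<alpha> \<cdot> (i \<otimes> i)) = (p \<cdot> wcp_mul C H A \<beta> \<cdot> (i \<otimes> i)) \<cdot> (T \<otimes> T)
    \<longleftrightarrow> tm f \<cdot> twisted_core u u \<alpha> = tm u \<cdot> twisted_core f f \<beta>"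
    (is "?X = ?Y \<longleftrightarrow> ?K = ?K'")
proof -
  note [simp] = wcp_mul_arr[OF assms(8)] wcp_mul_arr[OF assms(9)]
  have arr [simp]: "?X \<in> Arr C" "Dom C ?X = Z \<odot> Z" "Cod C ?X = Z"
    "?Y \<in> Arr C" "Dom C ?Y = Z \<odot> Z" "Cod C ?Y = Z"
    by simp_all
  have "i \<cdot> (?X \<cdot> (p \<otimes> p)) = extend T \<cdot> (wcp_mul C H A \<alpha> \<cdot> ((i \<cdot> p) \<otimes> (i \<cdot> p)))"
    by (simp add: extend_def assoc interchange)
  also have "\<dots> = tm f \<cdot> lin (twisted_core u u \<alpha>)"
    using wcp_mul_tm[OF unital_arr[OF assms(8)] u_arr u_arr] by (simp add: T ip)
  also have "\<dots> = lin ?K"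
    using unital_arr[OF assms(8)] unfolding tm_def by (intro lin_lin) simp_all
  finally have l: "i \<cdot> (?X \<cdot> (p \<otimes> p)) = lin ?K" .
  have "i \<cdot> (?Y \<cdot> (p \<otimes> p)) = (i \<cdot> p) \<cdot> (wcp_mul C H A \<beta> \<cdot> (extend T \<otimes> extend T))"
    by (simp add: extend_def assoc interchange)
  also have "\<dots> = tm u \<cdot> lin (twisted_core f f \<beta>)"
    using wcp_mul_tm[OF unital_arr[OF assms(9)] f f] by (simp add: T ip)
  also have "\<dots> = lin ?K'"
    using unital_arr[OF assms(9)] unfolding tm_def by (intro lin_lin) simp_all
  finally have r: "i \<cdot> (?Y \<cdot> (p \<otimes> p)) = lin ?K'" .
  have cancel: "p \<cdot> ((i \<cdot> (k \<cdot> (p \<otimes> p))) \<cdot> (i \<otimes> i)) = k"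
    if "k \<in> Arr C" "Dom C k = Z \<odot> Z" "Cod C k = Z" for k
    using that by (simp add: assoc interchange pi_tail)
  have "?X = ?Y \<longleftrightarrow> lin ?K = lin ?K'"
    using l r cancel[OF arr(1-3)] cancel[OF arr(4-6)] by metis
  also have "\<dots> \<longleftrightarrow> ?K = ?K'"
  proof
    assume eq: "lin ?K = lin ?K'"
    note [simp] = unital_arr[OF assms(8)] unital_arr[OF assms(9)]
    have "lin ?K \<cdot> (\<eta>\<^bsub>A\<^esub> \<otimes> ident C (obj H \<odot> (obj A \<odot> obj H))) = ?K"
      "lin ?K' \<cdot> (\<eta>\<^bsub>A\<^esub> \<otimes> ident C (obj H \<odot> (obj A \<odot> obj H))) = ?K'"
      by (rule lin_unit; simp)+
    then show "?K = ?K'" using eq by metis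
  qed simp
  finally show ?thesis .
qed

lemma equivalent_iff:
  assumes \<alpha>: "unital \<alpha>" and \<beta>: "unital \<beta>"
  shows "equivalent_wcp C H A Z i p \<alpha> \<beta> \<longleftrightarrow>
    (\<exists>f \<in> Reg1 C H A. f \<cdot> Pi_L C H = u \<and> tm f \<cdot> twisted_core u u \<alpha> = tm u \<cdot> twisted_core f f \<beta>)"
proof
  assume "equivalent_wcp C H A Z i p \<alpha> \<beta>"
  then obtain T S where T: "T \<in> Arr C" "Dom C T = Z" "Cod C T = Z"
    and S: "S \<in> Arr C" "Dom C S = Z" "Cod C S = Z"
    and ST: "S \<cdot> T = ident C Z" and TS: "T \<cdot> S = ident C Z"
    and unit: "T \<cdot> (p \<cdot> wcp_preunit C H A) = p \<cdot> wcp_preunit C H A"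
    and mult: "T \<cdot> (p \<cdot> wcp_mul C H A \<alpha> \<cdot> (i \<otimes> i)) = (p \<cdot> wcp_mul C H A \<beta> \<cdot> (i \<otimes> i)) \<cdot> (T \<otimes> T)"
    and linT: "T \<cdot> wcp_act C H A i p = wcp_act C H A i p \<cdot> (ident C (obj A) \<otimes> T)"
    and colT: "wcp_coact C H A i p \<cdot> T = (T \<otimes> ident C (obj H)) \<cdot> wcp_coact C H A i p"
    unfolding equivalent_wcp_def isomorphism_def algebra_morphism_def left_module_morphism_def
      right_comodule_morphism_def by (auto simp: wcp_algebra_def in_hom)
  let ?iA = "ident C (obj A)" and ?iH = "ident C (obj H)"
    and ?a = "wcp_act C H A i p" and ?r = "wcp_coact C H A i p"
  have linS: "S \<cdot> ?a = ?a \<cdot> (?iA \<otimes> S)"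
  proof -
    have "S \<cdot> ?a = S \<cdot> (?a \<cdot> ((?iA \<otimes> T) \<cdot> (?iA \<otimes> S)))"
      using S T by (simp add: interchange TS)
    also have "\<dots> = S \<cdot> ((T \<cdot> ?a) \<cdot> (?iA \<otimes> S))"
      unfolding linT using S T by (simp add: assoc)
    also have "\<dots> = (S \<cdot> T) \<cdot> (?a \<cdot> (?iA \<otimes> S))"
      using S T by (simp add: assoc)
    finally show ?thesis using S by (simp add: ST)
  qed
  have colS: "?r \<cdot> S = (S \<otimes> ?iH) \<cdot> ?r"
  proof -
    have "?r \<cdot> S = ((S \<otimes> ?iH) \<cdot> (T \<otimes> ?iH)) \<cdot> (?r \<cdot> S)"
      using S T by (simp add: interchange ST)
    also have "\<dots> = (S \<otimes> ?iH) \<cdot> (((T \<otimes> ?iH) \<cdot> ?r) \<cdot> S)"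
      using S T by (simp add: assoc)
    also have "\<dots> = (S \<otimes> ?iH) \<cdot> (?r \<cdot> (T \<cdot> S))"
      unfolding colT[symmetric] using S T by (simp add: assoc)
    finally show ?thesis by (simp add: TS)
  qed
  obtain f where f: "f \<in> Arr C" "Dom C f = obj H" "Cod C f = obj A" and Tf: "extend T = tm f"
    using linear_colinear_eq_tm[OF extend_arr[OF T]] linT colT linear_iff[OF T] colinear_iff[OF T] by metis
  obtain g where g: "g \<in> Arr C" "Dom C g = obj H" "Cod C g = obj A" and Sg: "extend S = tm g"
    using linear_colinear_eq_tm[OF extend_arr[OF S]] linS colS linear_iff[OF S] colinear_iff[OF S] by metis
  have arr: "\<mu>\<^bsub>A\<^esub> \<cdot> pair \<delta>\<^bsub>H\<^esub> k l \<in> Arr C" "Dom C (\<mu>\<^bsub>A\<^esub> \<cdot> pair \<delta>\<^bsub>H\<^esub> k l) = obj H"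
      "Cod C (\<mu>\<^bsub>A\<^esub> \<cdot> pair \<delta>\<^bsub>H\<^esub> k l) = obj A"
    if "k \<in> Arr C" "Dom C k = obj H" "Cod C k = obj A" "l \<in> Arr C" "Dom C l = obj H" "Cod C l = obj A" for k l
    using that by simp_all
  have conv: "\<mu>\<^bsub>A\<^esub> \<cdot> pair \<delta>\<^bsub>H\<^esub> k l = h"
    if "tm l \<cdot> tm k = tm h" "k \<in> Arr C" "Dom C k = obj H" "Cod C k = obj A"
      "l \<in> Arr C" "Dom C l = obj H" "Cod C l = obj A" "h \<in> Arr C" "Dom C h = obj H" "Cod C h = obj A"
    for k l h
    using that tm_comp[of l k] tm_inject[of "\<mu>\<^bsub>A\<^esub> \<cdot> pair \<delta>\<^bsub>H\<^esub> k l" h] arr[of k l] by simp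
  \<comment> \<open>Through \<open>tm_comp\<close> these composition laws become the four conditions
    of \<open>Reg1_iff\<close>, with \<open>g\<close> as the inverse.\<close>
  have "tm g \<cdot> tm f = tm u" "tm f \<cdot> tm g = tm u" "tm f \<cdot> tm u = tm f" "tm g \<cdot> tm u = tm g"
    using extend_comp[OF S T] extend_comp[OF T S] extend_nabla[OF T] extend_nabla[OF S]
    by (simp_all add: ST TS extend_ident Tf Sg)
  then have "\<mu>\<^bsub>A\<^esub> \<cdot> pair \<delta>\<^bsub>H\<^esub> f g = u \<and> \<mu>\<^bsub>A\<^esub> \<cdot> pair \<delta>\<^bsub>H\<^esub> g f = u \<and>
    \<mu>\<^bsub>A\<^esub> \<cdot> pair \<delta>\<^bsub>H\<^esub> u f = f \<and> \<mu>\<^bsub>A\<^esub> \<cdot> pair \<delta>\<^bsub>H\<^esub> u g = g"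
    using conv f g u_arr by metis
  then have "f \<in> Reg1 C H A"
    using f g by (auto simp: Reg1_iff in_hom)
  moreover have "f \<cdot> Pi_L C H = u"
    using unit unit_iff[OF T f Tf] fibre_unit_iff[OF f] by simp
  moreover have "tm f \<cdot> twisted_core u u \<alpha> = tm u \<cdot> twisted_core f f \<beta>"
    using mult mult_iff[OF T f Tf \<alpha> \<beta>] by simp
  ultimately show "\<exists>f \<in> Reg1 C H A. f \<cdot> Pi_L C H = u \<and> tm f \<cdot> twisted_core u u \<alpha> = tm u \<cdot> twisted_core f f \<beta>"
    by blast
next
  assume "\<exists>f \<in> Reg1 C H A. f \<cdot> Pi_L C H = u \<and> tm f \<cdot> twisted_core u u \<alpha> = tm u \<cdot> twisted_core f f \<beta>"
  then obtain f where reg: "f \<in> Reg1 C H A" and fPi: "f \<cdot> Pi_L C H = u"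
    and mult: "tm f \<cdot> twisted_core u u \<alpha> = tm u \<cdot> twisted_core f f \<beta>" by blast
  then obtain g where f: "f \<in> Arr C" "Dom C f = obj H" "Cod C f = obj A"
    and g: "g \<in> Arr C" "Dom C g = obj H" "Cod C g = obj A"
    and fg: "\<mu>\<^bsub>A\<^esub> \<cdot> pair \<delta>\<^bsub>H\<^esub> f g = u" "\<mu>\<^bsub>A\<^esub> \<cdot> pair \<delta>\<^bsub>H\<^esub> g f = u"
    and u_fg: "\<mu>\<^bsub>A\<^esub> \<cdot> pair \<delta>\<^bsub>H\<^esub> u f = f" "\<mu>\<^bsub>A\<^esub> \<cdot> pair \<delta>\<^bsub>H\<^esub> u g = g"
    unfolding Reg1_iff by (auto simp: in_hom)
  \<comment> \<open>As \<open>f\<close> absorbs \<open>u\<close> on both sides, \<open>tm f\<close>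
    survives restriction to \<open>Z\<close>: extending \<open>T\<close> gives back
    \<open>tm f\<close>.\<close>
  have fu: "tm u \<cdot> tm f = tm f" "tm f \<cdot> tm u = tm f"
    using Reg1_unital[OF reg] f by (simp_all add: tm_comp)
  define T S where "T = restrict (tm f)" and "S = restrict (tm g)"
  have T: "T \<in> Arr C" "Dom C T = Z" "Cod C T = Z" and S: "S \<in> Arr C" "Dom C S = Z" "Cod C S = Z"
    using f g by (simp_all add: T_def S_def)
  have Tf: "extend T = tm f"
    using extend_restrict[OF tm_arr[OF f]] by (simp add: T_def fu)
  have "extend S \<cdot> extend T = extend (ident C Z)" "extend T \<cdot> extend S = extend (ident C Z)"
  proof -
    have Sg: "extend S = tm u \<cdot> tm g"
      using extend_restrict[OF tm_arr[OF g]] g by (simp add: S_def tm_comp u_fg)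
    have "(tm u \<cdot> tm g) \<cdot> tm f = tm u \<cdot> (tm g \<cdot> tm f)" using f g by (simp add: assoc)
    also have "\<dots> = tm u \<cdot> tm u" using f g by (simp add: tm_comp fg)
    finally show "extend S \<cdot> extend T = extend (ident C Z)"
      using extend_nabla[of "ident C Z"] by (simp add: Sg Tf extend_ident)
    have "tm f \<cdot> (tm u \<cdot> tm g) = (tm f \<cdot> tm u) \<cdot> tm g" using f g by (simp add: assoc)
    then show "extend T \<cdot> extend S = extend (ident C Z)"
      using f g by (simp add: Sg Tf extend_ident fu) (simp add: tm_comp fg)
  qed
  then have "restrict (extend (S \<cdot> T)) = restrict (extend (ident C Z))"
    "restrict (extend (T \<cdot> S)) = restrict (extend (ident C Z))"
    using S T by (simp_all add: extend_comp)
  then have inv: "S \<cdot> T = ident C Z" "T \<cdot> S = ident C Z"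
    using S T by (simp_all add: restrict_extend)
  have "T \<cdot> (p \<cdot> wcp_preunit C H A) = p \<cdot> wcp_preunit C H A"
    using fPi unit_iff[OF T f Tf] fibre_unit_iff[OF f] by simp
  moreover have "T \<cdot> (p \<cdot> wcp_mul C H A \<alpha> \<cdot> (i \<otimes> i)) = (p \<cdot> wcp_mul C H A \<beta> \<cdot> (i \<otimes> i)) \<cdot> (T \<otimes> T)"
    using mult mult_iff[OF T f Tf \<alpha> \<beta>] by simp
  moreover have "T \<cdot> wcp_act C H A i p = wcp_act C H A i p \<cdot> (ident C (obj A) \<otimes> T)"
    using linear_iff[OF T] tm_linear[OF f] unfolding Tf by simp
  moreover have "wcp_coact C H A i p \<cdot> T = (T \<otimes> ident C (obj H)) \<cdot> wcp_coact C H A i p"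
    using colinear_iff[OF T] tm_colinear[OF f] unfolding Tf by simp
  ultimately show "equivalent_wcp C H A Z i p \<alpha> \<beta>"
    unfolding equivalent_wcp_def isomorphism_def algebra_morphism_def left_module_morphism_def
      right_comodule_morphism_def
    using S T inv by (intro exI[of _ T]) (auto simp: wcp_algebra_def in_hom)
qed

end

theorem theorem3p9:
  fixes C :: "('o, 'm, 'z) category_data_scheme" (structure)
    and H :: "('o, 'm) weak_hopf_data"
    and A :: "('o, 'm) module_algebra_data"
    and H_L AxH :: 'o
    and i_L p_L i p \<alpha> \<beta> :: 'm
  assumes "strict_symmetric_monoidal_category C"
    and "has_equalizers C"
    and "weak_hopf_algebra C H"
    and "cocommutative C H"
    and "splits_through C (Pi_L C H) (obj H) H_L i_L p_L"
    and "weak_module_algebra C H A"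
    and "splits_through C (nabla C H A) (obj A \<odot> obj H) AxH i p"
    and "\<alpha> \<in> Reg2_plus C H A" "twisted_condition C H A \<alpha>" "cocycle_condition C H A \<alpha>"
    and "\<beta> \<in> Reg2_plus C H A" "twisted_condition C H A \<beta>" "cocycle_condition C H A \<beta>"
  shows "equivalent_wcp C H A AxH i p \<alpha> \<beta> \<longleftrightarrow>
    (\<exists>f \<in> Reg1_plus C H A i_L.
      \<mu>\<^bsub>A\<^esub> \<cdot> (ident C (obj A) \<otimes> f) \<cdot> psi C H A
        = \<mu>\<^bsub>A\<^esub> \<cdot> (f \<otimes> \<phi>\<^bsub>A\<^esub>) \<cdot> (\<delta>\<^bsub>H\<^esub> \<otimes> ident C (obj A)) \<and>
      conv C (comul2 C H) A \<alpha> (d11 C H f)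
        = conv C (comul2 C H) A (conv C (comul2 C H) A (d10 C H A f) (d12 C H f)) \<beta>)"
proof -
  interpret strict_symmetric_monoidal_category C by fact
  interpret weak_action C H A by unfold_locales fact+
  interpret wcp_splitting C H A AxH i p by unfold_locales fact
  note \<alpha> = Reg2_plus_unital[OF \<open>\<alpha> \<in> Reg2_plus C H A\<close>]
    and \<beta> = Reg2_plus_unital[OF \<open>\<beta> \<in> Reg2_plus C H A\<close>]
  have L: "i_L \<in> Arr C" "Dom C i_L = H_L" "Cod C i_L = obj H"
    "p_L \<in> Arr C" "Dom C p_L = obj H" "Cod C p_L = H_L"
    "i_L \<cdot> p_L = Pi_L C H" "p_L \<cdot> i_L = ident C H_L"
    using assms(5) by (auto simp: splits_through_def in_hom)
  \<comment> \<open>\<open>p_L\<close> is a split epimorphism, so agreement on \<open>H_L\<close> is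
    agreement after \<open>Pi_L\<close>, and \<open>u\<close> is unchanged by
    \<open>Pi_L\<close>.\<close>
  have plus: "f \<in> Reg1_plus C H A i_L \<longleftrightarrow> f \<in> Reg1 C H A \<and> f \<cdot> Pi_L C H = u" for f
  proof -
    have Pi: "k \<cdot> i_L = l \<cdot> i_L \<longleftrightarrow> k \<cdot> Pi_L C H = l \<cdot> Pi_L C H"
      if k: "k \<in> Arr C" "Dom C k = obj H" and l: "l \<in> Arr C" "Dom C l = obj H" for k l
    proof -
      have *: "(m \<cdot> i_L) \<cdot> p_L = m \<cdot> Pi_L C H" "(m \<cdot> Pi_L C H) \<cdot> i_L = m \<cdot> i_L"
        if "m \<in> Arr C" "Dom C m = obj H" for m
        using that L by (simp_all add: assoc flip: L(7))
      show ?thesis using *[OF k] *[OF l] by metis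
    qed
    have "f \<cdot> i_L = u \<cdot> i_L \<longleftrightarrow> f \<cdot> Pi_L C H = u" if "f \<in> Reg1 C H A"
      using that Pi[of f u] u_Pi by (simp add: Reg1_iff in_hom)
    then show ?thesis by (auto simp: Reg1_plus_def)
  qed
  have "tm f \<cdot> twisted_core u u \<alpha> = tm u \<cdot> twisted_core f f \<beta> \<longleftrightarrow> commuting f \<and> cohomologous f \<alpha> \<beta>"
    if reg: "f \<in> Reg1 C H A" and fPi: "f \<cdot> Pi_L C H = u" for f
  proof -
    have f: "f \<in> Arr C" "Dom C f = obj H" "Cod C f = obj A"
      using reg by (auto simp: Reg1_iff in_hom)
    have "fibre f \<cdot> \<eta>\<^bsub>H\<^esub> = fibre u \<cdot> \<eta>\<^bsub>H\<^esub>"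
      using fPi fibre_unit_iff[OF f] by simp
    then show ?thesis
      using commutingI[OF \<alpha>(1) \<beta>(1) \<alpha>(2) \<beta>(2) f Reg1_unital(1)[OF reg]]
        cohomologousI[OF \<alpha>(1) \<beta>(1) f] twisted_core_eqI[OF \<alpha>(1) \<beta>(1) f] by blast
  qed
  moreover have "cohomologous f \<alpha> \<beta> \<longleftrightarrow> conv C (comul2 C H) A \<alpha> (d11 C H f)
        = conv C (comul2 C H) A (conv C (comul2 C H) A (d10 C H A f) (d12 C H f)) \<beta>"
    if "f \<in> Reg1 C H A" for f
    using cohomologous_iff[OF \<alpha>(1) \<beta>(1)] that by (simp add: Reg1_iff in_hom)
  ultimately show ?thesis
    unfolding equivalent_iff[OF \<alpha>(1) \<beta>(1)] Bex_def plus commuting_def by blast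
qed

end
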